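(* Let $\alpha\in(\mathbb{N}\cup\{0\})^n$ and let $x^0\in\mathbb{G}^{n+1}_\alpha$ be a Riemannian point. Every arc-length parametrized geodesic $x:[0,T]\to\mathbb{G}^{n+1}_\alpha$ with $x(0)=x^0$ has a unique lift $\lambda=(x,p)$ which satisfies Hamilton's equations $x_j'=\xi_j(x)^2p_j$, $p_j'=-\partial H/\partial x_j$ with initial covector $p(0)=p^0$ satisfying $H(x^0,p^0)=1/2$, and for $1\le j\le n+1$ $$x_j(t)=f_j\Big(\int_0^t\xi_j(x(s))^2ds\Big),\qquad p_j(t)=g_j\Big(\int_0^t\xi_j(x(s))^2ds\Big),$$ where $$f_j(s)=\begin{cases}x^0_j+p^0_js, & R_{j+1}=0\text{ or }\alpha_j=0,\\ A_j\sin_{\alpha_j}(\omega_js+\phi_j), & R_{j+1}\neq0\text{ and }\alpha_j\ge1,\end{cases}\qquad g_j(s)=\begin{cases}p^0_j, & R_{j+1}=0\text{ or }\alpha_j=0,\\ A_j\omega_j\cos_{\alpha_j}(\omega_js+\phi_j), & R_{j+1}\neq0\text{ and }\alpha_j\ge1.\end{cases}$$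
   Context: $\mathbb{G}^{n+1}_\alpha$ is $\mathbb{R}^{n+1}$ with the sub-Riemannian structure generated by $X_j=\xi_j\partial_{x_j}$, $\xi_j(x)=\prod_{i=1}^{j-1}x_i^{\alpha_i}$, and its Carnot–Carathéodory distance; a geodesic is a constant-speed horizontal curve that locally minimizes this distance. $H(x,p)=\tfrac12\sum_j\xi_j(x)^2p_j^2$. $J=\{j\le n:\alpha_j\neq0\}$; $x^0$ Riemannian means $x^0_j\neq0$ for $j\in J$. For real $a\ge1$: $\pi_a=2\int_0^1(1-t^{2a})^{-1/2}dt$; $\sin_a$ is the inverse of $s\mapsto\int_0^s(1-t^{2a})^{-1/2}dt$ on $[0,\pi_a/2]$, extended by $\sin_a(s)=\sin_a(\pi_a-s)$ to $[0,\pi_a]$, oddly and $2\pi_a$-periodically; $\cos_a=\sin_a'$; $\rho_\theta(s)=|s|^{\theta-1}s$. Spherical coordinates of $p^0$: $\tilde\alpha_j=\alpha_j$ ($j\in J$), $=1$ otherwise; $\tilde x^0_j=x^0_j$ ($j\in J$), $=1$ otherwise; $\phi\in\prod_{j\le n-1}[0,\pi_{\tilde\alpha_j}]\times[0,2\pi_{\tilde\alpha_n})$ with $p^0_j=\cos_{\tilde\alpha_j}(\phi_j)\prod_{i<j}\delta_i$ ($j\le n$), $p^0_{n+1}=\prod_{i\le n}\delta_i$, $\delta_i=\rho_{\tilde\alpha_i}(\sin_{\tilde\alpha_i}(\phi_i)/\tilde x^0_i)$. For $j\in J$ with $\sin_{\alpha_j}(\phi_j)\neq0$: $A_j=x^0_j/\sin_{\alpha_j}(\phi_j)$,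 $\omega_j=\frac{\sin_{\alpha_j}(\phi_j)}{x^0_j}\prod_{i<j}\delta_i$. Constants: $R_{n+2}=0$, $R_{n+1}=|p^0_{n+1}|$, $R_j=\sqrt{R_{j+1}^2(x^0_j)^{2\alpha_j}+(p^0_j)^2}$ for $j\le n$. *)

theory Defs
  imports "HOL-Analysis.Analysis"
begin

(* Conventions: points of R^{n+1} are functions nat => real, only coordinates 1..n+1 matter.
   alpha :: nat => nat, only alpha 1 .. alpha n matter. Curves are real => (nat => real). *)

definition xi :: "(nat \<Rightarrow> nat) \<Rightarrow> nat \<Rightarrow> (nat \<Rightarrow> real) \<Rightarrow> real" where
  "xi \<alpha> j x = (\<Prod>i\<in>{1..<j}. x i ^ \<alpha> i)"

definition Ham :: "(nat \<Rightarrow> nat) \<Rightarrow> nat \<Rightarrow> (nat \<Rightarrow> real) \<Rightarrow> (nat \<Rightarrow> real) \<Rightarrow> real" where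
  "Ham \<alpha> n x p = (1/2) * (\<Sum>j\<in>{1..n+1}. (xi \<alpha> j x)^2 * (p j)^2)"

definition dHam_dx :: "(nat \<Rightarrow> nat) \<Rightarrow> nat \<Rightarrow> nat \<Rightarrow> (nat \<Rightarrow> real) \<Rightarrow> (nat \<Rightarrow> real) \<Rightarrow> real" where
  "dHam_dx \<alpha> n j x p = deriv (\<lambda>s. Ham \<alpha> n (x(j := s)) p) (x j)"

(* h is a control for the curve gamma on [a,b]:  gamma' = sum_j h_j X_j(gamma)  (absolutely continuous,
   written in integral form) with integrable controls *)
definition horiz_control ::
  "(nat \<Rightarrow> nat) \<Rightarrow> nat \<Rightarrow> real \<Rightarrow> real \<Rightarrow> (real \<Rightarrow> nat \<Rightarrow> real) \<Rightarrow> (real \<Rightarrow> nat \<Rightarrow> real) \<Rightarrow> bool" where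
  "horiz_control \<alpha> n a b \<gamma> h \<longleftrightarrow> a \<le> b \<and>
     (\<forall>j\<in>{1..n+1}. set_integrable lborel {a..b} (\<lambda>s. h s j) \<and>
        set_integrable lborel {a..b} (\<lambda>s. h s j * xi \<alpha> j (\<gamma> s)) \<and>
        (\<forall>t\<in>{a..b}. \<gamma> t j = \<gamma> a j + (LINT s:{a..t}|lborel. h s j * xi \<alpha> j (\<gamma> s))))"

definition horizontal :: "(nat \<Rightarrow> nat) \<Rightarrow> nat \<Rightarrow> real \<Rightarrow> real \<Rightarrow> (real \<Rightarrow> nat \<Rightarrow> real) \<Rightarrow> bool" where
  "horizontal \<alpha> n a b \<gamma> \<longleftrightarrow> (\<exists>h. horiz_control \<alpha> n a b \<gamma> h)"

definition ctrl_length :: "nat \<Rightarrow> real \<Rightarrow> real \<Rightarrow> (real \<Rightarrow> nat \<Rightarrow> real) \<Rightarrow> real" where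
  "ctrl_length n a b h = (LINT s:{a..b}|lborel. sqrt (\<Sum>j\<in>{1..n+1}. (h s j)^2))"

definition curve_length :: "(nat \<Rightarrow> nat) \<Rightarrow> nat \<Rightarrow> real \<Rightarrow> real \<Rightarrow> (real \<Rightarrow> nat \<Rightarrow> real) \<Rightarrow> real" where
  "curve_length \<alpha> n a b \<gamma> = Inf {ctrl_length n a b h | h. horiz_control \<alpha> n a b \<gamma> h}"

definition cc_dist :: "(nat \<Rightarrow> nat) \<Rightarrow> nat \<Rightarrow> (nat \<Rightarrow> real) \<Rightarrow> (nat \<Rightarrow> real) \<Rightarrow> real" where
  "cc_dist \<alpha> n x y = Inf {curve_length \<alpha> n a b \<gamma> | a b \<gamma>. horizontal \<alpha> n a b \<gamma> \<and>
       (\<forall>j\<in>{1..n+1}. \<gamma> a j = x j \<and> \<gamma> b j = y j)}"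

definition arclength_geodesic :: "(nat \<Rightarrow> nat) \<Rightarrow> nat \<Rightarrow> real \<Rightarrow> (real \<Rightarrow> nat \<Rightarrow> real) \<Rightarrow> bool" where
  "arclength_geodesic \<alpha> n T x \<longleftrightarrow> 0 < T \<and> horizontal \<alpha> n 0 T x \<and>
     (\<forall>s t. 0 \<le> s \<longrightarrow> s \<le> t \<longrightarrow> t \<le> T \<longrightarrow> curve_length \<alpha> n s t x = t - s) \<and>
     (\<forall>t\<in>{0..T}. \<exists>\<epsilon>>0. \<forall>s1\<in>{0..T}. \<forall>s2\<in>{0..T}. \<bar>s1 - t\<bar> < \<epsilon> \<longrightarrow> \<bar>s2 - t\<bar> < \<epsilon> \<longrightarrow>
        cc_dist \<alpha> n (x s1) (x s2) = \<bar>s2 - s1\<bar>)"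

definition riemannian_point :: "(nat \<Rightarrow> nat) \<Rightarrow> nat \<Rightarrow> (nat \<Rightarrow> real) \<Rightarrow> bool" where
  "riemannian_point \<alpha> n x0 \<longleftrightarrow> (\<forall>j\<in>{1..n}. \<alpha> j \<noteq> 0 \<longrightarrow> x0 j \<noteq> 0)"

definition ham_lift :: "(nat \<Rightarrow> nat) \<Rightarrow> nat \<Rightarrow> real \<Rightarrow> (real \<Rightarrow> nat \<Rightarrow> real) \<Rightarrow> (real \<Rightarrow> nat \<Rightarrow> real) \<Rightarrow> bool" where
  "ham_lift \<alpha> n T x p \<longleftrightarrow>
     (\<forall>t\<in>{0..T}. \<forall>j\<in>{1..n+1}.
        ((\<lambda>s. x s j) has_real_derivative (xi \<alpha> j (x t))^2 * p t j) (at t within {0..T}) \<and>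
        ((\<lambda>s. p s j) has_real_derivative - dHam_dx \<alpha> n j (x t) (p t)) (at t within {0..T})) \<and>
     Ham \<alpha> n (x 0) (p 0) = 1/2"

definition Fa :: "real \<Rightarrow> real \<Rightarrow> real" where
  "Fa a s = (LINT t:{0..s}|lborel. 1 / sqrt (1 - t powr (2*a)))"

definition pi_a :: "real \<Rightarrow> real" where
  "pi_a a = 2 * Fa a 1"

definition sin_a0 :: "real \<Rightarrow> real \<Rightarrow> real" where
  "sin_a0 a y = (THE s. s \<in> {0..1} \<and> Fa a s = y)"

definition sin_a1 :: "real \<Rightarrow> real \<Rightarrow> real" where
  "sin_a1 a y = (if y \<le> pi_a a / 2 then sin_a0 a y else sin_a0 a (pi_a a - y))"

(* odd, 2 pi_a periodic extension *)
definition sin_a :: "real \<Rightarrow> real \<Rightarrow> real" where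
  "sin_a a y = (let r = y - 2 * pi_a a * of_int \<lfloor>y / (2 * pi_a a)\<rfloor> in
     if r \<le> pi_a a then sin_a1 a r else - sin_a1 a (2 * pi_a a - r))"

definition cos_a :: "real \<Rightarrow> real \<Rightarrow> real" where
  "cos_a a y = deriv (sin_a a) y"

definition rho :: "nat \<Rightarrow> real \<Rightarrow> real" where
  "rho \<theta> s = \<bar>s\<bar> ^ (\<theta> - 1) * s"

definition alpha_t :: "(nat \<Rightarrow> nat) \<Rightarrow> nat \<Rightarrow> nat" where
  "alpha_t \<alpha> j = (if \<alpha> j \<noteq> 0 then \<alpha> j else 1)"

definition x_t :: "(nat \<Rightarrow> nat) \<Rightarrow> (nat \<Rightarrow> real) \<Rightarrow> nat \<Rightarrow> real" where
  "x_t \<alpha> x0 j = (if \<alpha> j \<noteq> 0 then x0 j else 1)"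

definition sdelta :: "(nat \<Rightarrow> nat) \<Rightarrow> (nat \<Rightarrow> real) \<Rightarrow> (nat \<Rightarrow> real) \<Rightarrow> nat \<Rightarrow> real" where
  "sdelta \<alpha> x0 \<phi> i = rho (alpha_t \<alpha> i) (sin_a (alpha_t \<alpha> i) (\<phi> i) / x_t \<alpha> x0 i)"

definition spherical_coords :: "(nat \<Rightarrow> nat) \<Rightarrow> nat \<Rightarrow> (nat \<Rightarrow> real) \<Rightarrow> (nat \<Rightarrow> real) \<Rightarrow> (nat \<Rightarrow> real) \<Rightarrow> bool" where
  "spherical_coords \<alpha> n x0 p0 \<phi> \<longleftrightarrow>
     (\<forall>j\<in>{1..<n}. 0 \<le> \<phi> j \<and> \<phi> j \<le> pi_a (alpha_t \<alpha> j)) \<and>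
     0 \<le> \<phi> n \<and> \<phi> n < 2 * pi_a (alpha_t \<alpha> n) \<and>
     (\<forall>j\<in>{1..n}. p0 j = cos_a (alpha_t \<alpha> j) (\<phi> j) * (\<Prod>i\<in>{1..<j}. sdelta \<alpha> x0 \<phi> i)) \<and>
     p0 (n+1) = (\<Prod>i\<in>{1..n}. sdelta \<alpha> x0 \<phi> i)"

definition A_coef :: "(nat \<Rightarrow> nat) \<Rightarrow> (nat \<Rightarrow> real) \<Rightarrow> (nat \<Rightarrow> real) \<Rightarrow> nat \<Rightarrow> real" where
  "A_coef \<alpha> x0 \<phi> j = x0 j / sin_a (\<alpha> j) (\<phi> j)"

definition omega :: "(nat \<Rightarrow> nat) \<Rightarrow> (nat \<Rightarrow> real) \<Rightarrow> (nat \<Rightarrow> real) \<Rightarrow> nat \<Rightarrow> real" where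
  "omega \<alpha> x0 \<phi> j = sin_a (\<alpha> j) (\<phi> j) / x0 j * (\<Prod>i\<in>{1..<j}. sdelta \<alpha> x0 \<phi> i)"

(* Rdown k = R_{n+2-k}:  R_{n+2} = 0,  R_j = sqrt(R_{j+1}^2 x0_j^(2 alpha_j) + p0_j^2);
   for j = n+1 this gives |p0_{n+1}| since R_{n+2} = 0. *)
primrec Rdown :: "(nat \<Rightarrow> nat) \<Rightarrow> nat \<Rightarrow> (nat \<Rightarrow> real) \<Rightarrow> (nat \<Rightarrow> real) \<Rightarrow> nat \<Rightarrow> real" where
  "Rdown \<alpha> n x0 p0 0 = 0"
| "Rdown \<alpha> n x0 p0 (Suc k) = sqrt ((Rdown \<alpha> n x0 p0 k)^2 * (x0 (n+1-k))^(2 * \<alpha> (n+1-k)) + (p0 (n+1-k))^2)"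

definition R_const :: "(nat \<Rightarrow> nat) \<Rightarrow> nat \<Rightarrow> (nat \<Rightarrow> real) \<Rightarrow> (nat \<Rightarrow> real) \<Rightarrow> nat \<Rightarrow> real" where
  "R_const \<alpha> n x0 p0 j = Rdown \<alpha> n x0 p0 (n + 2 - j)"

end

(* The coordinates are triangular: xi_j depends only on x_1, ..., x_(j-1). Hence a variation of the
   control of a length minimizer can be corrected coordinate by coordinate, by a multiple of xi_j in
   the j-th control, so that the end point stays fixed; each correction solves a linear equation whose
   coefficient is close to the integral of xi_j^2, and this is nonzero as soon as xi_j is not
   identically zero along the curve. The first variation then yields u_j = p_j xi_j with p a solution
   of the adjoint equation, that is, Hamilton's equations, on every short interval containing a
   nonsingular time. The quantities R_j are conserved, and they prevent a curve issuing from a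
   Riemannian point from staying in the singular set during an interval of time. Therefore covectors
   are unique and the local lifts can be glued. In the time given by the integral of xi_j^2, the pair
   (x_j, p_j) solves X' = P, P' = - alpha_j R_(j+1)^2 X^(2 alpha_j - 1), whose solutions are the
   functions sin_a and cos_a. *)

theory Submission
  imports Defs
begin

text \<open>A length minimizer may in general be an abnormal extremal, and a strictly abnormal one
  need not satisfy Hamilton's equations. Here the correction of the end point succeeds in every
  coordinate once each xi_j is nonzero somewhere on the interval, and this rules the abnormal
  alternative out. The obstacle is that this nonvanishing is known in advance only at time 0:
  elsewhere it follows from conserved quantities, and these need a lift. So the lift is continued
  forward by short intervals, each of which reaches back into the part already lifted to meet a
  nonsingular time. Controls are merely measurable, so the variation is computed with integrals:
  length is replaced by energy through sqrt s <= (1 + s) / 2, and products of Lipschitz functions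
  are integrated by parts. Differentiability enters only after u_j = p_j xi_j has made the
  integrands almost everywhere equal to continuous functions. The value H = 1/2 is the unit speed of
  the least control, read off at one time of the first interval and carried to time 0 by
  conservation.\<close>

section \<open>Derivatives within closed intervals: joining, reflection, transfer\<close>

lemma has_field_derivative_within_Un:
  fixes f :: "real \<Rightarrow> real"
  assumes "t \<in> A \<Longrightarrow> (f has_field_derivative D) (at t within A)"
    and "t \<in> B \<Longrightarrow> (f has_field_derivative D) (at t within B)"
    and "closed A" "closed B"
  shows "(f has_field_derivative D) (at t within (A \<union> B))"
proof -
  \<comment> \<open>Away from a closed set the filter \<open>at t within C\<close> is trivial and
    every number is a derivative; this is why the hypotheses may be conditional on
    membership.\<close>
  have "(f has_field_derivative D) (at t within C)" if "t \<notin> C" "closed C" for C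
  proof -
    have "\<not> t islimpt C" using that closed_limpt by blast
    then have "at t within C = bot" by (simp add: trivial_limit_within)
    then show ?thesis by (simp add: has_field_derivative_iff)
  qed
  then have "(f has_field_derivative D) (at t within A)" "(f has_field_derivative D) (at t within B)"
    using assms by blast+
  then show ?thesis
    unfolding has_field_derivative_iff by (rule Lim_Un)
qed

lemma has_field_derivative_Icc_join:
  fixes f :: "real \<Rightarrow> real"
  assumes "\<And>t. t \<in> {a..b} \<Longrightarrow> (f has_field_derivative d t) (at t within {a..b})"
    and "\<And>t. t \<in> {b..c} \<Longrightarrow> (f has_field_derivative d t) (at t within {b..c})"
    and "a \<le> b" "b \<le> c"
  shows "(f has_field_derivative d t) (at t within {a..c})"
proof -
  have "{a..c} = {a..b} \<union> {b..c}" using assms by auto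
  then show ?thesis using has_field_derivative_within_Un[of t "{a..b}" f "d t" "{b..c}"] assms(1,2)[of t] by auto
qed

lemma has_field_derivative_reflect:
  fixes f :: "real \<Rightarrow> real"
  assumes "\<And>t. t \<in> {a..b} \<Longrightarrow> (f has_field_derivative d t) (at t within {a..b})"
    and "t \<in> {c-b..c-a}"
  shows "((\<lambda>y. f (c - y)) has_field_derivative - d (c - t)) (at t within {c-b..c-a})"
proof -
  have "(\<lambda>y. c - y) ` {c-b..c-a} = {a..b}"
    by auto
  then have "(f has_field_derivative d (c - t)) (at (c - t) within (\<lambda>y. c - y) ` {c-b..c-a})"
    using assms by auto
  moreover have "((\<lambda>y. c - y) has_field_derivative -1) (at t within {c-b..c-a})"
    by (auto intro!: derivative_eq_intros)
  ultimately show ?thesis using DERIV_image_chain[of f _ "\<lambda>y. c - y" t "{c-b..c-a}" "-1"] by (simp add: o_def)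
qed

lemma has_field_derivative_cong_on:
  fixes f g :: "real \<Rightarrow> real"
  assumes "(f has_field_derivative D) (at t within S)" "t \<in> S" "\<And>s. s \<in> S \<Longrightarrow> f s = g s"
    and "D = E" "S = S'"
  shows "(g has_field_derivative E) (at t within S')"
  using assms has_field_derivative_transform_within[OF assms(1), of 1 g] by auto

subsection \<open>The generalized trigonometric functions\<close>

text \<open>Named so that the \<open>powr\<close> in \<open>Fa\<close> can be traded for an integer
  power on t >= 0.\<close>

definition arc_integrand :: "nat \<Rightarrow> real \<Rightarrow> real" where
  "arc_integrand a t = 1 / sqrt (1 - t powr (2 * real a))"

context
  fixes a :: nat
  assumes a: "1 \<le> a"
begin

lemma arc_integrand_eq: "0 \<le> t \<Longrightarrow> arc_integrand a t = 1 / sqrt (1 - t ^ (2 * a))"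
proof -
  assume "0 \<le> t"
  then have "t powr (2 * real a) = t ^ (2 * a)"
    using powr_realpow[of t "2 * a"] a by (cases "t = 0") auto
  then show ?thesis by (simp add: arc_integrand_def)
qed

lemma pow_less_one: "0 \<le> t \<Longrightarrow> t < 1 \<Longrightarrow> (t::real) ^ (2 * a) < 1"
  using a by (simp add: power_less_one_iff)

lemma arc_integrand_ge_1: "0 \<le> t \<Longrightarrow> t < 1 \<Longrightarrow> 1 \<le> arc_integrand a t"
  using pow_less_one[of t] by (simp add: arc_integrand_eq)

text \<open>Since a >= 1, t^(2a) <= t on [0,1], so the singularity at 1 is no worse than that of 1 /
  sqrt (1 - t). At t = 1 both sides are 1 / 0 = 0.\<close>

lemma arc_integrand_bound: "0 \<le> t \<Longrightarrow> t \<le> 1 \<Longrightarrow> \<bar>arc_integrand a t\<bar> \<le> 1 / sqrt (1 - t)"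
proof (cases "t = 1")
  case False
  assume t: "0 \<le> t" "t \<le> 1"
  have "t ^ (2 * a) \<le> t ^ 1" using t a by (intro power_decreasing) auto
  then have "1 - t \<le> 1 - t ^ (2 * a)" by simp
  moreover have "0 < 1 - t" using t False by simp
  ultimately have "1 / sqrt (1 - t ^ (2 * a)) \<le> 1 / sqrt (1 - t)"
    by (intro divide_left_mono) (auto intro!: mult_pos_pos)
  then show ?thesis using t False pow_less_one[of t] by (simp add: arc_integrand_eq)
qed (simp add: arc_integrand_eq)

lemma arc_integrable: "set_integrable lborel {0..1} (arc_integrand a)"
proof -
  have h: "((\<lambda>t. 1 / sqrt (1 - t)) has_integral (-2 * sqrt (1 - 1)) - (-2 * sqrt (1 - 0))) {0..1::real}"
  proof (rule fundamental_theorem_of_calculus_interior)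
    show "continuous_on {0..1} (\<lambda>t::real. -2 * sqrt (1 - t))"
      by (intro continuous_intros)
    fix x :: real assume "x \<in> {0<..<1}"
    then show "((\<lambda>t. -2 * sqrt (1 - t)) has_vector_derivative 1 / sqrt (1 - x)) (at x)"
      unfolding has_real_derivative_iff_has_vector_derivative[symmetric]
      by (auto intro!: derivative_eq_intros simp: field_simps)
  qed simp
  have "(\<lambda>t. 1 / sqrt (1 - t)) absolutely_integrable_on {0..1::real}"
    using h by (intro nonnegative_absolutely_integrable_1) (auto simp: integrable_on_def)
  then have 1: "set_integrable lborel {0..1} (\<lambda>t::real. 1 / sqrt (1 - t))"
    unfolding set_integrable_def by (subst (asm) integrable_completion) auto
  show ?thesis
    by (rule set_integrable_bound[OF 1])
       (use arc_integrand_bound in \<open>auto simp: arc_integrand_def set_borel_measurable_def\<close>)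
qed

lemma Fa_eq_integral:
  assumes "0 \<le> s" "s \<le> 1"
  shows "Fa a s = integral {0..s} (arc_integrand a)"
proof -
  have "set_integrable lborel {0..s} (arc_integrand a)"
    by (rule set_integrable_subset[OF arc_integrable]) (use assms in auto)
  from set_borel_integral_eq_integral(2)[OF this] show ?thesis
    by (simp add: Fa_def arc_integrand_def)
qed

lemma Fa_continuous: "continuous_on {0..1} (Fa a)"
proof -
  have "continuous_on {0..1} (\<lambda>s. integral {0..s} (arc_integrand a))"
    using set_borel_integral_eq_integral(1)[OF arc_integrable] by (rule indefinite_integral_continuous_1)
  then show ?thesis by (subst continuous_on_cong[OF refl Fa_eq_integral]) auto
qed

lemma Fa_deriv:
  assumes s: "0 < s" "s < 1"
  shows "(Fa a has_real_derivative arc_integrand a s) (at s)"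
proof -
  \<comment> \<open>Any point strictly between s and 1 would do: on {0..r} the integrand stays away
    from its singularity and is continuous.\<close>
  define r where "r = (1 + s) / 2"
  have r: "s < r" "r < 1" "0 < r" using s by (auto simp: r_def)
  have "t ^ (2 * a) \<noteq> 1" if "t \<in> {0..r}" for t
    using pow_less_one[of t] r that by auto
  then have "continuous_on {0..r} (\<lambda>t. 1 / sqrt (1 - t ^ (2 * a)))"
    by (intro continuous_intros) auto
  then have "continuous_on {0..r} (arc_integrand a)"
    by (subst continuous_on_cong[OF refl arc_integrand_eq]) auto
  from integral_has_real_derivative[OF this, of s] s r
  have "((\<lambda>x. integral {0..x} (arc_integrand a)) has_real_derivative arc_integrand a s) (at s within {0..r})"
    by auto
  then have "(Fa a has_real_derivative arc_integrand a s) (at s within {0..r})"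
    by (rule has_field_derivative_cong_on) (use s r in \<open>auto simp: Fa_eq_integral\<close>)
  then show ?thesis using s r by (simp add: at_within_Icc_at)
qed

lemma Fa_strict_mono:
  assumes "0 \<le> s" "s < t" "t \<le> 1"
  shows "Fa a s < Fa a t"
proof (rule DERIV_pos_imp_increasing_open[OF assms(2)])
  fix x assume "s < x" "x < t"
  then have "(Fa a has_real_derivative arc_integrand a x) (at x)" "0 < arc_integrand a x"
    using assms Fa_deriv[of x] arc_integrand_ge_1[of x] by auto
  then show "\<exists>y. (Fa a has_real_derivative y) (at x) \<and> y > 0" by blast
next
  show "continuous_on {s..t} (Fa a)" by (rule continuous_on_subset[OF Fa_continuous]) (use assms in auto)
qed

lemma Fa_0: "Fa a 0 = 0"
  by (simp add: Fa_eq_integral)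

abbreviation quarter ("P") where "P \<equiv> Fa a 1"

lemma pi_a_eq: "pi_a a = 2 * P" by (simp add: pi_a_def)

lemma quarter_pos: "0 < P"
  using Fa_strict_mono[of 0 1] by (simp add: Fa_0)

lemma pi_a_pos: "0 < pi_a a" using quarter_pos by (simp add: pi_a_eq)

lemma sin_a0_prop:
  assumes "0 \<le> y" "y \<le> P"
  shows "sin_a0 a y \<in> {0..1} \<and> Fa a (sin_a0 a y) = y"
  unfolding sin_a0_def
proof (rule theI')
  have "\<exists>s. 0 \<le> s \<and> s \<le> 1 \<and> Fa a s = y"
    by (rule IVT') (use assms Fa_0 Fa_continuous in auto)
  then obtain s where "s \<in> {0..1}" "Fa a s = y" by auto
  moreover have "t = s" if "t \<in> {0..1}" "Fa a t = y" for t
    using Fa_strict_mono[of s t] Fa_strict_mono[of t s] that \<open>s \<in> {0..1}\<close> \<open>Fa a s = y\<close>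
    by (cases s t rule: linorder_cases) auto
  ultimately show "\<exists>!s. s \<in> {0..1} \<and> Fa a s = y" by blast
qed

lemma sin_a0_Fa:
  assumes "0 \<le> s" "s \<le> 1"
  shows "sin_a0 a (Fa a s) = s"
proof -
  have "0 \<le> Fa a s" "Fa a s \<le> P"
    using Fa_strict_mono[of 0 s] Fa_strict_mono[of s 1] assms Fa_0 by (cases "s = 0"; cases "s = 1"; force)+
  from sin_a0_prop[OF this] show ?thesis
    using Fa_strict_mono[of s "sin_a0 a (Fa a s)"] Fa_strict_mono[of "sin_a0 a (Fa a s)" s] assms
    by (cases s "sin_a0 a (Fa a s)" rule: linorder_cases) auto
qed

lemma sin_a0_0: "sin_a0 a 0 = 0" and sin_a0_quarter: "sin_a0 a P = 1"
  using sin_a0_Fa[of 0] sin_a0_Fa[of 1] by (auto simp: Fa_0)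

lemma sin_a0_continuous: "continuous_on {0..P} (sin_a0 a)"
proof -
  have im: "Fa a ` {0..1} = {0..P}"
  proof (intro equalityI subsetI)
    fix y assume "y \<in> Fa a ` {0..1}"
    then obtain s where "s \<in> {0..1}" "y = Fa a s" by auto
    then show "y \<in> {0..P}"
      using Fa_strict_mono[of 0 s] Fa_strict_mono[of s 1] Fa_0 by (cases "s = 0"; cases "s = 1"; force)
  next
    fix y assume "y \<in> {0..P}"
    then have "sin_a0 a y \<in> {0..1} \<and> Fa a (sin_a0 a y) = y" by (intro sin_a0_prop) auto
    then show "y \<in> Fa a ` {0..1}" by force
  qed
  have "continuous_on (Fa a ` {0..1}) (sin_a0 a)"
    by (rule continuous_on_inv[OF Fa_continuous]) (auto simp: sin_a0_Fa)
  then show ?thesis by (simp add: im)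
qed

text \<open>The relation cos^2 + sin^(2a) = 1 solved for the cosine on the first quarter, where it
  is nonnegative. Unlike \<open>cos_a\<close>, which is a \<open>deriv\<close>, this is visibly
  continuous up to the end points.\<close>

definition cos_a0 :: "real \<Rightarrow> real" where "cos_a0 y = sqrt (1 - sin_a0 a y ^ (2 * a))"

lemma cos_a0_continuous: "continuous_on {0..P} cos_a0"
  unfolding cos_a0_def by (intro continuous_intros sin_a0_continuous)

lemma sin_a0_interior:
  assumes "0 < y" "y < P"
  shows "0 < sin_a0 a y" "sin_a0 a y < 1"
proof -
  have *: "sin_a0 a y \<in> {0..1}" "Fa a (sin_a0 a y) = y" using sin_a0_prop[of y] assms by auto
  then show "0 < sin_a0 a y" "sin_a0 a y < 1" using assms Fa_0
    by (cases "sin_a0 a y = 0"; force; fail) (use * assms in \<open>cases "sin_a0 a y = 1"; force\<close>)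
qed

lemma sin_a0_deriv_interior:
  assumes y: "0 < y" "y < P"
  shows "(sin_a0 a has_real_derivative cos_a0 y) (at y)"
proof -
  note i = sin_a0_interior[OF y]
  have c: "isCont (sin_a0 a) y"
    using continuous_on_interior[OF sin_a0_continuous] y by auto
  have "(sin_a0 a has_real_derivative inverse (arc_integrand a (sin_a0 a y))) (at y)"
    by (rule DERIV_inverse_function[OF Fa_deriv[OF i] _ y _ c])
       (use arc_integrand_ge_1[of "sin_a0 a y"] i sin_a0_prop in auto)
  then show ?thesis using i by (simp add: arc_integrand_eq cos_a0_def)
qed

lemma cos_a0_deriv_interior:
  assumes y: "0 < y" "y < P"
  shows "(cos_a0 has_real_derivative - (real a * sin_a0 a y ^ (2 * a - 1))) (at y)"
proof -
  have "0 < 1 - sin_a0 a y ^ (2 * a)" using sin_a0_interior[OF y] pow_less_one[of "sin_a0 a y"] by auto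
  then show ?thesis
    unfolding cos_a0_def[abs_def]
    by (auto intro!: derivative_eq_intros sin_a0_deriv_interior[OF y] simp: cos_a0_def field_simps)
qed

text \<open>At the end points of the interval, in particular at \<open>P\<close>, where the inverse function theorem
  does not apply, the derivative is recovered by writing the function as the integral of its continuous
  interior derivative.\<close>

lemma deriv_within_closure:
  fixes f g :: "real \<Rightarrow> real"
  assumes "continuous_on {0..b} f" "continuous_on {0..b} g"
    "\<And>y. 0 < y \<Longrightarrow> y < b \<Longrightarrow> (f has_real_derivative g y) (at y)" "y \<in> {0..b}"
  shows "(f has_real_derivative g y) (at y within {0..b})"
proof -
  have eq: "f 0 + integral {0..t} g = f t" if "t \<in> {0..b}" for t
  proof -
    have "(g has_integral (f t - f 0)) {0..t}"
      using assms that
      by (intro fundamental_theorem_of_calculus_interior)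
         (auto simp: has_real_derivative_iff_has_vector_derivative[symmetric] intro: continuous_on_subset)
    then show ?thesis by (simp add: integral_unique)
  qed
  have "((\<lambda>t. f 0 + integral {0..t} g) has_real_derivative g y) (at y within {0..b})"
    using integral_has_real_derivative[OF assms(2,4)] by (auto intro!: derivative_eq_intros)
  then show ?thesis by (rule has_field_derivative_cong_on) (use assms eq in auto)
qed

lemma sin_a0_deriv: "y \<in> {0..P} \<Longrightarrow> (sin_a0 a has_real_derivative cos_a0 y) (at y within {0..P})"
  by (rule deriv_within_closure) (auto intro: sin_a0_continuous cos_a0_continuous sin_a0_deriv_interior)

lemma cos_a0_deriv:
  "y \<in> {0..P} \<Longrightarrow> (cos_a0 has_real_derivative - (real a * sin_a0 a y ^ (2 * a - 1))) (at y within {0..P})"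
  by (rule deriv_within_closure) (auto intro!: continuous_intros sin_a0_continuous cos_a0_continuous cos_a0_deriv_interior[simplified])

section \<open>Extension by reflections and by periodicity\<close>

definition cos_a1 :: "real \<Rightarrow> real" where
  "cos_a1 y = (if y \<le> P then cos_a0 y else - cos_a0 (2 * P - y))"

lemma cos_a0_quarter: "cos_a0 P = 0" and cos_a0_0: "cos_a0 0 = 1"
  using a by (auto simp: cos_a0_def sin_a0_quarter sin_a0_0)

lemma sin_a1_P: "sin_a1 a y = (if y \<le> P then sin_a0 a y else sin_a0 a (2 * P - y))"
  by (simp add: sin_a1_def pi_a_eq)

lemma sin_a1_upper: "P \<le> y \<Longrightarrow> sin_a1 a y = sin_a0 a (2 * P - y)"
  and cos_a1_upper: "P \<le> y \<Longrightarrow> cos_a1 y = - cos_a0 (2 * P - y)"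
  by (cases "y = P"; simp add: sin_a1_P cos_a1_def cos_a0_quarter)+

lemma sin_a1_deriv:
  assumes "y \<in> {0..2 * P}"
  shows "(sin_a1 a has_real_derivative cos_a1 y) (at y within {0..2 * P})"
proof (rule has_field_derivative_Icc_join[where b = P])
  fix t assume t: "t \<in> {0..P}"
  show "(sin_a1 a has_real_derivative cos_a1 t) (at t within {0..P})"
    by (rule has_field_derivative_cong_on[of "sin_a0 a"])
       (use t sin_a0_deriv[of t] in \<open>auto simp: sin_a1_P cos_a1_def\<close>)
next
  fix t assume t: "t \<in> {P..2 * P}"
  have "((\<lambda>y. sin_a0 a (2 * P - y)) has_real_derivative - cos_a0 (2 * P - t)) (at t within {2 * P - P..2 * P - 0})"
    by (rule has_field_derivative_reflect[OF sin_a0_deriv]) (use t in auto)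
  then show "(sin_a1 a has_real_derivative cos_a1 t) (at t within {P..2 * P})"
    by (rule has_field_derivative_cong_on)
       (use t in \<open>auto simp: sin_a1_upper cos_a1_upper\<close>)
qed (use quarter_pos in auto)

lemma cos_a1_deriv:
  assumes "y \<in> {0..2 * P}"
  shows "(cos_a1 has_real_derivative - (real a * sin_a1 a y ^ (2 * a - 1))) (at y within {0..2 * P})"
proof (rule has_field_derivative_Icc_join[where b = P])
  fix t assume t: "t \<in> {0..P}"
  show "(cos_a1 has_real_derivative - (real a * sin_a1 a t ^ (2 * a - 1))) (at t within {0..P})"
    by (rule has_field_derivative_cong_on[of "cos_a0"])
       (use t cos_a0_deriv[of t] in \<open>auto simp: sin_a1_P cos_a1_def\<close>)
next
  fix t assume t: "t \<in> {P..2 * P}"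
  have "((\<lambda>y. cos_a0 (2 * P - y)) has_real_derivative - (- (real a * sin_a0 a (2 * P - t) ^ (2 * a - 1)))) (at t within {2 * P - P..2 * P - 0})"
    by (rule has_field_derivative_reflect[OF cos_a0_deriv]) (use t in auto)
  from DERIV_minus[OF this]
  show "(cos_a1 has_real_derivative - (real a * sin_a1 a t ^ (2 * a - 1))) (at t within {P..2 * P})"
    by (rule has_field_derivative_cong_on)
       (use t in \<open>auto simp: sin_a1_upper cos_a1_upper\<close>)
qed (use quarter_pos in auto)

lemma sin_a1_ends: "sin_a1 a 0 = 0" "sin_a1 a (2 * P) = 0"
  and cos_a1_ends: "cos_a1 0 = 1" "cos_a1 (2 * P) = - 1"
  using quarter_pos by (auto simp: sin_a1_P cos_a1_def sin_a0_0 cos_a0_0)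

definition sin_a2 :: "real \<Rightarrow> real" where
  "sin_a2 r = (if r \<le> 2 * P then sin_a1 a r else - sin_a1 a (4 * P - r))"

definition cos_a2 :: "real \<Rightarrow> real" where
  "cos_a2 r = (if r \<le> 2 * P then cos_a1 r else cos_a1 (4 * P - r))"

lemma sin_a2_upper: "2 * P \<le> y \<Longrightarrow> sin_a2 y = - sin_a1 a (4 * P - y)"
  and cos_a2_upper: "2 * P \<le> y \<Longrightarrow> cos_a2 y = cos_a1 (4 * P - y)"
  by (cases "y = 2 * P"; simp add: sin_a2_def cos_a2_def sin_a1_ends)+

lemma sin_a2_deriv:
  assumes "y \<in> {0..4 * P}"
  shows "(sin_a2 has_real_derivative cos_a2 y) (at y within {0..4 * P})"
proof (rule has_field_derivative_Icc_join[where b = "2 * P"])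
  fix t assume t: "t \<in> {0..2 * P}"
  show "(sin_a2 has_real_derivative cos_a2 t) (at t within {0..2 * P})"
    by (rule has_field_derivative_cong_on[of "sin_a1 a"])
       (use t sin_a1_deriv[of t] in \<open>auto simp: sin_a2_def cos_a2_def\<close>)
next
  fix t assume t: "t \<in> {2 * P..4 * P}"
  have "((\<lambda>y. sin_a1 a (4 * P - y)) has_real_derivative - cos_a1 (4 * P - t)) (at t within {4 * P - 2 * P..4 * P - 0})"
    by (rule has_field_derivative_reflect[OF sin_a1_deriv]) (use t in auto)
  from DERIV_minus[OF this]
  show "(sin_a2 has_real_derivative cos_a2 t) (at t within {2 * P..4 * P})"
    by (rule has_field_derivative_cong_on)
       (use t in \<open>auto simp: sin_a2_upper cos_a2_upper\<close>)
qed (use quarter_pos in auto)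

lemma odd_power: "(- x) ^ (2 * a - 1) = - ((x::real) ^ (2 * a - 1))"
  using a by (intro power_minus_odd) auto

lemma cos_a2_deriv:
  assumes "y \<in> {0..4 * P}"
  shows "(cos_a2 has_real_derivative - (real a * sin_a2 y ^ (2 * a - 1))) (at y within {0..4 * P})"
proof (rule has_field_derivative_Icc_join[where b = "2 * P"])
  fix t assume t: "t \<in> {0..2 * P}"
  show "(cos_a2 has_real_derivative - (real a * sin_a2 t ^ (2 * a - 1))) (at t within {0..2 * P})"
    by (rule has_field_derivative_cong_on[of "cos_a1"])
       (use t cos_a1_deriv[of t] in \<open>auto simp: sin_a2_def cos_a2_def\<close>)
next
  fix t assume t: "t \<in> {2 * P..4 * P}"
  have "((\<lambda>y. cos_a1 (4 * P - y)) has_real_derivative - (- (real a * sin_a1 a (4 * P - t) ^ (2 * a - 1)))) (at t within {4 * P - 2 * P..4 * P - 0})"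
    by (rule has_field_derivative_reflect[OF cos_a1_deriv]) (use t in auto)
  then show "(cos_a2 has_real_derivative - (real a * sin_a2 t ^ (2 * a - 1))) (at t within {2 * P..4 * P})"
    by (rule has_field_derivative_cong_on)
       (use t in \<open>auto simp: sin_a2_upper cos_a2_upper odd_power[simplified]\<close>)
qed (use quarter_pos in auto)

text \<open>Holds on the closed period cell: at its right end the floor already jumps to k + 1, but
  both readings give the value 0. Closed cells are what \<open>periodic_deriv\<close> joins.\<close>

lemma sin_a_shift:
  assumes "y \<in> {4 * P * of_int k..4 * P * of_int k + 4 * P}"
  shows "sin_a a y = sin_a2 (y - 4 * P * of_int k)"
proof (cases "y = 4 * P * of_int k + 4 * P")
  case True
  have "y / (4 * P) = of_int (k + 1)" using quarter_pos True by (simp add: field_simps)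
  then have "\<lfloor>y / (4 * P)\<rfloor> = k + 1" by (simp only: floor_of_int)
  then show ?thesis using True quarter_pos
    by (simp add: sin_a_def Let_def pi_a_eq sin_a1_ends sin_a2_def algebra_simps)
next
  case False
  have "\<lfloor>y / (4 * P)\<rfloor> = k" using quarter_pos False assms by (intro floor_unique) (auto simp: field_simps)
  then show ?thesis
    by (simp add: sin_a_def Let_def pi_a_eq sin_a2_def)
qed

text \<open>An explicit candidate for the derivative of \<open>sin_a\<close>; it can be identified
  with \<open>cos_a\<close> only after \<open>sin_a\<close> has been differentiated at every
  point.\<close>

definition cos_aux :: "real \<Rightarrow> real" where
  "cos_aux y = cos_a2 (y - 4 * P * of_int \<lfloor>y / (4 * P)\<rfloor>)"

lemma cos_aux_shift:
  assumes "y \<in> {4 * P * of_int k..4 * P * of_int k + 4 * P}"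
  shows "cos_aux y = cos_a2 (y - 4 * P * of_int k)"
proof (cases "y = 4 * P * of_int k + 4 * P")
  case True
  have "y / (4 * P) = of_int (k + 1)" using quarter_pos True by (simp add: field_simps)
  then have "\<lfloor>y / (4 * P)\<rfloor> = k + 1" by (simp only: floor_of_int)
  then show ?thesis using True quarter_pos
    by (simp add: cos_aux_def cos_a1_ends cos_a2_def algebra_simps)
next
  case False
  have "\<lfloor>y / (4 * P)\<rfloor> = k" using quarter_pos False assms by (intro floor_unique) (auto simp: field_simps)
  then show ?thesis by (simp add: cos_aux_def)
qed

lemma deriv_shift_period:
  fixes f :: "real \<Rightarrow> real"
  assumes "\<And>y. y \<in> {0..b} \<Longrightarrow> (f has_real_derivative d y) (at y within {0..b})" "y \<in> {c..c + b}"
  shows "((\<lambda>y. f (y - c)) has_real_derivative d (y - c)) (at y within {c..c + b})"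
proof -
  have "(\<lambda>y. y - c) ` {c..c+b} = {0..b}" by auto
  then have "(f has_real_derivative d (y - c)) (at (y - c) within (\<lambda>y. y - c) ` {c..c+b})"
    using assms by auto
  moreover have "((\<lambda>y. y - c) has_field_derivative 1) (at y within {c..c+b})"
    by (auto intro!: derivative_eq_intros)
  ultimately show ?thesis using DERIV_image_chain[of f _ "\<lambda>y. y - c" y "{c..c+b}" 1] by (simp add: o_def)
qed

text \<open>The cell of y and the preceding one together cover a neighbourhood of y, even if y is
  the left end of its cell, so derivatives within cells combine to a two-sided derivative.\<close>

lemma periodic_deriv:
  fixes f g :: "real \<Rightarrow> real"
  assumes d: "\<And>y. y \<in> {0..4 * P} \<Longrightarrow> (f has_real_derivative d y) (at y within {0..4 * P})"
    and f: "\<And>k y. y \<in> {4 * P * of_int k..4 * P * of_int k + 4 * P} \<Longrightarrow> g y = f (y - 4 * P * of_int k)"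
    and e: "\<And>k y. y \<in> {4 * P * of_int k..4 * P * of_int k + 4 * P} \<Longrightarrow> e y = d (y - 4 * P * of_int k)"
  shows "(g has_real_derivative e y) (at y)"
proof -
  define k where "k = \<lfloor>y / (4 * P)\<rfloor>"
  have k: "4 * P * of_int k \<le> y" "y < 4 * P * of_int k + 4 * P"
    using quarter_pos floor_divide_lower[of "4 * P" y] floor_divide_upper[of "4 * P" y]
    unfolding k_def[symmetric] by (simp_all add: distrib_right mult.commute)
  define A where "A = {4 * P * of_int (k - 1)..4 * P * of_int (k - 1) + 4 * P}"
  define B where "B = {4 * P * of_int k..4 * P * of_int k + 4 * P}"
  have w: "(g has_real_derivative e t) (at t within {4 * P * of_int m..4 * P * of_int m + 4 * P})"
    if "t \<in> {4 * P * of_int m..4 * P * of_int m + 4 * P}" for t m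
    by (rule has_field_derivative_cong_on[OF deriv_shift_period[OF d that] that])
       (use f[of _ m] e[of t m] that in simp_all)
  have "(g has_real_derivative e y) (at y within (A \<union> B))"
    unfolding A_def B_def by (rule has_field_derivative_within_Un[OF w w closed_atLeastAtMost closed_atLeastAtMost])
  moreover have "{4 * P * of_int k - 4 * P<..<4 * P * of_int k + 4 * P} \<subseteq> A \<union> B"
  proof
    fix t assume "t \<in> {4 * P * of_int k - 4 * P<..<4 * P * of_int k + 4 * P}"
    moreover have "4 * P * of_int (k - 1) = 4 * P * of_int k - 4 * P" by (simp add: right_diff_distrib)
    ultimately show "t \<in> A \<union> B" unfolding A_def B_def by force
  qed
  ultimately have "(g has_real_derivative e y) (at y within {4 * P * of_int k - 4 * P<..<4 * P * of_int k + 4 * P})"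
    by (rule DERIV_subset)
  then show ?thesis using k quarter_pos by (subst (asm) at_within_open) auto
qed

lemma sin_a_deriv_aux: "(sin_a a has_real_derivative cos_aux y) (at y)"
  by (rule periodic_deriv[OF sin_a2_deriv sin_a_shift cos_aux_shift])

lemma cos_a_aux: "cos_a a = cos_aux"
  unfolding cos_a_def by (intro ext DERIV_imp_deriv sin_a_deriv_aux)

lemma sin_a_has_derivative: "(sin_a a has_real_derivative cos_a a y) (at y)"
  using sin_a_deriv_aux by (simp add: cos_a_aux)

lemma cos_a_has_derivative: "(cos_a a has_real_derivative - (real a * sin_a a y ^ (2 * a - 1))) (at y)"
  unfolding cos_a_aux
  by (rule periodic_deriv[OF cos_a2_deriv cos_aux_shift]) (simp_all only: sin_a_shift)

lemma sin_a_base: "y \<in> {0..4 * P} \<Longrightarrow> sin_a a y = sin_a2 y"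
  and cos_a_base: "y \<in> {0..4 * P} \<Longrightarrow> cos_a a y = cos_a2 y"
  using sin_a_shift[of y 0] cos_aux_shift[of y 0] by (auto simp: cos_a_aux)

lemma sin_a_0: "sin_a a 0 = 0" and cos_a_0: "cos_a a 0 = 1" and cos_a_pi: "cos_a a (pi_a a) = -1"
  using quarter_pos by (auto simp: sin_a_base cos_a_base sin_a2_def cos_a2_def sin_a1_ends cos_a1_ends pi_a_eq)

text \<open>The left-hand side is the energy of the system S' = C, C' = - a S^(2a-1); it is constant
  and equals 1 at the origin.\<close>

lemma sin_cos_a_squared: "cos_a a y ^ 2 + sin_a a y ^ (2 * a) = 1"
proof -
  have "((\<lambda>y. cos_a a y ^ 2 + sin_a a y ^ (2 * a)) has_real_derivative 0) (at y)" for y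
    by (auto intro!: derivative_eq_intros sin_a_has_derivative cos_a_has_derivative)
  from DERIV_isconst_all[of "\<lambda>y. cos_a a y ^ 2 + sin_a a y ^ (2 * a)" y 0] this
  show ?thesis using a by (auto simp: sin_a_0 cos_a_0)
qed

lemma sin_a_reflect: "y \<in> {0..pi_a a} \<Longrightarrow> sin_a a (2 * pi_a a - y) = - sin_a a y"
  and cos_a_reflect: "y \<in> {0..pi_a a} \<Longrightarrow> cos_a a (2 * pi_a a - y) = cos_a a y"
  using quarter_pos by (auto simp: pi_a_eq sin_a_base cos_a_base sin_a2_upper cos_a2_upper sin_a2_def cos_a2_def sin_a1_ends)

lemma cos_a_surj:
  assumes "\<bar>c\<bar> \<le> 1"
  obtains y where "y \<in> {0..pi_a a}" "cos_a a y = c"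
proof -
  have "continuous_on {0..pi_a a} (cos_a a)"
    by (intro continuous_at_imp_continuous_on ballI DERIV_isCont[OF cos_a_has_derivative])
  then have "\<exists>y\<ge>0. y \<le> pi_a a \<and> cos_a a y = c"
    using assms pi_a_pos by (intro IVT2') (auto simp: cos_a_0 cos_a_pi)
  then show ?thesis using that by auto
qed

end

subsection \<open>The Hamiltonian\<close>

text \<open>The recursion becomes polynomial after squaring, so it can be differentiated along a
  solution; x and p are an arbitrary phase point here, not only the initial one.\<close>

definition R_sq :: "(nat \<Rightarrow> nat) \<Rightarrow> nat \<Rightarrow> (nat \<Rightarrow> real) \<Rightarrow> (nat \<Rightarrow> real) \<Rightarrow> nat \<Rightarrow> real" where
  "R_sq \<alpha> n x p j = (R_const \<alpha> n x p j)\<^sup>2"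

lemma R_sq_top: "R_sq \<alpha> n x p (n + 2) = 0"
  by (simp add: R_sq_def R_const_def)

lemma R_sq_step:
  assumes "j \<le> n + 1"
  shows "R_sq \<alpha> n x p j = R_sq \<alpha> n x p (Suc j) * x j ^ (2 * \<alpha> j) + (p j)\<^sup>2"
proof -
  have "n + 2 - j = Suc (n + 1 - j)" "n + 1 - (n + 1 - j) = j" "n + 2 - Suc j = n + 1 - j"
    using assms by auto
  then show ?thesis
    by (simp add: R_sq_def R_const_def power_mult)
qed

lemma R_sq_nonneg: "0 \<le> R_sq \<alpha> n x p j"
  by (simp add: R_sq_def)

lemma R_sq_zero: "R_sq \<alpha> n x p j = 0 \<longleftrightarrow> R_const \<alpha> n x p j = 0"
  by (simp add: R_sq_def)

lemma R_sq_cong: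
  assumes "\<And>i. j \<le> i \<Longrightarrow> i \<le> n + 1 \<Longrightarrow> x i = x' i \<and> p i = p' i"
    and "j \<le> n + 2"
  shows "R_sq \<alpha> n x p j = R_sq \<alpha> n x' p' j"
  using assms(2,1)
proof (induction rule: inc_induct)
  case base
  show ?case by (simp only: R_sq_top)
next
  case (step m)
  have "R_sq \<alpha> n x p (Suc m) = R_sq \<alpha> n x' p' (Suc m)" using step by (intro step.IH) auto
  moreover have "x m = x' m" "p m = p' m" using step.prems[of m] step.hyps by auto
  ultimately show ?case using step.hyps by (simp add: R_sq_step)
qed

lemma xi_Suc: "1 \<le> j \<Longrightarrow> xi \<alpha> (Suc j) x = xi \<alpha> j x * x j ^ \<alpha> j"
  by (simp add: xi_def atLeastLessThanSuc)

lemma xi_1: "xi \<alpha> (Suc 0) x = 1" by (simp add: xi_def)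

lemma xi_cong: "(\<And>i. 1 \<le> i \<Longrightarrow> i < j \<Longrightarrow> x i = y i) \<Longrightarrow> xi \<alpha> j x = xi \<alpha> j y"
  by (auto simp: xi_def intro!: prod.cong)

lemma square_power: "((x::real) ^ a)\<^sup>2 = x ^ (2 * a)"
  by (simp only: power_mult[symmetric] mult.commute)

text \<open>The origin of the constants R_j: \<open>xi\<close> at m+1 is \<open>xi\<close> at m
  times x_m^\<alpha>_m, so factoring \<open>xi\<close> squared out of a tail of 2H reproduces
  exactly the recursion for \<open>R_sq\<close>.\<close>

lemma sum_tail_R_sq:
  assumes "j \<le> n + 2" "1 \<le> j"
  shows "(\<Sum>k = j..n+1. (xi \<alpha> k x)\<^sup>2 * (p k)\<^sup>2) = (xi \<alpha> j x)\<^sup>2 * R_sq \<alpha> n x p j"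
  using assms
proof (induction rule: inc_induct)
  case base
  then show ?case by (simp add: R_sq_top[simplified])
next
  case (step m)
  have "(\<Sum>k = m..n+1. (xi \<alpha> k x)\<^sup>2 * (p k)\<^sup>2) = (xi \<alpha> m x)\<^sup>2 * (p m)\<^sup>2 + (\<Sum>k = Suc m..n+1. (xi \<alpha> k x)\<^sup>2 * (p k)\<^sup>2)"
    using step.hyps by (intro sum.atLeast_Suc_atMost) auto
  also have "(\<Sum>k = Suc m..n+1. (xi \<alpha> k x)\<^sup>2 * (p k)\<^sup>2) = (xi \<alpha> (Suc m) x)\<^sup>2 * R_sq \<alpha> n x p (Suc m)"
    using step by simp
  finally show ?case
    using step by (simp only: R_sq_step xi_Suc power_mult_distrib square_power) (simp add: algebra_simps)
qed

lemma Ham_eq_R_sq: "Ham \<alpha> n x p = R_sq \<alpha> n x p (Suc 0) / 2"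
  using sum_tail_R_sq[of 1 n \<alpha> x p] by (simp add: Ham_def xi_1)

text \<open>Terms up to j do not see x_j, and all later ones contain it through the same factor;
  hence H is constant plus a monomial in the j-th coordinate.\<close>

lemma Ham_upd:
  assumes j: "1 \<le> j" "j \<le> n + 1"
  shows "Ham \<alpha> n (x(j := s)) p =
    (\<Sum>k = 1..j. (xi \<alpha> k x)\<^sup>2 * (p k)\<^sup>2) / 2 + (xi \<alpha> j x)\<^sup>2 * s ^ (2 * \<alpha> j) * R_sq \<alpha> n x p (Suc j) / 2"
proof -
  let ?x = "x(j := s)"
  have "(\<Sum>k = 1..n+1. (xi \<alpha> k ?x)\<^sup>2 * (p k)\<^sup>2) =
      (\<Sum>k = 1..j. (xi \<alpha> k ?x)\<^sup>2 * (p k)\<^sup>2) + (\<Sum>k = Suc j..n+1. (xi \<alpha> k ?x)\<^sup>2 * (p k)\<^sup>2)"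
  proof -
    have e: "j + (n + 1 - j) = n + 1" using j by simp
    show ?thesis using sum.ub_add_nat[of 1 j "\<lambda>k. (xi \<alpha> k ?x)\<^sup>2 * (p k)\<^sup>2" "n + 1 - j"] j
      unfolding e by (simp only: Suc_eq_plus1 le_add2)
  qed
  also have "(\<Sum>k = 1..j. (xi \<alpha> k ?x)\<^sup>2 * (p k)\<^sup>2) = (\<Sum>k = 1..j. (xi \<alpha> k x)\<^sup>2 * (p k)\<^sup>2)"
    by (intro sum.cong refl arg_cong2[of _ _ _ _ "\<lambda>a b. a\<^sup>2 * b"] xi_cong) auto
  also have "(\<Sum>k = Suc j..n+1. (xi \<alpha> k ?x)\<^sup>2 * (p k)\<^sup>2) = (xi \<alpha> (Suc j) ?x)\<^sup>2 * R_sq \<alpha> n ?x p (Suc j)"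
    using j by (intro sum_tail_R_sq) auto
  also have "R_sq \<alpha> n ?x p (Suc j) = R_sq \<alpha> n x p (Suc j)"
    using j by (intro R_sq_cong) auto
  also have "xi \<alpha> (Suc j) ?x = xi \<alpha> j x * s ^ \<alpha> j"
    using j xi_cong[of j ?x x \<alpha>] by (simp add: xi_Suc)
  finally show ?thesis
    by (simp only: Ham_def power_mult_distrib square_power) (simp add: add_divide_distrib)
qed

text \<open>For \<open>\<alpha> j = 0\<close> the truncated exponent
  \<open>2 * \<alpha> j - 1\<close> is 0, but the factor \<open>real (\<alpha> j)\<close> vanishes,
  so the formula is still right.\<close>

lemma dHam_dx_eq:
  assumes j: "1 \<le> j" "j \<le> n + 1"
  shows "dHam_dx \<alpha> n j x p = (xi \<alpha> j x)\<^sup>2 * (real (\<alpha> j) * x j ^ (2 * \<alpha> j - 1) * R_sq \<alpha> n x p (Suc j))"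
  unfolding dHam_dx_def Ham_upd[OF j]
  by (rule DERIV_imp_deriv) (auto intro!: derivative_eq_intros)

text \<open>Hamilton's equations on an arbitrary interval and without the normalization of the
  energy, so that solutions can be restricted and glued.\<close>

definition ham_on :: "(nat \<Rightarrow> nat) \<Rightarrow> nat \<Rightarrow> real \<Rightarrow> real \<Rightarrow> (real \<Rightarrow> nat \<Rightarrow> real) \<Rightarrow> (real \<Rightarrow> nat \<Rightarrow> real) \<Rightarrow> bool" where
  "ham_on \<alpha> n a b x p \<longleftrightarrow>
     (\<forall>t\<in>{a..b}. \<forall>j\<in>{1..n+1}.
        ((\<lambda>s. x s j) has_real_derivative (xi \<alpha> j (x t))\<^sup>2 * p t j) (at t within {a..b}) \<and>
        ((\<lambda>s. p s j) has_real_derivative - dHam_dx \<alpha> n j (x t) (p t)) (at t within {a..b}))"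

lemma ham_lift_iff: "ham_lift \<alpha> n T x p \<longleftrightarrow> ham_on \<alpha> n 0 T x p \<and> Ham \<alpha> n (x 0) (p 0) = 1/2"
  by (simp add: ham_lift_def ham_on_def)

lemma ham_onD:
  assumes "ham_on \<alpha> n a b x p" "t \<in> {a..b}" "1 \<le> j" "j \<le> n + 1"
  shows "((\<lambda>s. x s j) has_real_derivative (xi \<alpha> j (x t))\<^sup>2 * p t j) (at t within {a..b})"
    and "((\<lambda>s. p s j) has_real_derivative
      - ((xi \<alpha> j (x t))\<^sup>2 * (real (\<alpha> j) * x t j ^ (2 * \<alpha> j - 1) * R_sq \<alpha> n (x t) (p t) (Suc j)))) (at t within {a..b})"
  using assms by (auto simp: ham_on_def dHam_dx_eq)

lemma ham_on_subset:
  "ham_on \<alpha> n a b x p \<Longrightarrow> a \<le> c \<Longrightarrow> d \<le> b \<Longrightarrow> ham_on \<alpha> n c d x p"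
  unfolding ham_on_def by (auto intro!: DERIV_subset[of _ _ _ "{a..b}" "{c..d}"])

lemma ham_on_continuous:
  assumes "ham_on \<alpha> n a b x p" "1 \<le> j" "j \<le> n + 1"
  shows "continuous_on {a..b} (\<lambda>t. x t j)" "continuous_on {a..b} (\<lambda>t. p t j)"
  by (rule DERIV_continuous_on, rule ham_onD[OF assms(1) _ assms(2,3)], assumption)+

text \<open>By downward induction \<open>R_sq\<close> at m+1 is a constant coupling; then
  \<open>R_sq\<close> at m is the kinetic plus potential energy of the one-dimensional system for
  (x_m, p_m), and the common factor xi_m^2 only changes the speed along its orbits.\<close>

lemma R_sq_deriv:
  assumes h: "ham_on \<alpha> n a b x p" "t \<in> {a..b}" and j: "1 \<le> j" "j \<le> n + 2"
  shows "((\<lambda>s. R_sq \<alpha> n (x s) (p s) j) has_real_derivative 0) (at t within {a..b})"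
  using j(2,1)
proof (induction rule: inc_induct)
  case base
  then show ?case by (simp add: R_sq_top[simplified])
next
  case (step m)
  have m: "m \<le> n + 1" "1 \<le> m" using step by auto
  have IH: "((\<lambda>s. R_sq \<alpha> n (x s) (p s) (Suc m)) has_real_derivative 0) (at t within {a..b})"
    using step by simp
  note d = ham_onD[OF h m(2,1)]
  have "((\<lambda>s. R_sq \<alpha> n (x s) (p s) (Suc m) * x s m ^ (2 * \<alpha> m) + (p s m)\<^sup>2) has_real_derivative 0) (at t within {a..b})"
    by (auto intro!: derivative_eq_intros IH d)
  then show ?case using m by (simp add: R_sq_step)
qed

lemma R_sq_const:
  assumes h: "ham_on \<alpha> n a b x p" "t \<in> {a..b}" "1 \<le> j" "j \<le> n + 2"
  shows "R_sq \<alpha> n (x t) (p t) j = R_sq \<alpha> n (x a) (p a) j"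
proof -
  have "\<exists>c. \<forall>t\<in>{a..b}. R_sq \<alpha> n (x t) (p t) j = c"
    using R_sq_deriv[OF h(1) _ h(3,4)] by (intro has_field_derivative_zero_constant) auto
  then show ?thesis using h(2) by force
qed

subsection \<open>Spherical coordinates\<close>

text \<open>A signed square root of \<open>R_sq\<close> at j, by \<open>R_sq_spherical\<close>; p_j
  is this number times a generalized cosine.\<close>

definition D_prod :: "(nat \<Rightarrow> nat) \<Rightarrow> (nat \<Rightarrow> real) \<Rightarrow> (nat \<Rightarrow> real) \<Rightarrow> nat \<Rightarrow> real" where
  "D_prod \<alpha> x0 \<phi> j = (\<Prod>i\<in>{1..<j}. sdelta \<alpha> x0 \<phi> i)"

lemma D_prod_1: "D_prod \<alpha> x0 \<phi> (Suc 0) = 1" by (simp add: D_prod_def)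

lemma D_prod_Suc: "1 \<le> j \<Longrightarrow> D_prod \<alpha> x0 \<phi> (Suc j) = D_prod \<alpha> x0 \<phi> j * sdelta \<alpha> x0 \<phi> j"
  by (simp add: D_prod_def atLeastLessThanSuc)

lemma D_prod_cong: "(\<And>i. 1 \<le> i \<Longrightarrow> i < j \<Longrightarrow> \<phi> i = \<psi> i) \<Longrightarrow> D_prod \<alpha> x0 \<phi> j = D_prod \<alpha> x0 \<psi> j"
  by (auto simp: D_prod_def sdelta_def intro!: prod.cong)

lemma alpha_t_ge_1: "1 \<le> alpha_t \<alpha> j" by (auto simp: alpha_t_def)

lemma rho_squared: "1 \<le> \<theta> \<Longrightarrow> (rho \<theta> s)\<^sup>2 = s ^ (2 * \<theta>)"
proof -
  assume "1 \<le> \<theta>"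
  then have "\<bar>rho \<theta> s\<bar> = \<bar>s\<bar> ^ \<theta>"
    by (simp add: rho_def abs_mult power_minus_mult flip: power_Suc2)
  then have "(rho \<theta> s)\<^sup>2 = (\<bar>s\<bar> ^ \<theta>)\<^sup>2" by (metis power2_abs)
  also have "\<dots> = (\<bar>s\<bar>\<^sup>2) ^ \<theta>" by (simp only: power_mult[symmetric] mult.commute)
  finally show ?thesis by (simp add: power_mult)
qed

lemma rho_minus: "rho \<theta> (- s) = - rho \<theta> s" by (simp add: rho_def)

text \<open>The conventions \<open>alpha_t\<close> = 1 and \<open>x_t\<close> = 1 for
  \<open>\<alpha> j = 0\<close> make the flat coordinates obey the same identity, since then x_j^0 =
  1.\<close>

lemma sdelta_squared:
  assumes "\<alpha> j \<noteq> 0 \<Longrightarrow> x0 j \<noteq> 0"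
  shows "(sdelta \<alpha> x0 \<phi> j)\<^sup>2 * x0 j ^ (2 * \<alpha> j) = 1 - (cos_a (alpha_t \<alpha> j) (\<phi> j))\<^sup>2"
proof -
  have "(sdelta \<alpha> x0 \<phi> j)\<^sup>2 * x0 j ^ (2 * \<alpha> j) = sin_a (alpha_t \<alpha> j) (\<phi> j) ^ (2 * alpha_t \<alpha> j)"
    using assms alpha_t_ge_1[of \<alpha> j]
    by (cases "\<alpha> j = 0") (auto simp: sdelta_def rho_squared x_t_def alpha_t_def power_divide)
  then show ?thesis using sin_cos_a_squared[OF alpha_t_ge_1, of \<alpha> j "\<phi> j"] by simp
qed

lemma riemannian_pow_nonzero:
  "riemannian_point \<alpha> n x0 \<Longrightarrow> 1 \<le> j \<Longrightarrow> j \<le> n \<Longrightarrow> x0 j ^ (2 * \<alpha> j) \<noteq> 0"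
  by (cases "\<alpha> j = 0") (auto simp: riemannian_point_def)

text \<open>With p_m = cos * D_m, the recursion adds D_m^2 (1 - cos^2) and D_m^2 cos^2, so it
  collapses to D_m^2 from the top coordinate downwards.\<close>

lemma R_sq_spherical:
  assumes "riemannian_point \<alpha> n x0" "spherical_coords \<alpha> n x0 p0 \<phi>" "1 \<le> j" "j \<le> n + 1"
  shows "R_sq \<alpha> n x0 p0 j = (D_prod \<alpha> x0 \<phi> j)\<^sup>2"
  using assms(4,3)
proof (induction rule: inc_induct)
  case base
  have "p0 (n + 1) = D_prod \<alpha> x0 \<phi> (n + 1)"
    using assms(2) unfolding D_prod_def spherical_coords_def atLeastLessThanSuc_atLeastAtMost[symmetric] Suc_eq_plus1 by blast
  then show ?case by (simp add: R_sq_step R_sq_top[simplified])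
next
  case (step m)
  have m: "1 \<le> m" "m \<le> n" using step by auto
  then have p: "p0 m = cos_a (alpha_t \<alpha> m) (\<phi> m) * D_prod \<alpha> x0 \<phi> m"
    using assms(2) unfolding spherical_coords_def D_prod_def by auto
  have s: "(sdelta \<alpha> x0 \<phi> m)\<^sup>2 * x0 m ^ (2 * \<alpha> m) = 1 - (cos_a (alpha_t \<alpha> m) (\<phi> m))\<^sup>2"
    using assms(1) m by (intro sdelta_squared) (auto simp: riemannian_point_def)
  have "R_sq \<alpha> n x0 p0 m = (D_prod \<alpha> x0 \<phi> m)\<^sup>2 * ((sdelta \<alpha> x0 \<phi> m)\<^sup>2 * x0 m ^ (2 * \<alpha> m)) + (p0 m)\<^sup>2"
    using m step by (simp add: R_sq_step D_prod_Suc power_mult_distrib)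
  also have "\<dots> = (D_prod \<alpha> x0 \<phi> m)\<^sup>2"
    unfolding s p by (simp add: algebra_simps power_mult_distrib)
  finally show ?case .
qed

lemma spherical_step:
  assumes "riemannian_point \<alpha> n x0" "1 \<le> j" "j \<le> n"
    and D: "R_sq \<alpha> n x0 p0 j = (D_prod \<alpha> x0 \<phi> j)\<^sup>2"
  obtains y where "y \<in> {0..pi_a (alpha_t \<alpha> j)}" "p0 j = cos_a (alpha_t \<alpha> j) y * D_prod \<alpha> x0 \<phi> j"
    "R_sq \<alpha> n x0 p0 (Suc j) = (D_prod \<alpha> x0 (\<phi>(j := y)) (Suc j))\<^sup>2"
proof -
  have c: "R_sq \<alpha> n x0 p0 (Suc j) = (D_prod \<alpha> x0 (\<phi>(j := y)) (Suc j))\<^sup>2"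
    if p: "p0 j = cos_a (alpha_t \<alpha> j) y * D_prod \<alpha> x0 \<phi> j" for y
  proof -
    have s: "(sdelta \<alpha> x0 (\<phi>(j := y)) j)\<^sup>2 * x0 j ^ (2 * \<alpha> j) = 1 - (cos_a (alpha_t \<alpha> j) y)\<^sup>2"
      using sdelta_squared[of \<alpha> j x0 "\<phi>(j := y)"] assms by (auto simp: riemannian_point_def)
    have e: "D_prod \<alpha> x0 (\<phi>(j := y)) j = D_prod \<alpha> x0 \<phi> j" by (rule D_prod_cong) auto
    have "R_sq \<alpha> n x0 p0 (Suc j) * x0 j ^ (2 * \<alpha> j) = (D_prod \<alpha> x0 \<phi> j)\<^sup>2 - (p0 j)\<^sup>2"
      using D assms R_sq_step[of j n \<alpha> x0 p0] by simp
    also have "\<dots> = (D_prod \<alpha> x0 (\<phi>(j := y)) (Suc j))\<^sup>2 * x0 j ^ (2 * \<alpha> j)"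
      using assms(2) by (simp add: D_prod_Suc e power_mult_distrib mult.assoc s p) (simp add: right_diff_distrib)
    \<comment> \<open>Dividing by x0_j^(2 \<alpha>_j) is where the Riemannian hypothesis is
      needed.\<close>
    finally show ?thesis using riemannian_pow_nonzero[OF assms(1-3)] mult_right_cancel by blast
  qed
  have le: "(p0 j)\<^sup>2 \<le> (D_prod \<alpha> x0 \<phi> j)\<^sup>2"
    using D assms R_sq_step[of j n \<alpha> x0 p0] mult_nonneg_nonneg[OF R_sq_nonneg[of \<alpha> n x0 p0 "Suc j"], of "x0 j ^ (2 * \<alpha> j)"]
    by simp
  show ?thesis
  proof (cases "D_prod \<alpha> x0 \<phi> j = 0")
    case True
    \<comment> \<open>With D_j = 0 the angle is undetermined, because both sides vanish for every
      choice; 0 is taken.\<close>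
    then have "p0 j = 0" using le by simp
    then show ?thesis using that[of 0] c[of 0] True pi_a_pos[OF alpha_t_ge_1, of \<alpha> j] by auto
  next
    case False
    then have "\<bar>p0 j / D_prod \<alpha> x0 \<phi> j\<bar> \<le> 1" using le by (simp add: abs_le_square_iff)
    then obtain y where "y \<in> {0..pi_a (alpha_t \<alpha> j)}" "cos_a (alpha_t \<alpha> j) y = p0 j / D_prod \<alpha> x0 \<phi> j"
      using cos_a_surj[OF alpha_t_ge_1] by metis
    then show ?thesis using that[of y] c[of y] False by auto
  qed
qed

text \<open>H = 1/2 says \<open>R_sq\<close> at 1 equals 1 = D_1^2, which starts the recursion over
  the angles. Only squares are controlled, so p_(n+1) comes out up to sign; the last angle, ranging
  over a full period, absorbs the sign.\<close>

lemma spherical_coords_exist: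
  assumes r: "riemannian_point \<alpha> n x0" and n: "1 \<le> n" and h: "Ham \<alpha> n x0 p0 = 1/2"
  shows "\<exists>\<phi>. spherical_coords \<alpha> n x0 p0 \<phi>"
proof -
  have "\<exists>\<phi>. R_sq \<alpha> n x0 p0 (Suc m) = (D_prod \<alpha> x0 \<phi> (Suc m))\<^sup>2 \<and>
     (\<forall>j\<in>{1..m}. \<phi> j \<in> {0..pi_a (alpha_t \<alpha> j)} \<and> p0 j = cos_a (alpha_t \<alpha> j) (\<phi> j) * D_prod \<alpha> x0 \<phi> j)"
    if "m \<le> n" for m
    using that
  proof (induction m)
    case 0
    then show ?case using h by (simp add: D_prod_1 Ham_eq_R_sq)
  next
    case (Suc m)
    then obtain \<phi> where \<phi>: "R_sq \<alpha> n x0 p0 (Suc m) = (D_prod \<alpha> x0 \<phi> (Suc m))\<^sup>2"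
      "\<forall>j\<in>{1..m}. \<phi> j \<in> {0..pi_a (alpha_t \<alpha> j)} \<and> p0 j = cos_a (alpha_t \<alpha> j) (\<phi> j) * D_prod \<alpha> x0 \<phi> j"
      by auto
    obtain y where y: "y \<in> {0..pi_a (alpha_t \<alpha> (Suc m))}"
      "p0 (Suc m) = cos_a (alpha_t \<alpha> (Suc m)) y * D_prod \<alpha> x0 \<phi> (Suc m)"
      "R_sq \<alpha> n x0 p0 (Suc (Suc m)) = (D_prod \<alpha> x0 (\<phi>(Suc m := y)) (Suc (Suc m)))\<^sup>2"
      using spherical_step[OF r _ Suc.prems \<phi>(1)] by auto
    have e: "D_prod \<alpha> x0 (\<phi>(Suc m := y)) j = D_prod \<alpha> x0 \<phi> j" if "j \<le> Suc m" for j
      by (rule D_prod_cong) (use that in auto)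
    have "\<forall>j\<in>{1..Suc m}. (\<phi>(Suc m := y)) j \<in> {0..pi_a (alpha_t \<alpha> j)} \<and>
       p0 j = cos_a (alpha_t \<alpha> j) ((\<phi>(Suc m := y)) j) * D_prod \<alpha> x0 (\<phi>(Suc m := y)) j"
      using \<phi>(2) y(1,2) e by (auto simp: le_Suc_eq)
    then show ?case using y(3) by blast
  qed
  from this[of n] obtain \<phi> where \<phi>: "R_sq \<alpha> n x0 p0 (Suc n) = (D_prod \<alpha> x0 \<phi> (Suc n))\<^sup>2"
    "\<And>j. j \<in> {1..n} \<Longrightarrow> \<phi> j \<in> {0..pi_a (alpha_t \<alpha> j)} \<and> p0 j = cos_a (alpha_t \<alpha> j) (\<phi> j) * D_prod \<alpha> x0 \<phi> j"
    by auto
  have "(p0 (n + 1))\<^sup>2 = (D_prod \<alpha> x0 \<phi> (Suc n))\<^sup>2"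
    using \<phi>(1) R_sq_step[of "n + 1" n \<alpha> x0 p0] R_sq_top[of \<alpha> n x0 p0] by simp
  then have sgn: "p0 (n + 1) = D_prod \<alpha> x0 \<phi> (Suc n) \<or> p0 (n + 1) = - D_prod \<alpha> x0 \<phi> (Suc n)"
    by (simp add: power2_eq_iff)
  have atl: "{1..<Suc n} = {1..n}" by auto
  let ?a = "alpha_t \<alpha> n"
  have pp: "0 < pi_a ?a" using pi_a_pos[OF alpha_t_ge_1] .
  show ?thesis
  proof (cases "p0 (n + 1) = D_prod \<alpha> x0 \<phi> (Suc n)")
    case True
    then have "spherical_coords \<alpha> n x0 p0 \<phi>"
      using \<phi>(2) pp n unfolding spherical_coords_def D_prod_def atl by force
    then show ?thesis by blast
  next
    case False
    then have neg: "p0 (n + 1) = - D_prod \<alpha> x0 \<phi> (Suc n)" and nz: "D_prod \<alpha> x0 \<phi> (Suc n) \<noteq> 0"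
      using sgn by auto
    \<comment> \<open>This reflection keeps the cosine and reverses the sine. It stays below the
      full period because \<open>\<phi> n\<close> is not 0.\<close>
    define \<psi> where "\<psi> = \<phi>(n := 2 * pi_a ?a - \<phi> n)"
    have \<phi>n: "\<phi> n \<in> {0..pi_a ?a}" using \<phi>(2)[of n] n by auto
    have "\<phi> n \<noteq> 0"
    proof
      assume "\<phi> n = 0"
      then have "sdelta \<alpha> x0 \<phi> n = 0" by (simp add: sdelta_def sin_a_0[OF alpha_t_ge_1] rho_def)
      then show False using nz n by (simp add: D_prod_Suc)
    qed
    then have rng: "0 \<le> \<psi> n" "\<psi> n < 2 * pi_a ?a" using \<phi>n pp by (auto simp: \<psi>_def)
    have c: "cos_a ?a (\<psi> n) = cos_a ?a (\<phi> n)" and s: "sin_a ?a (\<psi> n) = - sin_a ?a (\<phi> n)"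
      using cos_a_reflect[OF alpha_t_ge_1 \<phi>n] sin_a_reflect[OF alpha_t_ge_1 \<phi>n] by (auto simp: \<psi>_def)
    have e: "D_prod \<alpha> x0 \<psi> j = D_prod \<alpha> x0 \<phi> j" if "j \<le> n" for j
      by (rule D_prod_cong) (use that in \<open>auto simp: \<psi>_def\<close>)
    have "sdelta \<alpha> x0 \<psi> n = - sdelta \<alpha> x0 \<phi> n"
      by (simp add: sdelta_def s rho_minus)
    then have last: "p0 (n + 1) = D_prod \<alpha> x0 \<psi> (Suc n)"
      using neg n e[of n] by (simp add: D_prod_Suc)
    have "p0 j = cos_a (alpha_t \<alpha> j) (\<psi> j) * D_prod \<alpha> x0 \<psi> j" if "j \<in> {1..n}" for j
      using \<phi>(2)[OF that] e[of j] c that by (cases "j = n") (auto simp: \<psi>_def)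
    moreover have "\<psi> j \<in> {0..pi_a (alpha_t \<alpha> j)}" if "j \<in> {1..<n}" for j
      using \<phi>(2)[of j] that by (auto simp: \<psi>_def)
    ultimately have "spherical_coords \<alpha> n x0 p0 \<psi>"
      using last rng unfolding spherical_coords_def D_prod_def atl by force
    then show ?thesis by blast
  qed
qed

subsection \<open>Integrals of bounded measurable functions\<close>

text \<open>Bounds on the whole line make the class stable under products, which integrability alone
  is not, and settle integrability on every compact interval. The price is that curves and
  primitives must be clamped outside the interval of interest.\<close>

definition bm :: "(real \<Rightarrow> real) \<Rightarrow> bool" where
  "bm f \<longleftrightarrow> f \<in> borel_measurable borel \<and> (\<exists>C. \<forall>t. \<bar>f t\<bar> \<le> C)"

lemma bm_measurable: "bm f \<Longrightarrow> f \<in> borel_measurable borel"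
  by (simp add: bm_def)

lemma bm_bound:
  assumes "bm f" obtains C where "0 \<le> C" "\<And>t. \<bar>f t\<bar> \<le> C"
proof -
  obtain C where C: "\<forall>t. \<bar>f t\<bar> \<le> C" using assms unfolding bm_def by blast
  then have "0 \<le> C" using abs_ge_zero[of "f 0"] order_trans by blast
  then show ?thesis using that C by blast
qed

lemma bmI: "f \<in> borel_measurable borel \<Longrightarrow> (\<And>t. \<bar>f t\<bar> \<le> C) \<Longrightarrow> bm f"
  unfolding bm_def by blast

lemma bm_const [simp]: "bm (\<lambda>t. c)"
  by (rule bmI[of _ "\<bar>c\<bar>"]) auto

lemma bm_add [simp]: assumes "bm f" "bm g" shows "bm (\<lambda>t. f t + g t)"
proof -
  obtain C where C: "\<And>t. \<bar>f t\<bar> \<le> C" using bm_bound[OF assms(1)] by blast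
  obtain D where D: "\<And>t. \<bar>g t\<bar> \<le> D" using bm_bound[OF assms(2)] by blast
  have "\<bar>f t + g t\<bar> \<le> C + D" for t using C[of t] D[of t] by linarith
  then show ?thesis using borel_measurable_add[OF assms[THEN bm_measurable]] by (intro bmI[of _ "C + D"])
qed

lemma bm_mult [simp]: assumes "bm f" "bm g" shows "bm (\<lambda>t. f t * g t)"
proof -
  obtain C where C: "0 \<le> C" "\<And>t. \<bar>f t\<bar> \<le> C" using bm_bound[OF assms(1)] by blast
  obtain D where D: "\<And>t. \<bar>g t\<bar> \<le> D" using bm_bound[OF assms(2)] by blast
  have "\<bar>f t * g t\<bar> \<le> C * D" for t unfolding abs_mult using C D by (intro mult_mono) auto
  then show ?thesis using borel_measurable_times[OF assms[THEN bm_measurable]] by (intro bmI[of _ "C * D"])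
qed

lemma bm_minus [simp]: "bm f \<Longrightarrow> bm (\<lambda>t. - f t)"
  using bm_mult[of "\<lambda>t. -1" f] by simp

lemma bm_diff [simp]: "bm f \<Longrightarrow> bm g \<Longrightarrow> bm (\<lambda>t. f t - g t)"
  using bm_add[of f "\<lambda>t. - g t"] by simp

lemma bm_power [simp]: "bm f \<Longrightarrow> bm (\<lambda>t. f t ^ k)"
  by (induction k) auto

lemma bm_sum [simp]: "(\<And>i. i \<in> I \<Longrightarrow> bm (f i)) \<Longrightarrow> bm (\<lambda>t. \<Sum>i\<in>I. f i t)"
  by (induction I rule: infinite_finite_induct) auto

lemma bm_prod [simp]: "(\<And>i. i \<in> I \<Longrightarrow> bm (f i)) \<Longrightarrow> bm (\<lambda>t. \<Prod>i\<in>I. f i t)"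
  by (induction I rule: infinite_finite_induct) auto

lemma bm_integrable [simp]: assumes "bm f" shows "set_integrable lborel {a..b} f"
proof -
  obtain C where C: "\<And>t. \<bar>f t\<bar> \<le> C" using bm_bound[OF assms] by blast
  have "set_integrable lborel {a..b} (\<lambda>t. C)" by (simp add: borel_integrable_atLeastAtMost')
  moreover have "set_borel_measurable lborel {a..b} f"
    using bm_measurable[OF assms] by (simp add: set_borel_measurable_def)
  ultimately show ?thesis
    by (rule set_integrable_bound) (intro AE_I2, use C order_trans[OF C abs_ge_self] in auto)
qed

lemma LI_integral: "bm f \<Longrightarrow> (LINT s:{a..b}|lborel. f s) = integral {a..b} f"
  by (intro set_borel_integral_eq_integral bm_integrable)

lemma LI_add: "bm f \<Longrightarrow> bm g \<Longrightarrow>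
  (LINT s:{a..b}|lborel. f s + g s) = (LINT s:{a..b}|lborel. f s) + (LINT s:{a..b}|lborel. g s)"
  by (intro set_integral_add bm_integrable)

lemma LI_diff: "bm f \<Longrightarrow> bm g \<Longrightarrow>
  (LINT s:{a..b}|lborel. f s - g s) = (LINT s:{a..b}|lborel. f s) - (LINT s:{a..b}|lborel. g s)"
  by (intro set_integral_diff bm_integrable)

lemma LI_sum: "(\<And>i. i \<in> I \<Longrightarrow> bm (f i)) \<Longrightarrow>
  (LINT s:{a..b}|lborel. (\<Sum>i\<in>I. f i s)) = (\<Sum>i\<in>I. LINT s:{a..b}|lborel. f i s)"
  by (induction I rule: infinite_finite_induct) (auto simp: LI_add set_lebesgue_integral_def[of _ _ "\<lambda>s. 0"])

lemma LI_cong: "(\<And>s. s \<in> {a..b::real} \<Longrightarrow> f s = g s) \<Longrightarrow>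
  (LINT s:{a..b}|lborel. f s) = (LINT s:{a..b}|lborel. g s :: real)"
  by (intro set_lebesgue_integral_cong) (auto simp: lborel_def)

lemma LI_mono: "set_integrable lborel {a..b} f \<Longrightarrow> set_integrable lborel {a..b} g \<Longrightarrow> (\<And>s. s \<in> {a..b} \<Longrightarrow> f s \<le> g s) \<Longrightarrow>
  (LINT s:{a..b}|lborel. f s) \<le> (LINT s:{a..b}|lborel. g s :: real)"
  by (intro set_integral_mono) auto

lemma LI_const: "a \<le> b \<Longrightarrow> (LINT s:{a..b}|lborel. c) = c * (b - a :: real)"
  by (subst LI_integral) auto

lemma LI_abs_le:
  assumes "bm f" "a \<le> b" "\<And>s. s \<in> {a..b} \<Longrightarrow> \<bar>f s\<bar> \<le> C"
  shows "\<bar>LINT s:{a..b}|lborel. f s\<bar> \<le> C * (b - a)"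
proof -
  have "(LINT s:{a..b}|lborel. f s) \<le> (LINT s:{a..b}|lborel. C)"
    by (rule LI_mono) (use assms in \<open>force+\<close>)
  moreover have "(LINT s:{a..b}|lborel. - C) \<le> (LINT s:{a..b}|lborel. f s)"
    by (rule LI_mono) (use assms in \<open>force+\<close>)
  ultimately show ?thesis using LI_const[OF assms(2), of C] LI_const[OF assms(2), of "- C"] by auto
qed

lemma LI_split:
  assumes "bm f" "a \<le> c" "c \<le> b"
  shows "(LINT s:{a..b}|lborel. f s) = (LINT s:{a..c}|lborel. f s) + (LINT s:{c..b}|lborel. f s)"
  using assms set_borel_integral_eq_integral(1)[OF bm_integrable[OF assms(1)]]
  by (simp add: LI_integral Henstock_Kurzweil_Integration.integral_combine)

lemma LI_point: "(LINT s:{a..a::real}|lborel. f s) = (0::real)"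
proof -
  have "AE s in lborel. s \<noteq> a" by (rule AE_lborel_singleton)
  then have "AE s in lborel. indicator {a..a} s *\<^sub>R f s = 0" by eventually_elim auto
  then show ?thesis unfolding set_lebesgue_integral_def by (rule integral_eq_zero_AE)
qed

lemma LI_lipschitz:
  assumes f: "bm f" "\<And>s. \<bar>f s\<bar> \<le> C" and "a \<le> s" "a \<le> t"
  shows "\<bar>(LINT r:{a..t}|lborel. f r) - (LINT r:{a..s}|lborel. f r)\<bar> \<le> C * \<bar>t - s\<bar>"
proof -
  have *: "\<bar>(LINT r:{a..t}|lborel. f r) - (LINT r:{a..s}|lborel. f r)\<bar> \<le> C * (t - s)"
    if "a \<le> s" "s \<le> t" for s t
    using LI_split[OF f(1) that] LI_abs_le[OF f(1) that(2), of C] f(2) by simp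
  show ?thesis using *[of s t] *[of t s] assms by (cases "s \<le> t") auto
qed

lemma LI_continuous:
  assumes f: "bm f" shows "continuous_on {a..} (\<lambda>t. LINT r:{a..t}|lborel. f r)"
proof -
  obtain C where C: "0 \<le> C" "\<And>t. \<bar>f t\<bar> \<le> C" using bm_bound[OF f] by blast
  have "C-lipschitz_on {a..} (\<lambda>t. LINT r:{a..t}|lborel. f r)"
    using LI_lipschitz[OF f C(2)] C(1) by (intro lipschitz_onI) (auto simp: dist_real_def abs_minus_commute)
  then show ?thesis by (rule lipschitz_on_continuous_on)
qed

text \<open>Clamping the upper limit to [a,b] keeps the primitive bounded on the whole line without
  changing it on the interval.\<close>

lemma bm_primitive [simp]:
  assumes "bm f" "a \<le> b"
  shows "bm (\<lambda>t. LINT r:{a..max a (min b t)}|lborel. f r)"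
proof -
  obtain C where C: "0 \<le> C" "\<And>t. \<bar>f t\<bar> \<le> C" using bm_bound[OF assms(1)] by blast
  have "continuous_on UNIV (\<lambda>t. LINT r:{a..max a (min b t)}|lborel. f r)"
    by (rule continuous_on_compose2[OF LI_continuous[OF assms(1)]]) (auto intro!: continuous_intros)
  moreover have "\<bar>LINT r:{a..max a (min b t)}|lborel. f r\<bar> \<le> C * (b - a)" for t
  proof -
    have "\<bar>LINT r:{a..max a (min b t)}|lborel. f r\<bar> \<le> C * (max a (min b t) - a)"
      by (rule LI_abs_le) (use assms C in auto)
    also have "\<dots> \<le> C * (b - a)" using C assms by (intro mult_left_mono) auto
    finally show ?thesis .
  qed
  ultimately show ?thesis by (intro bmI borel_measurable_continuous_onI)
qed

lemma LI_has_derivative: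
  assumes "bm f" "continuous_on {a..b} f" "t \<in> {a..b}"
  shows "((\<lambda>t. LINT s:{a..t}|lborel. f s) has_real_derivative f t) (at t within {a..b})"
  using integral_has_real_derivative[OF assms(2,3)] by (simp add: LI_integral[OF assms(1)])

text \<open>The difference quotients are at most K |t - s|, so H has derivative 0 everywhere even
  when the functions it is built from are not differentiable.\<close>

lemma zero_derivative_quadratic:
  fixes H :: "real \<Rightarrow> real"
  assumes "\<And>s t. s \<in> {a..b} \<Longrightarrow> t \<in> {a..b} \<Longrightarrow> s \<le> t \<Longrightarrow> \<bar>H t - H s\<bar> \<le> K * (t - s)\<^sup>2" and "a \<le> b"
  shows "H b = H a"
proof -
  have sym: "\<bar>H t - H s\<bar> \<le> K * \<bar>t - s\<bar> * \<bar>t - s\<bar>" if "s \<in> {a..b}" "t \<in> {a..b}" for s t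
    using assms(1)[OF that] assms(1)[OF that(2,1)]
    by (cases "s \<le> t") (auto simp: power2_eq_square algebra_simps abs_minus_commute)
  have "(H has_real_derivative 0) (at s within {a..b})" if s: "s \<in> {a..b}" for s
  proof -
    have "((\<lambda>t. (H t - H s) / (t - s)) \<longlongrightarrow> 0) (at s within {a..b})"
    proof (rule Lim_null_comparison)
      show "\<forall>\<^sub>F t in at s within {a..b}. norm ((H t - H s) / (t - s)) \<le> K * \<bar>t - s\<bar>"
        unfolding eventually_at_filter
        using sym[OF s] by (auto simp: divide_simps abs_divide intro!: always_eventually)
      have "((\<lambda>t. K * \<bar>t - s\<bar>) \<longlongrightarrow> K * \<bar>s - s\<bar>) (at s within {a..b})"
        by (intro tendsto_intros)
      then show "((\<lambda>t. K * \<bar>t - s\<bar>) \<longlongrightarrow> 0) (at s within {a..b})" by simp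
    qed
    then show ?thesis by (simp add: has_field_derivative_iff)
  qed
  then have "\<exists>c. \<forall>t\<in>{a..b}. H t = c" by (intro has_field_derivative_zero_constant) auto
  then show ?thesis using assms(2) by force
qed

text \<open>The two primitives are only Lipschitz, but the difference of the two sides, as a function of
  the upper end point, has increments of second order.\<close>

lemma LI_by_parts:
  assumes f: "bm f" and g: "bm g" and "a \<le> b"
  defines "F \<equiv> \<lambda>t. LINT s:{a..t}|lborel. f s" and "G \<equiv> \<lambda>t. LINT s:{a..t}|lborel. g s"
  shows "(LINT s:{a..b}|lborel. F s * g s + f s * G s) = F b * G b"
proof -
  obtain C where C: "0 \<le> C" "\<And>t. \<bar>f t\<bar> \<le> C" using bm_bound[OF f] by blast
  obtain D where D: "0 \<le> D" "\<And>t. \<bar>g t\<bar> \<le> D" using bm_bound[OF g] by blast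
  define cl where "cl = (\<lambda>t. max a (min b t))"
  define h where "h = (\<lambda>s. F (cl s) * g s + f s * G (cl s))"
  have bF: "bm (\<lambda>t. F (cl t))" and bG: "bm (\<lambda>t. G (cl t))"
    unfolding F_def G_def cl_def by (rule bm_primitive[OF f assms(3)], rule bm_primitive[OF g assms(3)])
  have bh: "bm h" unfolding h_def using bF bG f g by simp
  define H where "H = (\<lambda>t. F t * G t - (LINT s:{a..t}|lborel. h s))"
  have "H b = H a"
  proof (rule zero_derivative_quadratic[of a b H "2 * C * D"])
    fix s t assume st: "s \<in> {a..b}" "t \<in> {a..b}" "s \<le> t"
    have Fst: "F t - F s = (LINT r:{s..t}|lborel. f r)" and Gst: "G t - G s = (LINT r:{s..t}|lborel. g r)"
      using LI_split[OF f, of a s t] LI_split[OF g, of a s t] st by (auto simp: F_def G_def)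
    have hst: "(LINT r:{a..t}|lborel. h r) - (LINT r:{a..s}|lborel. h r) = (LINT r:{s..t}|lborel. h r)"
      using LI_split[OF bh, of a s t] st by auto
    \<comment> \<open>Freezing F at t and G at s turns the increment of the product into one
      integral; unfreezing costs a Lipschitz increment per factor, hence the second order bound with
      constant 2 * C * D.\<close>
    have "F t * G t - F s * G s = F t * (G t - G s) + G s * (F t - F s)" by (simp add: algebra_simps)
    also have "\<dots> = (LINT r:{s..t}|lborel. F t * g r + G s * f r)"
      unfolding Fst Gst using f g by (subst LI_add) auto
    finally have "H t - H s = (LINT r:{s..t}|lborel. (F t * g r + G s * f r) - h r)"
      using hst f g bh unfolding H_def by (subst LI_diff) auto
    also have "\<bar>\<dots>\<bar> \<le> 2 * C * D * (t - s) * (t - s)"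
    proof (rule LI_abs_le)
      fix r assume r: "r \<in> {s..t}"
      then have cl: "cl r = r" using st by (auto simp: cl_def)
      have "\<bar>F t - F r\<bar> \<le> C * \<bar>t - r\<bar>" "\<bar>G s - G r\<bar> \<le> D * \<bar>s - r\<bar>"
        unfolding F_def G_def using LI_lipschitz[OF f C(2), of a r t] LI_lipschitz[OF g D(2), of a r s] r st
        by simp_all
      moreover have "C * \<bar>t - r\<bar> \<le> C * (t - s)" "D * \<bar>s - r\<bar> \<le> D * (t - s)"
        using r C D by (auto intro!: mult_left_mono)
      ultimately have 1: "\<bar>F t - F r\<bar> \<le> C * (t - s)" "\<bar>G s - G r\<bar> \<le> D * (t - s)" by auto
      have "(F t * g r + G s * f r) - h r = (F t - F r) * g r + (G s - G r) * f r"
        by (simp add: h_def cl algebra_simps)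
      also have "\<bar>\<dots>\<bar> \<le> \<bar>F t - F r\<bar> * \<bar>g r\<bar> + \<bar>G s - G r\<bar> * \<bar>f r\<bar>"
        by (metis abs_mult abs_triangle_ineq)
      also have "\<dots> \<le> (C * (t - s)) * D + (D * (t - s)) * C"
        using 1 C D st by (intro add_mono mult_mono) auto
      finally show "\<bar>(F t * g r + G s * f r) - h r\<bar> \<le> 2 * C * D * (t - s)" by (simp add: algebra_simps)
    qed (use f g bh st in auto)
    finally show "\<bar>H t - H s\<bar> \<le> 2 * C * D * (t - s)\<^sup>2" by (simp add: power2_eq_square)
  qed fact
  moreover have "H a = 0" using LI_point[of a f] LI_point[of a h] by (simp add: H_def F_def)
  moreover have "(LINT s:{a..b}|lborel. h s) = (LINT s:{a..b}|lborel. F s * g s + f s * G s)"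
    by (rule LI_cong) (auto simp: h_def cl_def)
  ultimately show ?thesis by (simp add: H_def)
qed

lemma LI_sq_zero:
  assumes "bm f" "(LINT s:{a..b}|lborel. (f s)\<^sup>2) = 0"
  shows "AE s in lborel. s \<in> {a..b} \<longrightarrow> f s = 0"
proof -
  have "integrable lborel (\<lambda>s. indicator {a..b} s *\<^sub>R (f s)\<^sup>2)"
    using bm_integrable[of "\<lambda>s. (f s)\<^sup>2" a b] assms(1) by (simp add: set_integrable_def)
  moreover have "(\<integral>s. indicator {a..b} s *\<^sub>R (f s)\<^sup>2 \<partial>lborel) = 0"
    using assms(2) by (simp add: set_lebesgue_integral_def)
  ultimately have "AE s in lborel. indicator {a..b} s *\<^sub>R (f s)\<^sup>2 = 0"
    by (subst (asm) integral_nonneg_eq_0_iff_AE) auto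
  then show ?thesis by eventually_elim auto
qed

subsection \<open>Expansion of the weights\<close>

text \<open>Partial derivative of \<open>xi\<close> k in the j-th coordinate for j < k, written
  without division by x_j so that it is correct at singular points too.\<close>

definition dxi :: "(nat \<Rightarrow> nat) \<Rightarrow> nat \<Rightarrow> nat \<Rightarrow> (nat \<Rightarrow> real) \<Rightarrow> real" where
  "dxi \<alpha> j k x = (\<Prod>i\<in>{1..<k} - {j}. x i ^ \<alpha> i) * (real (\<alpha> j) * x j ^ (\<alpha> j - 1))"

lemma dxi_Suc: "1 \<le> j \<Longrightarrow> j < k \<Longrightarrow> dxi \<alpha> j (Suc k) x = dxi \<alpha> j k x * x k ^ \<alpha> k"
proof -
  assume "1 \<le> j" "j < k"
  then have "{1..<Suc k} - {j} = insert k ({1..<k} - {j})" by auto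
  then show ?thesis using \<open>j < k\<close> by (simp add: dxi_def)
qed

lemma dxi_last: "1 \<le> k \<Longrightarrow> dxi \<alpha> k (Suc k) x = xi \<alpha> k x * (real (\<alpha> k) * x k ^ (\<alpha> k - 1))"
proof -
  have "{1..<Suc k} - {k} = {1..<k}" by auto
  then show ?thesis by (simp add: dxi_def xi_def)
qed

lemma xi_deriv:
  assumes "1 \<le> j" "j < k"
  shows "((\<lambda>s. xi \<alpha> k (x(j := s))) has_real_derivative dxi \<alpha> j k x) (at (x j))"
proof -
  have "xi \<alpha> k (x(j := s)) = (\<Prod>i\<in>{1..<k} - {j}. x i ^ \<alpha> i) * s ^ \<alpha> j" for s
  proof -
    have "xi \<alpha> k (x(j := s)) = (x(j := s)) j ^ \<alpha> j * (\<Prod>i\<in>{1..<k} - {j}. (x(j := s)) i ^ \<alpha> i)"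
      unfolding xi_def using assms by (intro prod.remove) auto
    also have "(\<Prod>i\<in>{1..<k} - {j}. (x(j := s)) i ^ \<alpha> i) = (\<Prod>i\<in>{1..<k} - {j}. x i ^ \<alpha> i)"
      by (intro prod.cong) auto
    finally show ?thesis by (simp only: fun_upd_same mult.commute)
  qed
  then show ?thesis unfolding dxi_def by (auto intro!: derivative_eq_intros)
qed

text \<open>The form of the force in which the adjoint equation produces it;
  \<open>dHam_dx_eq\<close> is the closed form used to solve the equations.\<close>

lemma dHam_dx_sum:
  assumes "1 \<le> j" "j \<le> n + 1"
  shows "dHam_dx \<alpha> n j x p = (\<Sum>k\<in>{Suc j..n+1}. dxi \<alpha> j k x * xi \<alpha> k x * (p k)\<^sup>2)"
proof -
  have d: "((\<lambda>s. (xi \<alpha> k (x(j := s)))\<^sup>2 * (p k)\<^sup>2) has_real_derivative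
      (if j < k then 2 * (dxi \<alpha> j k x * xi \<alpha> k x * (p k)\<^sup>2) else 0)) (at (x j))" for k
  proof (cases "j < k")
    case True
    then show ?thesis using assms
      by (auto intro!: derivative_eq_intros xi_deriv simp: fun_upd_triv)
  next
    case False
    then have "xi \<alpha> k (x(j := s)) = xi \<alpha> k x" for s by (intro xi_cong) auto
    then show ?thesis using False by simp
  qed
  have "((\<lambda>s. Ham \<alpha> n (x(j := s)) p) has_real_derivative
      (1/2) * (\<Sum>k\<in>{1..n+1}. if j < k then 2 * (dxi \<alpha> j k x * xi \<alpha> k x * (p k)\<^sup>2) else 0)) (at (x j))"
    unfolding Ham_def by (intro DERIV_cmult DERIV_sum d)
  moreover have "(\<Sum>k\<in>{1..n+1}. if j < k then 2 * (dxi \<alpha> j k x * xi \<alpha> k x * (p k)\<^sup>2) else 0)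
      = (\<Sum>k\<in>{Suc j..n+1}. 2 * (dxi \<alpha> j k x * xi \<alpha> k x * (p k)\<^sup>2))"
    by (rule sum.mono_neutral_cong_right) (use assms in auto)
  ultimately show ?thesis
    unfolding dHam_dx_def by (intro DERIV_imp_deriv) (simp add: sum_distrib_left[symmetric])
qed

text \<open>Here a is the base value, A the perturbed one and d its first order change. One constant
  for size, increment and Taylor remainder makes the property stable under products.\<close>

definition approx1 :: "real \<Rightarrow> real \<Rightarrow> real \<Rightarrow> real \<Rightarrow> real \<Rightarrow> bool" where
  "approx1 K e a A d \<longleftrightarrow> \<bar>a\<bar> \<le> K \<and> \<bar>A - a\<bar> \<le> K * e \<and> \<bar>A - a - d\<bar> \<le> K * e\<^sup>2"

text \<open>AB - ab splits into two linear terms and one product of increments, hence the 3; e <= 1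
  lets the quadratic term be counted among the linear ones.\<close>

lemma approx1_mult:
  assumes "approx1 K e a A d" "approx1 L e b B d'" "0 \<le> e" "e \<le> 1"
  shows "approx1 (3 * (K * L)) e (a * b) (A * B) (a * d' + b * d)"
proof -
  have k: "\<bar>a\<bar> \<le> K" "\<bar>A - a\<bar> \<le> K * e" "\<bar>A - a - d\<bar> \<le> K * e\<^sup>2"
    and l: "\<bar>b\<bar> \<le> L" "\<bar>B - b\<bar> \<le> L * e" "\<bar>B - b - d'\<bar> \<le> L * e\<^sup>2"
    using assms by (auto simp: approx1_def)
  have K: "0 \<le> K" "0 \<le> L" using k(1) l(1) by auto
  have m: "\<bar>x * y\<bar> \<le> X * Y" if "\<bar>x\<bar> \<le> X" "\<bar>y\<bar> \<le> Y" for x y X Y :: real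
  proof -
    have "0 \<le> X" using that(1) by linarith
    then show ?thesis unfolding abs_mult using that by (intro mult_mono) auto
  qed
  have q: "\<bar>(A - a) * (B - b)\<bar> \<le> K * L * e\<^sup>2" using m[OF k(2) l(2)] by (simp add: power2_eq_square algebra_simps)
  have e2: "e\<^sup>2 \<le> e" using assms(3,4) by (simp add: power2_eq_square mult_left_le)
  then have "K * L * e\<^sup>2 \<le> K * L * e" using K by (intro mult_left_mono) auto
  moreover have "A * B - a * b = a * (B - b) + b * (A - a) + (A - a) * (B - b)" by (simp add: algebra_simps)
  moreover have "\<bar>a * (B - b)\<bar> \<le> K * L * e" "\<bar>b * (A - a)\<bar> \<le> K * L * e"
    using m[OF k(1) l(2)] m[OF l(1) k(2)] by (simp_all add: algebra_simps)
  ultimately have 1: "\<bar>A * B - a * b\<bar> \<le> 3 * (K * L) * e" using q by linarith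
  have "A * B - a * b - (a * d' + b * d) = a * (B - b - d') + b * (A - a - d) + (A - a) * (B - b)"
    by (simp add: algebra_simps)
  moreover have "\<bar>a * (B - b - d')\<bar> \<le> K * L * e\<^sup>2" "\<bar>b * (A - a - d)\<bar> \<le> K * L * e\<^sup>2"
    using m[OF k(1) l(3)] m[OF l(1) k(3)] by (simp_all add: algebra_simps)
  ultimately have 2: "\<bar>A * B - a * b - (a * d' + b * d)\<bar> \<le> 3 * (K * L) * e\<^sup>2" using q by linarith
  have "0 \<le> K * L" using K by simp
  then have "\<bar>a * b\<bar> \<le> 3 * (K * L)" using m[OF k(1) l(1)] by linarith
  then show ?thesis using 1 2 by (simp add: approx1_def)
qed

lemma approx1_power:
  "\<exists>K. \<forall>x y e. \<bar>x\<bar> \<le> M \<longrightarrow> \<bar>y - x\<bar> \<le> e \<longrightarrow> e \<le> 1 \<longrightarrow>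
     approx1 K e (x ^ m) (y ^ m) (real m * x ^ (m - 1) * (y - x))"
proof (induction m)
  case 0
  show ?case by (intro exI[of _ 1]) (auto simp: approx1_def)
next
  case (Suc m)
  then obtain K where K: "\<And>x y e. \<bar>x\<bar> \<le> M \<Longrightarrow> \<bar>y - x\<bar> \<le> e \<Longrightarrow> e \<le> 1 \<Longrightarrow>
     approx1 K e (x ^ m) (y ^ m) (real m * x ^ (m - 1) * (y - x))" by blast
  have "approx1 (3 * (max M 1 * K)) e (x ^ Suc m) (y ^ Suc m) (real (Suc m) * x ^ (Suc m - 1) * (y - x))"
    if h: "\<bar>x\<bar> \<le> M" "\<bar>y - x\<bar> \<le> e" "e \<le> 1" for x y e
  proof -
    have "0 \<le> e" using h by linarith
    moreover from this have "1 * e \<le> max M 1 * e" by (intro mult_right_mono) auto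
    ultimately have "approx1 (max M 1) e x y (y - x)" using h by (auto simp: approx1_def)
    from approx1_mult[OF this K[OF h] \<open>0 \<le> e\<close> h(3)]
    have "approx1 (3 * (max M 1 * K)) e (x ^ Suc m) (y ^ Suc m) (x * (real m * x ^ (m - 1) * (y - x)) + x ^ m * (y - x))"
      by simp
    moreover have "x * (real m * x ^ (m - 1) * (y - x)) + x ^ m * (y - x) = real (Suc m) * x ^ (Suc m - 1) * (y - x)"
      by (cases m) (auto simp: algebra_simps)
    ultimately show ?thesis by simp
  qed
  then show ?case by blast
qed

text \<open>The point is uniformity: K depends on the bound M but not on x, so the expansion holds
  with one constant along a whole curve.\<close>

lemma approx1_xi:
  "\<exists>K. \<forall>x y e. (\<forall>i\<in>{1..<k}. \<bar>x i\<bar> \<le> M \<and> \<bar>y i - x i\<bar> \<le> e) \<longrightarrow> 0 \<le> e \<longrightarrow> e \<le> 1 \<longrightarrow>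
     approx1 K e (xi \<alpha> k x) (xi \<alpha> k y) (\<Sum>j\<in>{1..<k}. dxi \<alpha> j k x * (y j - x j))"
proof (induction k)
  case 0
  show ?case by (intro exI[of _ 1]) (auto simp: approx1_def xi_def)
next
  case (Suc k)
  show ?case
  proof (cases "k = 0")
    case True
    then show ?thesis by (intro exI[of _ 1]) (auto simp: approx1_def xi_def)
  next
    case False
    then have k: "1 \<le> k" by simp
    obtain K where K: "\<And>x y e. (\<forall>i\<in>{1..<k}. \<bar>x i\<bar> \<le> M \<and> \<bar>y i - x i\<bar> \<le> e) \<Longrightarrow> 0 \<le> e \<Longrightarrow> e \<le> 1 \<Longrightarrow>
       approx1 K e (xi \<alpha> k x) (xi \<alpha> k y) (\<Sum>j\<in>{1..<k}. dxi \<alpha> j k x * (y j - x j))" using Suc by blast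
    obtain L where L: "\<And>x y e. \<bar>x\<bar> \<le> M \<Longrightarrow> \<bar>y - x\<bar> \<le> e \<Longrightarrow> e \<le> 1 \<Longrightarrow>
       approx1 L e (x ^ \<alpha> k) (y ^ \<alpha> k) (real (\<alpha> k) * x ^ (\<alpha> k - 1) * (y - x))"
      using approx1_power[of M "\<alpha> k"] by blast
    have "approx1 (3 * (K * L)) e (xi \<alpha> (Suc k) x) (xi \<alpha> (Suc k) y) (\<Sum>j\<in>{1..<Suc k}. dxi \<alpha> j (Suc k) x * (y j - x j))"
      if h: "\<forall>i\<in>{1..<Suc k}. \<bar>x i\<bar> \<le> M \<and> \<bar>y i - x i\<bar> \<le> e" "0 \<le> e" "e \<le> 1" for x y e
    proof -
      have "approx1 K e (xi \<alpha> k x) (xi \<alpha> k y) (\<Sum>j\<in>{1..<k}. dxi \<alpha> j k x * (y j - x j))"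
        using h by (intro K) auto
      moreover have "approx1 L e (x k ^ \<alpha> k) (y k ^ \<alpha> k) (real (\<alpha> k) * x k ^ (\<alpha> k - 1) * (y k - x k))"
        using h k by (intro L) auto
      ultimately have *: "approx1 (3 * (K * L)) e (xi \<alpha> k x * x k ^ \<alpha> k) (xi \<alpha> k y * y k ^ \<alpha> k)
        (xi \<alpha> k x * (real (\<alpha> k) * x k ^ (\<alpha> k - 1) * (y k - x k)) + x k ^ \<alpha> k * (\<Sum>j\<in>{1..<k}. dxi \<alpha> j k x * (y j - x j)))"
        using h(2,3) by (rule approx1_mult)
      have "(\<Sum>j\<in>{1..<Suc k}. dxi \<alpha> j (Suc k) x * (y j - x j)) =
         (\<Sum>j\<in>{1..<k}. dxi \<alpha> j (Suc k) x * (y j - x j)) + dxi \<alpha> k (Suc k) x * (y k - x k)"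
        using k by simp
      also have "(\<Sum>j\<in>{1..<k}. dxi \<alpha> j (Suc k) x * (y j - x j)) = x k ^ \<alpha> k * (\<Sum>j\<in>{1..<k}. dxi \<alpha> j k x * (y j - x j))"
        unfolding sum_distrib_left by (intro sum.cong refl) (simp add: dxi_Suc)
      finally have "(\<Sum>j\<in>{1..<Suc k}. dxi \<alpha> j (Suc k) x * (y j - x j)) =
        xi \<alpha> k x * (real (\<alpha> k) * x k ^ (\<alpha> k - 1) * (y k - x k)) + x k ^ \<alpha> k * (\<Sum>j\<in>{1..<k}. dxi \<alpha> j k x * (y j - x j))"
        using k by (simp add: dxi_last)
      then show ?thesis using * k by (simp add: xi_Suc)
    qed
    then show ?thesis by blast
  qed
qed

subsection \<open>First variation\<close>

text \<open>The competitors in \<open>minimal\<close> are all horizontal curves with the same end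
  points. \<open>u_unit\<close> holds at every time, as can be arranged on a null set, and makes the
  length of u at most b - a. \<open>nondegenerate\<close> is what excludes abnormal
  minimizers.\<close>

locale length_minimizer =
  fixes \<alpha> :: "nat \<Rightarrow> nat" and n :: nat and a b :: real and X u :: "real \<Rightarrow> nat \<Rightarrow> real"
  assumes ab: "a < b"
    and X_bm: "\<And>j. j \<in> {1..n+1} \<Longrightarrow> bm (\<lambda>t. X t j)"
    and u_bm: "\<And>j. j \<in> {1..n+1} \<Longrightarrow> bm (\<lambda>t. u t j)"
    and u_unit: "\<And>t. (\<Sum>j\<in>{1..n+1}. (u t j)\<^sup>2) \<le> 1"
    and X_eq: "\<And>j t. j \<in> {1..n+1} \<Longrightarrow> t \<in> {a..b} \<Longrightarrow>
      X t j = X a j + (LINT s:{a..t}|lborel. u s j * xi \<alpha> j (X s))"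
    and minimal: "\<And>Y w. horiz_control \<alpha> n a b Y w \<Longrightarrow> (\<And>j. j \<in> {1..n+1} \<Longrightarrow> Y a j = X a j \<and> Y b j = X b j) \<Longrightarrow>
      b - a \<le> ctrl_length n a b w"
    and nondegenerate: "\<And>j. j \<in> {1..n+1} \<Longrightarrow> (LINT s:{a..b}|lborel. (xi \<alpha> j (X s))\<^sup>2) \<noteq> 0"
begin

abbreviation I where "I f \<equiv> LINT s:{a..b}|lborel. f s"

lemma xi_bm:
  assumes "\<And>j. 1 \<le> j \<Longrightarrow> j < k \<Longrightarrow> bm (\<lambda>t. Y t j)"
  shows "bm (\<lambda>t. xi \<alpha> k (Y t))"
  unfolding xi_def using assms by (intro bm_prod bm_power) auto

lemma xi_X_bm [simp]: "k \<in> {1..n+1} \<Longrightarrow> bm (\<lambda>t. xi \<alpha> k (X t))"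
  by (rule xi_bm, rule X_bm) auto

lemma dxi_X_bm [simp]: "1 \<le> j \<Longrightarrow> j < k \<Longrightarrow> k \<le> n + 1 \<Longrightarrow> bm (\<lambda>t. dxi \<alpha> j k (X t))"
  unfolding dxi_def by (intro bm_mult bm_prod bm_power bm_const X_bm) auto

section \<open>The adjoint equation along the minimizer\<close>

text \<open>Minus the right-hand side of the adjoint equation, with the true control u_k in place of
  p_k xi_k; the substitution turns it into \<open>dHam_dx_sum\<close>. Only momenta above j occur,
  so the equation is solved from the top by integration.\<close>

definition adj :: "(real \<Rightarrow> nat \<Rightarrow> real) \<Rightarrow> nat \<Rightarrow> real \<Rightarrow> real" where
  "adj p j t = (\<Sum>k\<in>{Suc j..n+1}. dxi \<alpha> j k (X t) * u t k * p t k)"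

text \<open>The free constants of the adjoint equation are fixed by orthogonality of the defect
  \<open>u - p \<xi>\<close> to the direction \<open>\<xi>\<close> that is used below to restore the end point.\<close>

lemma adjoint_exists:
  "\<exists>p c. \<forall>j\<in>{1..n+1}. bm (\<lambda>t. p t j) \<and>
     (\<forall>t\<in>{a..b}. p t j = c j - (LINT s:{a..t}|lborel. adj p j s)) \<and>
     I (\<lambda>t. (u t j - p t j * xi \<alpha> j (X t)) * xi \<alpha> j (X t)) = 0"
proof -
  have "\<exists>p c. \<forall>j\<in>{m..n+1}. bm (\<lambda>t. p t j) \<and>
     (\<forall>t\<in>{a..b}. p t j = c j - (LINT s:{a..t}|lborel. adj p j s)) \<and>
     I (\<lambda>t. (u t j - p t j * xi \<alpha> j (X t)) * xi \<alpha> j (X t)) = 0" if "1 \<le> m" "m \<le> n + 2" for m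
    using that(2,1)
  proof (induction rule: inc_induct)
    case base
    then show ?case by auto
  next
    case (step m)
    have "\<exists>p c. \<forall>j\<in>{Suc m..n+1}. bm (\<lambda>t. p t j) \<and>
     (\<forall>t\<in>{a..b}. p t j = c j - (LINT s:{a..t}|lborel. adj p j s)) \<and>
     I (\<lambda>t. (u t j - p t j * xi \<alpha> j (X t)) * xi \<alpha> j (X t)) = 0"
      by (rule step.IH) simp
    then obtain p c where pc: "\<forall>j\<in>{Suc m..n+1}. bm (\<lambda>t. p t j) \<and>
     (\<forall>t\<in>{a..b}. p t j = c j - (LINT s:{a..t}|lborel. adj p j s)) \<and>
     I (\<lambda>t. (u t j - p t j * xi \<alpha> j (X t)) * xi \<alpha> j (X t)) = 0" by blast
    have p: "\<And>j. j \<in> {Suc m..n+1} \<Longrightarrow> bm (\<lambda>t. p t j)"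
      "\<And>j t. j \<in> {Suc m..n+1} \<Longrightarrow> t \<in> {a..b} \<Longrightarrow> p t j = c j - (LINT s:{a..t}|lborel. adj p j s)"
      "\<And>j. j \<in> {Suc m..n+1} \<Longrightarrow> I (\<lambda>t. (u t j - p t j * xi \<alpha> j (X t)) * xi \<alpha> j (X t)) = 0"
      using pc by blast+
    have m: "m \<in> {1..n+1}" using step by auto
    define f where "f = adj p m"
    have f_bm: "bm f" unfolding f_def adj_def[abs_def] using m
      by (intro bm_sum bm_mult dxi_X_bm u_bm p(1)) auto
    define P where "P = (\<lambda>t. LINT s:{a..max a (min b t)}|lborel. f s)"
    have P_bm: "bm P" unfolding P_def using f_bm ab by simp
    let ?w = "\<lambda>t. xi \<alpha> m (X t)"
    \<comment> \<open>With q_m = d - P, the integral of (u_m - q_m w) w is I(u_m w) + I(P w^2) - d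
      I(w^2); this d is its zero.\<close>
    define d where "d = (I (\<lambda>t. u t m * ?w t) + I (\<lambda>t. P t * (?w t)\<^sup>2)) / I (\<lambda>t. (?w t)\<^sup>2)"
    define q where "q = (\<lambda>t. (p t)(m := d - P t))"
    have q_other: "q t k = p t k" if "k \<noteq> m" for t k using that by (simp add: q_def)
    have adj_q: "adj q j = adj p j" if "m \<le> j" for j
      unfolding adj_def[abs_def] using that by (intro ext sum.cong refl) (simp add: q_other)
    have "I (\<lambda>t. (u t m - q t m * ?w t) * ?w t) = I (\<lambda>t. (u t m * ?w t + P t * (?w t)\<^sup>2) - d * (?w t)\<^sup>2)"
      by (rule LI_cong) (simp add: q_def power2_eq_square algebra_simps)
    also have "\<dots> = I (\<lambda>t. u t m * ?w t) + I (\<lambda>t. P t * (?w t)\<^sup>2) - d * I (\<lambda>t. (?w t)\<^sup>2)"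
      using u_bm[OF m] xi_X_bm[OF m] P_bm by (simp add: LI_diff LI_add)
    also have "\<dots> = 0" using nondegenerate[OF m] by (simp add: d_def)
    finally have q3: "I (\<lambda>t. (u t m - q t m * ?w t) * ?w t) = 0" .
    have q2: "q t m = d - (LINT s:{a..t}|lborel. adj q m s)" if "t \<in> {a..b}" for t
    proof -
      have "max a (min b t) = t" using that by auto
      then show ?thesis unfolding adj_q[OF order_refl] by (simp add: q_def P_def f_def)
    qed
    have q1: "bm (\<lambda>t. q t m)" using P_bm by (simp add: q_def)
    have "\<forall>j\<in>{m..n+1}. bm (\<lambda>t. q t j) \<and>
     (\<forall>t\<in>{a..b}. q t j = (c(m := d)) j - (LINT s:{a..t}|lborel. adj q j s)) \<and>
     I (\<lambda>t. (u t j - q t j * xi \<alpha> j (X t)) * xi \<alpha> j (X t)) = 0"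
    proof
      fix j assume "j \<in> {m..n+1}"
      then consider "j = m" | "j \<noteq> m" "j \<in> {Suc m..n+1}" "m \<le> j" by force
      then show "bm (\<lambda>t. q t j) \<and>
         (\<forall>t\<in>{a..b}. q t j = (c(m := d)) j - (LINT s:{a..t}|lborel. adj q j s)) \<and>
         I (\<lambda>t. (u t j - q t j * xi \<alpha> j (X t)) * xi \<alpha> j (X t)) = 0"
      proof cases
        case 1
        then show ?thesis using q1 q2 q3 by simp
      next
        case 2
        have "\<forall>t\<in>{a..b}. p t j = c j - (LINT s:{a..t}|lborel. adj p j s)" using p(2)[OF 2(2)] by blast
        then show ?thesis using p(1,3)[OF 2(2)] 2(1) by (simp add: q_other adj_q[OF 2(3)])
      qed
    qed
    then show ?case by blast
  qed
  from this[of 1] show ?thesis by simp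
qed

section \<open>Perturbed controls with fixed end points\<close>

text \<open>A variation of size e in direction v plus a corrector. The corrector uses
  \<open>xi\<close> at the unperturbed curve, so its shape is known beforehand and only the number
  h_j remains to be found.\<close>

definition ctrl :: "real \<Rightarrow> (real \<Rightarrow> nat \<Rightarrow> real) \<Rightarrow> (nat \<Rightarrow> real) \<Rightarrow> real \<Rightarrow> nat \<Rightarrow> real" where
  "ctrl e v h t j = u t j + e * v t j + h j * xi \<alpha> j (X t)"

text \<open>Limited to the first m coordinates so that it can be built one coordinate at a time. All
  deviations are linear in e, with a constant that is to be chosen before e.\<close>

definition admissible :: "real \<Rightarrow> real \<Rightarrow> (real \<Rightarrow> nat \<Rightarrow> real) \<Rightarrow> nat \<Rightarrow> (real \<Rightarrow> nat \<Rightarrow> real) \<Rightarrow> (nat \<Rightarrow> real) \<Rightarrow> bool" where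
  "admissible C e v m Y h \<longleftrightarrow> (\<forall>j\<in>{1..m}. bm (\<lambda>t. Y t j) \<and> Y a j = X a j \<and> Y b j = X b j \<and> \<bar>h j\<bar> \<le> C * e \<and>
     (\<forall>t\<in>{a..b}. \<bar>Y t j - X t j\<bar> \<le> C * e \<and>
        Y t j = X a j + (LINT s:{a..t}|lborel. ctrl e v h s j * xi \<alpha> j (Y s))))"

lemma X_bound:
  obtains M where "0 \<le> M" "\<And>j t. j \<in> {1..n+1} \<Longrightarrow> \<bar>X t j\<bar> \<le> M"
proof -
  have "\<exists>M. \<forall>j\<in>{1..n+1}. \<forall>t. \<bar>X t j\<bar> \<le> M j"
  proof (rule bchoice, intro ballI)
    fix j assume "j \<in> {1..n+1}"
    then show "\<exists>M. \<forall>t. \<bar>X t j\<bar> \<le> M" using X_bm[of j] unfolding bm_def by blast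
  qed
  then obtain M where M: "\<forall>j\<in>{1..n+1}. \<forall>t. \<bar>X t j\<bar> \<le> M j" by blast
  have "\<bar>X t j\<bar> \<le> (\<Sum>i\<in>{1..n+1}. \<bar>M i\<bar>)" if "j \<in> {1..n+1}" for t j
  proof -
    have "\<bar>X t j\<bar> \<le> \<bar>M j\<bar>" using M[rule_format, OF that, of t] by linarith
    also have "\<bar>M j\<bar> \<le> (\<Sum>i\<in>{1..n+1}. \<bar>M i\<bar>)" using that by (intro member_le_sum) auto
    finally show ?thesis .
  qed
  then show ?thesis using that[of "\<Sum>i\<in>{1..n+1}. \<bar>M i\<bar>"] by (simp add: sum_nonneg)
qed

text \<open>Since \<open>\<xi> j\<close> depends on the coordinates below \<open>j\<close> only, the end point condition for the
  \<open>j\<close>-th coordinate is a linear equation for \<open>h j\<close> once the previous coordinates are known.\<close>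

lemma admissible_exists:
  assumes v: "\<And>j. j \<in> {1..n+1} \<Longrightarrow> bm (\<lambda>t. v t j)" and m: "m \<le> n + 1"
  shows "\<exists>C\<ge>0. \<exists>e0>0. \<forall>e. 0 < e \<longrightarrow> e \<le> e0 \<longrightarrow> (\<exists>Y h. admissible C e v m Y h)"
  using m
proof (induction m)
  case 0
  then show ?case by (intro exI[of _ 0]) (auto simp: admissible_def intro!: exI[of _ 1])
next
  case (Suc m)
  then obtain C e0 where C: "0 \<le> C" "0 < e0" and ex: "\<And>e. 0 < e \<Longrightarrow> e \<le> e0 \<Longrightarrow> \<exists>Y h. admissible C e v m Y h"
    by auto
  let ?k = "Suc m"
  have k: "?k \<in> {1..n+1}" using Suc.prems by auto
  let ?w = "\<lambda>t. xi \<alpha> ?k (X t)"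
  note ub = u_bm[OF k] and wb = xi_X_bm[OF k] and vb = v[OF k]
  obtain M where M: "0 \<le> M" "\<And>j t. j \<in> {1..n+1} \<Longrightarrow> \<bar>X t j\<bar> \<le> M" using X_bound by blast
  obtain K where K: "\<And>x y e. (\<forall>i\<in>{1..<?k}. \<bar>x i\<bar> \<le> M \<and> \<bar>y i - x i\<bar> \<le> e) \<Longrightarrow> 0 \<le> e \<Longrightarrow> e \<le> 1 \<Longrightarrow>
     approx1 K e (xi \<alpha> ?k x) (xi \<alpha> ?k y) (\<Sum>j\<in>{1..<?k}. dxi \<alpha> j ?k x * (y j - x j))"
    using approx1_xi[of ?k M \<alpha>] by blast
  obtain U where U: "0 \<le> U" "\<And>t. \<bar>u t ?k\<bar> \<le> U" using bm_bound[OF ub] by blast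
  obtain V where V: "0 \<le> V" "\<And>t. \<bar>v t ?k\<bar> \<le> V" using bm_bound[OF vb] by blast
  obtain W where W: "0 \<le> W" "\<And>t. \<bar>?w t\<bar> \<le> W" using bm_bound[OF wb] by blast
  define D where "D = I (\<lambda>t. (?w t)\<^sup>2)"
  have "0 \<le> D" unfolding D_def set_lebesgue_integral_def by (rule integral_nonneg_AE) auto
  then have D: "0 < D" using nondegenerate[OF k] by (simp add: D_def)
  \<comment> \<open>The constants to come: K1 e bounds the change of the weight, B e the uncorrected
    change r of the velocity, Ch e the corrector, and C' e every deviation.\<close>
  define K1 where "K1 = \<bar>K\<bar> * C"
  have K1: "0 \<le> K1" using C by (simp add: K1_def)
  \<comment> \<open>The terms ensure, in turn, that the previous coordinates exist, e <= 1, C e <= 1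
    as the expansion of \<open>xi\<close> requires, and that the coefficient E below differs from D
    by at most D / 2.\<close>
  define e1 where "e1 = min (min e0 1) (min (1 / (C + 1)) (D / (2 * (K1 * W * (b - a) + 1))))"
  have "0 \<le> K1 * W * (b - a)" using K1 W ab by simp
  then have q0: "0 < 2 * (K1 * W * (b - a) + 1)" by simp
  have e1: "0 < e1" using C D q0 by (simp add: e1_def)
  define B where "B = U * K1 + V * (W + K1)"
  have B: "0 \<le> B" using U V W K1 by (simp add: B_def)
  define Ch where "Ch = 2 * B * (b - a) / D"
  have Ch: "0 \<le> Ch" using B ab D by (simp add: Ch_def)
  define C' where "C' = max C (max Ch ((B + Ch * W * (W + K1)) * (b - a)))"
  have "0 \<le> C'" using C by (simp add: C'_def)
  moreover have "\<exists>Y h. admissible C' e v ?k Y h" if e: "0 < e" "e \<le> e1" for e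
  proof -
    have e': "e \<le> e0" "e \<le> 1" "e \<le> 1 / (C + 1)" "e \<le> D / (2 * (K1 * W * (b - a) + 1))"
      using e by (auto simp: e1_def)
    have Ce: "C * e \<le> 1" "0 \<le> C * e"
    proof -
      have "(C + 1) * e \<le> 1" using e'(3) C by (simp add: field_simps)
      then show "C * e \<le> 1" using e by (simp add: algebra_simps)
    qed (use C e in auto)
    obtain Y h where Y: "admissible C e v m Y h" using ex[OF e(1) e'(1)] by blast
    have Yb: "\<And>j. 1 \<le> j \<Longrightarrow> j < ?k \<Longrightarrow> bm (\<lambda>t. Y t j)" using Y by (auto simp: admissible_def)
    let ?W = "\<lambda>t. xi \<alpha> ?k (Y t)"
    have Wb: "bm ?W" by (rule xi_bm) (rule Yb)
    have Ww: "\<bar>?W t - ?w t\<bar> \<le> K1 * e" if t: "t \<in> {a..b}" for t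
    proof -
      have "approx1 K (C * e) (?w t) (?W t) (\<Sum>j\<in>{1..<?k}. dxi \<alpha> j ?k (X t) * (Y t j - X t j))"
      proof (intro K ballI conjI)
        fix i assume i: "i \<in> {1..<?k}"
        then show "\<bar>X t i\<bar> \<le> M" using k by (intro M(2)) auto
        have "i \<in> {1..m}" using i by auto
        then show "\<bar>Y t i - X t i\<bar> \<le> C * e" using Y t unfolding admissible_def by blast
      qed (use Ce in auto)
      then have "\<bar>?W t - ?w t\<bar> \<le> K * (C * e)" by (simp add: approx1_def)
      also have "\<dots> \<le> \<bar>K\<bar> * (C * e)" using Ce by (intro mult_right_mono) auto
      finally show ?thesis by (simp add: K1_def algebra_simps)
    qed
    have Wbd: "\<bar>?W t\<bar> \<le> W + K1" if t: "t \<in> {a..b}" for t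
    proof -
      have "K1 * e \<le> K1" using K1 e'(2) e(1) by (simp add: mult_left_le)
      then show ?thesis using Ww[OF t] W(2)[of t] by linarith
    qed
    \<comment> \<open>The coefficient of the unknown h in the end point equation; at the unperturbed
      curve it would be D > 0.\<close>
    define E where "E = I (\<lambda>t. ?W t * ?w t)"
    have "\<bar>I (\<lambda>t. ?W t * ?w t - (?w t)\<^sup>2)\<bar> \<le> K1 * e * W * (b - a)"
    proof (rule LI_abs_le)
      fix t assume t: "t \<in> {a..b}"
      have "\<bar>?W t * ?w t - (?w t)\<^sup>2\<bar> = \<bar>?W t - ?w t\<bar> * \<bar>?w t\<bar>"
        by (simp add: power2_eq_square abs_mult[symmetric] algebra_simps)
      also have "\<dots> \<le> K1 * e * W" using Ww[OF t] W(2)[of t] K1 e W(1) by (intro mult_mono) auto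
      finally show "\<bar>?W t * ?w t - (?w t)\<^sup>2\<bar> \<le> K1 * e * W" .
    qed (use Wb wb ab in auto)
    moreover have "I (\<lambda>t. ?W t * ?w t - (?w t)\<^sup>2) = E - D"
      using Wb wb by (simp add: LI_diff E_def D_def)
    moreover have "K1 * e * W * (b - a) \<le> D / 2"
    proof -
      have "e * (2 * (K1 * W * (b - a) + 1)) \<le> D" using e'(4) q0 by (simp add: pos_le_divide_eq)
      then show ?thesis using e(1) by (simp add: algebra_simps)
    qed
    ultimately have E: "D / 2 \<le> E" by linarith
    then have E0: "0 < E" using D by linarith
    \<comment> \<open>Change of the velocity before the correction. The end point is restored when I
      r + g * E = 0, which gives g.\<close>
    define r where "r = (\<lambda>t. (?W t - ?w t) * u t ?k + e * (?W t * v t ?k))"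
    have rb: "bm r" unfolding r_def using Wb wb ub vb by simp
    have rbd: "\<bar>r t\<bar> \<le> B * e" if t: "t \<in> {a..b}" for t
    proof -
      have "\<bar>r t\<bar> \<le> \<bar>(?W t - ?w t) * u t ?k\<bar> + \<bar>e * (?W t * v t ?k)\<bar>" unfolding r_def by (rule abs_triangle_ineq)
      also have "\<dots> = \<bar>?W t - ?w t\<bar> * \<bar>u t ?k\<bar> + e * (\<bar>?W t\<bar> * \<bar>v t ?k\<bar>)" using e by (simp add: abs_mult)
      also have "\<dots> \<le> (K1 * e) * U + e * ((W + K1) * V)"
        using Ww[OF t] Wbd[OF t] U V W K1 e by (intro add_mono mult_mono mult_left_mono) auto
      finally show ?thesis by (simp add: B_def algebra_simps)
    qed
    define g where "g = - I r / E"
    have gbd: "\<bar>g\<bar> \<le> Ch * e"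
    proof -
      have "\<bar>g\<bar> = \<bar>I r\<bar> / E" using E0 by (simp add: g_def)
      also have "\<dots> \<le> (B * e * (b - a)) / (D / 2)"
        using LI_abs_le[OF rb less_imp_le[OF ab] rbd] E D B e ab by (intro frac_le) auto
      finally show ?thesis by (simp add: Ch_def algebra_simps)
    qed
    define h' where "h' = h(?k := g)"
    define c where "c = (\<lambda>t. ctrl e v h' t ?k * ?W t)"
    have c_eq: "c t = u t ?k * ?w t + (r t + g * (?W t * ?w t))" for t
      by (simp add: c_def ctrl_def h'_def r_def algebra_simps)
    have cb: "bm c" unfolding c_eq[abs_def] using rb Wb wb ub by simp
    define Z where "Z = (\<lambda>t. X a ?k + (LINT s:{a..max a (min b t)}|lborel. c s))"
    have Zb: "bm Z" unfolding Z_def using cb ab by simp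
    define Y' where "Y' = (\<lambda>t. (Y t)(?k := Z t))"
    have xi_Y': "xi \<alpha> j (Y' t) = xi \<alpha> j (Y t)" if "j \<le> ?k" for j t
      using that by (intro xi_cong) (auto simp: Y'_def)
    have Z_diff: "Z t - X t ?k = (LINT s:{a..t}|lborel. r s + g * (?W s * ?w s))" if t: "t \<in> {a..b}" for t
    proof -
      have "(LINT s:{a..t}|lborel. c s) = (LINT s:{a..t}|lborel. u s ?k * ?w s) + (LINT s:{a..t}|lborel. r s + g * (?W s * ?w s))"
        unfolding c_eq[abs_def] using rb Wb wb ub by (intro LI_add) auto
      moreover have "max a (min b t) = t" using t by auto
      ultimately show ?thesis using X_eq[OF k t] by (simp add: Z_def)
    qed
    have Zbd: "\<bar>Z t - X t ?k\<bar> \<le> C' * e" if t: "t \<in> {a..b}" for t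
    proof -
      have "\<bar>Z t - X t ?k\<bar> \<le> ((B + Ch * W * (W + K1)) * e) * (t - a)"
        unfolding Z_diff[OF t]
      proof (rule LI_abs_le)
        fix s assume "s \<in> {a..t}"
        then have s: "s \<in> {a..b}" using t by auto
        have "\<bar>r s + g * (?W s * ?w s)\<bar> \<le> \<bar>r s\<bar> + \<bar>g\<bar> * (\<bar>?W s\<bar> * \<bar>?w s\<bar>)"
          by (metis abs_mult abs_triangle_ineq)
        also have "\<dots> \<le> B * e + (Ch * e) * ((W + K1) * W)"
          using rbd[OF s] gbd Wbd[OF s] W K1 Ch e by (intro add_mono mult_mono) auto
        finally show "\<bar>r s + g * (?W s * ?w s)\<bar> \<le> (B + Ch * W * (W + K1)) * e" by (simp add: algebra_simps)
      qed (use rb Wb wb t in auto)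
      also have "\<dots> \<le> ((B + Ch * W * (W + K1)) * e) * (b - a)"
        using B Ch W K1 e t by (intro mult_left_mono) auto
      also have "\<dots> = ((B + Ch * W * (W + K1)) * (b - a)) * e" by simp
      also have "\<dots> \<le> C' * e" using e by (intro mult_right_mono) (auto simp: C'_def)
      finally show ?thesis .
    qed
    have Za: "Z a = X a ?k" using LI_point[of a c] ab by (simp add: Z_def)
    have Zend: "Z b = X b ?k"
    proof -
      have "Z b - X b ?k = I r + g * E"
        using Z_diff[of b] ab rb Wb wb by (simp add: LI_add E_def)
      then show ?thesis using E0 by (simp add: g_def)
    qed
    have CC: "C * e \<le> C' * e" "Ch * e \<le> C' * e" using e by (auto simp: C'_def intro!: mult_right_mono)
    have "admissible C' e v ?k Y' h'"
      unfolding admissible_def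
    proof
      fix j assume "j \<in> {1..?k}"
      then consider "j = ?k" | "j \<noteq> ?k" "j \<in> {1..m}" "j \<le> ?k" by force
      then show "bm (\<lambda>t. Y' t j) \<and> Y' a j = X a j \<and> Y' b j = X b j \<and> \<bar>h' j\<bar> \<le> C' * e \<and>
       (\<forall>t\<in>{a..b}. \<bar>Y' t j - X t j\<bar> \<le> C' * e \<and>
          Y' t j = X a j + (LINT s:{a..t}|lborel. ctrl e v h' s j * xi \<alpha> j (Y' s)))"
      proof cases
        case 1
        have "Z t = X a ?k + (LINT s:{a..t}|lborel. ctrl e v h' s ?k * xi \<alpha> ?k (Y' s))" if "t \<in> {a..b}" for t
        proof -
          have "max a (min b t) = t" using that by auto
          then show ?thesis by (simp add: Z_def xi_Y' c_def)
        qed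
        then show ?thesis using 1 Zb Za Zend gbd Zbd CC by (auto simp: Y'_def h'_def)
      next
        case 2
        have "ctrl e v h' s j = ctrl e v h s j" for s using 2 by (simp add: ctrl_def h'_def)
        moreover have "Y' t j = Y t j" for t using 2 by (simp add: Y'_def)
        moreover have "bm (\<lambda>t. Y t j) \<and> Y a j = X a j \<and> Y b j = X b j \<and> \<bar>h j\<bar> \<le> C * e \<and>
         (\<forall>t\<in>{a..b}. \<bar>Y t j - X t j\<bar> \<le> C * e \<and>
            Y t j = X a j + (LINT s:{a..t}|lborel. ctrl e v h s j * xi \<alpha> j (Y s)))"
          using Y 2(2) unfolding admissible_def by blast
        moreover have "h' j = h j" using 2 by (simp add: h'_def)
        ultimately show ?thesis using CC(1) xi_Y'[OF 2(3)] by (auto intro: order_trans)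
      qed
    qed
    then show "\<exists>Y h. admissible C' e v ?k Y h" by blast
  qed
  ultimately show ?case using e1 by blast
qed

text \<open>The variation \<open>v = - (u - p \<xi>)\<close> is tested. Minimality bounds the first order change of the
  energy from below, while integrating \<open>p\<close> against the variation of the curve, which vanishes at both
  ends, identifies this change as \<open>- e \<Sum> \<integral> (u - p \<xi>)\<^sup>2\<close> up to \<open>O(e\<^sup>2)\<close>.\<close>

lemma defect_zero:
  assumes p_bm: "\<And>j. j \<in> {1..n+1} \<Longrightarrow> bm (\<lambda>t. p t j)"
    and p_eq: "\<And>j t. j \<in> {1..n+1} \<Longrightarrow> t \<in> {a..b} \<Longrightarrow> p t j = c j - (LINT s:{a..t}|lborel. adj p j s)"
    and p_orth: "\<And>j. j \<in> {1..n+1} \<Longrightarrow> I (\<lambda>t. (u t j - p t j * xi \<alpha> j (X t)) * xi \<alpha> j (X t)) = 0"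
    and j: "j \<in> {1..n+1}"
  shows "I (\<lambda>t. (u t j - p t j * xi \<alpha> j (X t))\<^sup>2) = 0"
proof -
  let ?N = "{1..n+1}"
  define r where "r = (\<lambda>t j. u t j - p t j * xi \<alpha> j (X t))"
  have r_bm: "bm (\<lambda>t. r t j)" if "j \<in> ?N" for j
    unfolding r_def using u_bm[OF that] p_bm[OF that] xi_X_bm[OF that] by simp
  define v where "v = (\<lambda>t j. - r t j)"
  have v_bm: "bm (\<lambda>t. v t j)" if "j \<in> ?N" for j unfolding v_def using r_bm[OF that] by simp
  have "\<exists>C\<ge>0. \<exists>e0>0. \<forall>e. 0 < e \<longrightarrow> e \<le> e0 \<longrightarrow> (\<exists>Y h. admissible C e v (n + 1) Y h)"
    by (rule admissible_exists[OF _ order_refl]) (rule v_bm)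
  then obtain C e0 where C: "0 \<le> C" "0 < e0" and ex: "\<And>e. 0 < e \<Longrightarrow> e \<le> e0 \<Longrightarrow> \<exists>Y h. admissible C e v (n + 1) Y h"
    by auto
  obtain M where M: "0 \<le> M" "\<And>j t. j \<in> ?N \<Longrightarrow> \<bar>X t j\<bar> \<le> M" using X_bound by blast
  have "\<exists>K. \<forall>k\<in>?N. \<forall>x y e. (\<forall>i\<in>{1..<k}. \<bar>x i\<bar> \<le> M \<and> \<bar>y i - x i\<bar> \<le> e) \<longrightarrow> 0 \<le> e \<longrightarrow> e \<le> 1 \<longrightarrow>
     approx1 (K k) e (xi \<alpha> k x) (xi \<alpha> k y) (\<Sum>j\<in>{1..<k}. dxi \<alpha> j k x * (y j - x j))"
    by (rule bchoice, rule ballI, rule approx1_xi)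
  then obtain K where K0: "\<forall>k\<in>?N. \<forall>x y e. (\<forall>i\<in>{1..<k}. \<bar>x i\<bar> \<le> M \<and> \<bar>y i - x i\<bar> \<le> e) \<longrightarrow> 0 \<le> e \<longrightarrow> e \<le> 1 \<longrightarrow>
     approx1 (K k) e (xi \<alpha> k x) (xi \<alpha> k y) (\<Sum>j\<in>{1..<k}. dxi \<alpha> j k x * (y j - x j))" ..
  note K = bspec[OF K0, THEN spec, THEN spec, THEN spec, THEN mp, THEN mp, THEN mp]
  have bnd: "\<exists>B. \<forall>k\<in>?N. \<forall>t. \<bar>f t k\<bar> \<le> B k" if "\<And>k. k \<in> ?N \<Longrightarrow> bm (\<lambda>t. f t k)" for f :: "real \<Rightarrow> nat \<Rightarrow> real"
  proof (rule bchoice, rule ballI)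
    fix k assume "k \<in> ?N"
    then show "\<exists>B. \<forall>t. \<bar>f t k\<bar> \<le> B" using that unfolding bm_def by blast
  qed
  obtain W where "\<forall>k\<in>?N. \<forall>t. \<bar>xi \<alpha> k (X t)\<bar> \<le> W k" using bnd[of "\<lambda>t k. xi \<alpha> k (X t)", OF xi_X_bm] ..
  note W = bspec[OF this, THEN spec]
  obtain V where "\<forall>k\<in>?N. \<forall>t. \<bar>v t k\<bar> \<le> V k" using bnd[of v, OF v_bm] ..
  note V = bspec[OF this, THEN spec]
  obtain U where "\<forall>k\<in>?N. \<forall>t. \<bar>u t k\<bar> \<le> U k" using bnd[of u, OF u_bm] ..
  note U = bspec[OF this, THEN spec]
  obtain Q where "\<forall>k\<in>?N. \<forall>t. \<bar>p t k\<bar> \<le> Q k" using bnd[of p, OF p_bm] ..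
  note Q = bspec[OF this, THEN spec]
  define G where "G = (\<lambda>k. V k + C * W k)"
  \<comment> \<open>Collects the second order terms per coordinate: d^2 / 2 from the energy, and p
    times the sum of u times the Taylor remainder of the weight and d times its increment.\<close>
  define Ke where "Ke = (\<Sum>k\<in>?N. (G k)\<^sup>2 / 2 + Q k * (U k * (\<bar>K k\<bar> * C\<^sup>2) + G k * (\<bar>K k\<bar> * C)))"
  define S where "S = (\<Sum>k\<in>?N. I (\<lambda>t. (r t k)\<^sup>2))"
  define e1 where "e1 = min e0 (1 / (C + 1))"
  have e1: "0 < e1" using C by (simp add: e1_def)
  have main: "S \<le> Ke * (b - a) * e" if e: "0 < e" "e \<le> e1" for e
  proof -
    have e': "e \<le> e0" "e \<le> 1 / (C + 1)" using e by (auto simp: e1_def)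
    have Ce: "0 \<le> C * e" "C * e \<le> 1"
    proof -
      have "(C + 1) * e \<le> 1" using e'(2) C by (simp add: field_simps)
      then show "C * e \<le> 1" using e by (simp add: algebra_simps)
    qed (use C e in auto)
    obtain Y h where "admissible C e v (n + 1) Y h" using ex[OF e(1) e'(1)] by blast
    then have Y: "\<forall>j\<in>?N. bm (\<lambda>t. Y t j) \<and> Y a j = X a j \<and> Y b j = X b j \<and> \<bar>h j\<bar> \<le> C * e \<and>
     (\<forall>t\<in>{a..b}. \<bar>Y t j - X t j\<bar> \<le> C * e \<and>
        Y t j = X a j + (LINT s:{a..t}|lborel. ctrl e v h s j * xi \<alpha> j (Y s)))" unfolding admissible_def .
    have Yb: "\<And>k. k \<in> ?N \<Longrightarrow> bm (\<lambda>t. Y t k)" using Y by blast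
    have Wb: "\<And>k. k \<in> ?N \<Longrightarrow> bm (\<lambda>t. xi \<alpha> k (Y t))" by (rule xi_bm, rule Yb) auto
    have wb: "\<And>k. k \<in> ?N \<Longrightarrow> bm (\<lambda>t. xi \<alpha> k (X t))" by (rule xi_X_bm)
    define d where "d = (\<lambda>t k. e * v t k + h k * xi \<alpha> k (X t))"
    have d_bm: "\<And>k. k \<in> ?N \<Longrightarrow> bm (\<lambda>t. d t k)" unfolding d_def using v_bm wb by simp
    have ctrl_d: "ctrl e v h t k = u t k + d t k" for t k by (simp add: ctrl_def d_def)
    have ctrl_bm: "\<And>k. k \<in> ?N \<Longrightarrow> bm (\<lambda>t. ctrl e v h t k)" unfolding ctrl_d using u_bm d_bm by simp
    have d_bd: "\<bar>d t k\<bar> \<le> G k * e" if k: "k \<in> ?N" for t k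
    proof -
      have "\<bar>d t k\<bar> \<le> \<bar>e * v t k\<bar> + \<bar>h k * xi \<alpha> k (X t)\<bar>" unfolding d_def by (rule abs_triangle_ineq)
      also have "\<dots> = e * \<bar>v t k\<bar> + \<bar>h k\<bar> * \<bar>xi \<alpha> k (X t)\<bar>" using e by (simp add: abs_mult)
      also have "\<dots> \<le> e * V k + (C * e) * W k"
        using V[OF k, of t] W[OF k, of t] Y k e Ce by (intro add_mono mult_mono) auto
      finally show ?thesis by (simp add: G_def algebra_simps)
    qed
    define z where "z = (\<lambda>t k. Y t k - X t k)"
    have z_bm: "\<And>k. k \<in> ?N \<Longrightarrow> bm (\<lambda>t. z t k)" unfolding z_def using Yb X_bm by simp
    \<comment> \<open>Difference of the perturbed and the unperturbed velocity, that is, the density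
      of z; it is bounded, so z is a primitive fit for integration by parts.\<close>
    define g where "g = (\<lambda>k t. ctrl e v h t k * xi \<alpha> k (Y t) - u t k * xi \<alpha> k (X t))"
    have g_bm: "\<And>k. k \<in> ?N \<Longrightarrow> bm (g k)" unfolding g_def using ctrl_bm Wb u_bm wb by simp
    have z_eq: "z t k = (LINT s:{a..t}|lborel. g k s)" if "k \<in> ?N" "t \<in> {a..b}" for k t
    proof -
      have "(LINT s:{a..t}|lborel. g k s) = (LINT s:{a..t}|lborel. ctrl e v h s k * xi \<alpha> k (Y s)) - (LINT s:{a..t}|lborel. u s k * xi \<alpha> k (X s))"
        unfolding g_def using that ctrl_bm Wb u_bm wb by (intro LI_diff bm_mult) auto
      moreover have "Y t k = X a k + (LINT s:{a..t}|lborel. ctrl e v h s k * xi \<alpha> k (Y s))" using Y that by blast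
      ultimately show ?thesis using X_eq[OF that] by (simp add: z_def)
    qed
    have adj_bm: "bm (adj p k)" if "k \<in> ?N" for k
      unfolding adj_def[abs_def] using that by (intro bm_sum bm_mult dxi_X_bm u_bm p_bm) auto
    \<comment> \<open>z vanishes at both ends, so the constant c_k in p_k and the boundary terms
      drop out.\<close>
    have parts: "I (\<lambda>t. p t k * g k t) = I (\<lambda>t. adj p k t * z t k)" if k: "k \<in> ?N" for k
    proof -
      have zb: "(LINT s:{a..b}|lborel. g k s) = 0" 
      proof -
        have "Y b k = X b k" using Y k by blast
        then show ?thesis using z_eq[OF k, of b] ab unfolding z_def by simp
      qed
      have "I (\<lambda>t. adj p k t * z t k - p t k * g k t) =
        I (\<lambda>t. ((LINT s:{a..t}|lborel. adj p k s) * g k t + adj p k t * (LINT s:{a..t}|lborel. g k s)) - c k * g k t)"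
        by (rule LI_cong) (simp add: z_eq[OF k] p_eq[OF k] algebra_simps)
      also have "\<dots> = I (\<lambda>t. ((LINT s:{a..max a (min b t)}|lborel. adj p k s) * g k t + adj p k t * (LINT s:{a..max a (min b t)}|lborel. g k s)) - c k * g k t)"
        by (rule LI_cong) simp
      also have "\<dots> = I (\<lambda>t. (LINT s:{a..max a (min b t)}|lborel. adj p k s) * g k t + adj p k t * (LINT s:{a..max a (min b t)}|lborel. g k s)) - I (\<lambda>t. c k * g k t)"
        using adj_bm[OF k] g_bm[OF k] ab by (intro LI_diff bm_add bm_mult bm_primitive bm_const) auto
      also have "I (\<lambda>t. (LINT s:{a..max a (min b t)}|lborel. adj p k s) * g k t + adj p k t * (LINT s:{a..max a (min b t)}|lborel. g k s))
        = I (\<lambda>t. (LINT s:{a..t}|lborel. adj p k s) * g k t + adj p k t * (LINT s:{a..t}|lborel. g k s))"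
        by (rule LI_cong) simp
      also have "\<dots> = 0" using LI_by_parts[OF adj_bm[OF k] g_bm[OF k] less_imp_le[OF ab]] zb by simp
      also have "I (\<lambda>t. c k * g k t) = 0" using zb by simp
      finally have "I (\<lambda>t. adj p k t * z t k - p t k * g k t) = 0" by simp
      moreover have "I (\<lambda>t. adj p k t * z t k - p t k * g k t) = I (\<lambda>t. adj p k t * z t k) - I (\<lambda>t. p t k * g k t)"
        using adj_bm[OF k] z_bm[OF k] p_bm[OF k] g_bm[OF k] by (intro LI_diff bm_mult) auto
      ultimately show ?thesis by simp
    qed
    define L where "L = (\<lambda>t k. \<Sum>j\<in>{1..<k}. dxi \<alpha> j k (X t) * z t j)"
    have L_bm: "bm (\<lambda>t. L t k)" if "k \<in> ?N" for k
      unfolding L_def using that by (intro bm_sum bm_mult dxi_X_bm z_bm) auto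
    \<comment> \<open>Duality: \<open>adj\<close> is the transpose of the linearization L of the
      weights, so exchanging the two sums over j < k moves it from p to z.\<close>
    have swap: "(\<Sum>k\<in>?N. adj p k t * z t k) = (\<Sum>k\<in>?N. u t k * p t k * L t k)" for t
    proof -
      have "(\<Sum>j\<in>?N. adj p j t * z t j) = (\<Sum>j\<in>?N. \<Sum>k\<in>?N. if j < k then dxi \<alpha> j k (X t) * u t k * p t k * z t j else 0)"
        unfolding adj_def sum_distrib_right
        by (intro sum.cong refl sum.mono_neutral_cong_left) auto
      also have "\<dots> = (\<Sum>k\<in>?N. \<Sum>j\<in>?N. if j < k then dxi \<alpha> j k (X t) * u t k * p t k * z t j else 0)"
        by (rule sum.swap)
      also have "\<dots> = (\<Sum>k\<in>?N. u t k * p t k * L t k)"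
        unfolding L_def sum_distrib_left
        by (intro sum.cong refl sum.mono_neutral_cong_right) (auto simp: algebra_simps)
      finally show ?thesis .
    qed
    \<comment> \<open>The first order contribution of the constraint; by \<open>parts\<close> and
      \<open>swap\<close> it integrates to zero.\<close>
    define E where "E = (\<lambda>t. \<Sum>k\<in>?N. p t k * g k t - u t k * p t k * L t k)"
    have "I E = (\<Sum>k\<in>?N. I (\<lambda>t. p t k * g k t - u t k * p t k * L t k))"
      unfolding E_def using p_bm g_bm u_bm L_bm by (intro LI_sum bm_diff bm_mult) auto
    also have "\<dots> = (\<Sum>k\<in>?N. I (\<lambda>t. p t k * g k t) - I (\<lambda>t. u t k * p t k * L t k))"
      using p_bm g_bm u_bm L_bm by (intro sum.cong refl LI_diff bm_mult) auto
    also have "\<dots> = (\<Sum>k\<in>?N. I (\<lambda>t. p t k * g k t)) - (\<Sum>k\<in>?N. I (\<lambda>t. u t k * p t k * L t k))"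
      by (rule sum_subtractf)
    also have "(\<Sum>k\<in>?N. I (\<lambda>t. u t k * p t k * L t k)) = I (\<lambda>t. \<Sum>k\<in>?N. u t k * p t k * L t k)"
      using p_bm u_bm L_bm by (intro LI_sum[symmetric] bm_mult) auto
    also have "\<dots> = I (\<lambda>t. \<Sum>k\<in>?N. adj p k t * z t k)" unfolding swap ..
    also have "\<dots> = (\<Sum>k\<in>?N. I (\<lambda>t. adj p k t * z t k))"
      using adj_bm z_bm by (intro LI_sum bm_mult) auto
    also have "(\<Sum>k\<in>?N. I (\<lambda>t. p t k * g k t)) = (\<Sum>k\<in>?N. I (\<lambda>t. adj p k t * z t k))"
      by (intro sum.cong refl parts)
    finally have IE: "I E = 0" by simp
    have E_bm: "bm E" unfolding E_def using p_bm g_bm u_bm L_bm by (intro bm_sum bm_diff bm_mult) auto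
    define T where "T = (\<lambda>t. \<Sum>k\<in>?N. r t k * d t k)"
    have T_bm: "bm T" unfolding T_def using r_bm d_bm by (intro bm_sum bm_mult) auto
    \<comment> \<open>The corrector part of d is a multiple of xi_k, to which the defect r is
      orthogonal; only the part - e r of d survives.\<close>
    have IT: "I T = - (e * S)"
    proof -
      have "I (\<lambda>t. r t k * d t k) = - (e * I (\<lambda>t. (r t k)\<^sup>2))" if k: "k \<in> ?N" for k
      proof -
        have "I (\<lambda>t. r t k * d t k) = I (\<lambda>t. h k * (r t k * xi \<alpha> k (X t)) - e * (r t k)\<^sup>2)"
          by (rule LI_cong) (simp add: d_def v_def power2_eq_square algebra_simps)
        also have "\<dots> = I (\<lambda>t. h k * (r t k * xi \<alpha> k (X t))) - I (\<lambda>t. e * (r t k)\<^sup>2)"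
          using r_bm[OF k] wb[OF k] by (intro LI_diff bm_mult bm_power bm_const) auto
        also have "I (\<lambda>t. h k * (r t k * xi \<alpha> k (X t))) = 0"
          using p_orth[OF k] by (simp add: r_def)
        finally show ?thesis by simp
      qed
      then have "(\<Sum>k\<in>?N. I (\<lambda>t. r t k * d t k)) = - (e * S)"
        unfolding S_def sum_distrib_left sum_negf[symmetric] by (intro sum.cong refl)
      moreover have "I T = (\<Sum>k\<in>?N. I (\<lambda>t. r t k * d t k))"
        unfolding T_def using r_bm d_bm by (intro LI_sum bm_mult) auto
      ultimately show ?thesis by simp
    qed
    have pw: "sqrt (\<Sum>k\<in>?N. (ctrl e v h t k)\<^sup>2) \<le> 1 + T t + E t + Ke * e\<^sup>2" if t: "t \<in> {a..b}" for t
    proof -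
      have "(\<Sum>k\<in>?N. (ctrl e v h t k)\<^sup>2) = (\<Sum>k\<in>?N. (u t k)\<^sup>2) + (\<Sum>k\<in>?N. 2 * u t k * d t k + (d t k)\<^sup>2)"
        unfolding sum.distrib[symmetric] by (intro sum.cong refl) (simp add: ctrl_d power2_eq_square algebra_simps)
      then have q: "(\<Sum>k\<in>?N. (ctrl e v h t k)\<^sup>2) \<le> 1 + (\<Sum>k\<in>?N. 2 * u t k * d t k + (d t k)\<^sup>2)"
        using u_unit[of t] by linarith
      have "0 \<le> (\<Sum>k\<in>?N. (ctrl e v h t k)\<^sup>2)" by (intro sum_nonneg) simp
      \<comment> \<open>The tangent to the square root at 1: exact to first order at unit speed, and
        in the direction needed to bound the length from above.\<close>
      then have "sqrt (\<Sum>k\<in>?N. (ctrl e v h t k)\<^sup>2) \<le> (1 + (\<Sum>k\<in>?N. (ctrl e v h t k)\<^sup>2)) / 2"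
        using arith_geo_mean_sqrt[of 1 "\<Sum>k\<in>?N. (ctrl e v h t k)\<^sup>2"] by (simp only: mult_1 zero_le_one)
      also have "\<dots> \<le> 1 + (\<Sum>k\<in>?N. 2 * u t k * d t k + (d t k)\<^sup>2) / 2"
      proof -
        have "(1 + x) / 2 \<le> 1 + y / 2" if "x \<le> 1 + y" for x y :: real using that by simp
        from this[OF q] show ?thesis .
      qed
      also have "(\<Sum>k\<in>?N. 2 * u t k * d t k + (d t k)\<^sup>2) / 2 = (\<Sum>k\<in>?N. u t k * d t k + (d t k)\<^sup>2 / 2)"
        unfolding sum_divide_distrib by (intro sum.cong refl) (simp add: field_simps)
      also have "\<dots> \<le> (\<Sum>k\<in>?N. r t k * d t k + (p t k * g k t - u t k * p t k * L t k)
           + ((G k)\<^sup>2 / 2 + Q k * (U k * (\<bar>K k\<bar> * C\<^sup>2) + G k * (\<bar>K k\<bar> * C))) * e\<^sup>2)"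
      proof (rule sum_mono)
        fix k assume k: "k \<in> ?N"
        let ?w = "xi \<alpha> k (X t)" and ?W = "xi \<alpha> k (Y t)"
        have "approx1 (K k) (C * e) ?w ?W (L t k)"
          unfolding L_def z_def
        proof (rule K[OF k _ Ce], intro ballI conjI)
          fix i assume i: "i \<in> {1..<k}"
          then have "i \<in> ?N" using k by auto
          then show "\<bar>X t i\<bar> \<le> M" "\<bar>Y t i - X t i\<bar> \<le> C * e" using M(2) Y t by blast+
        qed
        then have a1: "\<bar>?W - ?w\<bar> \<le> K k * (C * e)" and a2: "\<bar>?W - ?w - L t k\<bar> \<le> K k * (C * e)\<^sup>2"
          by (auto simp: approx1_def)
        have "K k * (C * e) \<le> \<bar>K k\<bar> * (C * e)" "K k * (C * e)\<^sup>2 \<le> \<bar>K k\<bar> * (C * e)\<^sup>2"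
          using Ce by (auto intro!: mult_right_mono)
        then have a1': "\<bar>?W - ?w\<bar> \<le> \<bar>K k\<bar> * (C * e)" and a2': "\<bar>?W - ?w - L t k\<bar> \<le> \<bar>K k\<bar> * (C * e)\<^sup>2"
          using a1 a2 by linarith+
        \<comment> \<open>Substituting u = r + p w into u d, and g = u (W - w) + d W for p w d,
          leaves p times this remainder, which is of order e^2.\<close>
        define R where "R = u t k * (?W - ?w - L t k) + d t k * (?W - ?w)"
        have id: "u t k * d t k = r t k * d t k + (p t k * g k t - u t k * p t k * L t k) - p t k * R"
          unfolding R_def g_def r_def ctrl_d by algebra
        have "\<bar>R\<bar> \<le> \<bar>u t k\<bar> * \<bar>?W - ?w - L t k\<bar> + \<bar>d t k\<bar> * \<bar>?W - ?w\<bar>"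
          unfolding R_def by (metis abs_mult abs_triangle_ineq)
        also have "\<dots> \<le> U k * (\<bar>K k\<bar> * (C * e)\<^sup>2) + (G k * e) * (\<bar>K k\<bar> * (C * e))"
          using U[OF k, of t] d_bd[OF k, of t] a1' a2' abs_ge_zero[of "u t k"] abs_ge_zero[of "d t k"]
          by (intro add_mono mult_mono) linarith+
        finally have "\<bar>R\<bar> \<le> (U k * (\<bar>K k\<bar> * C\<^sup>2) + G k * (\<bar>K k\<bar> * C)) * e\<^sup>2"
          by (simp add: power2_eq_square algebra_simps)
        then have pR: "\<bar>p t k * R\<bar> \<le> Q k * ((U k * (\<bar>K k\<bar> * C\<^sup>2) + G k * (\<bar>K k\<bar> * C)) * e\<^sup>2)"
          unfolding abs_mult using Q[OF k, of t] abs_ge_zero[of "p t k"] by (intro mult_mono) linarith+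
        have dG: "(d t k)\<^sup>2 \<le> (G k)\<^sup>2 * e\<^sup>2"
          using power_mono[OF d_bd[OF k, of t] abs_ge_zero, of 2] by (simp add: power_mult_distrib)
        have "((G k)\<^sup>2 / 2 + Q k * (U k * (\<bar>K k\<bar> * C\<^sup>2) + G k * (\<bar>K k\<bar> * C))) * e\<^sup>2 =
            ((G k)\<^sup>2 * e\<^sup>2) / 2 + Q k * ((U k * (\<bar>K k\<bar> * C\<^sup>2) + G k * (\<bar>K k\<bar> * C)) * e\<^sup>2)"
          by (simp add: distrib_right)
        then show "u t k * d t k + (d t k)\<^sup>2 / 2 \<le> r t k * d t k + (p t k * g k t - u t k * p t k * L t k)
           + ((G k)\<^sup>2 / 2 + Q k * (U k * (\<bar>K k\<bar> * C\<^sup>2) + G k * (\<bar>K k\<bar> * C))) * e\<^sup>2"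
          unfolding id using pR dG abs_ge_minus_self[of "p t k * R"] by linarith
      qed
      also have "\<dots> = T t + E t + Ke * e\<^sup>2"
        unfolding T_def E_def Ke_def sum_distrib_right sum.distrib[symmetric] ..
      finally show ?thesis by (simp only: add.assoc)
    qed
    have hc: "horiz_control \<alpha> n a b Y (ctrl e v h)"
      unfolding horiz_control_def
    proof (intro conjI ballI)
      fix k t assume k: "k \<in> ?N" and t: "t \<in> {a..b}"
      have "Y a k = X a k" "Y t k = X a k + (LINT s:{a..t}|lborel. ctrl e v h s k * xi \<alpha> k (Y s))" using Y k t by blast+
      then show "Y t k = Y a k + (LINT s:{a..t}|lborel. ctrl e v h s k * xi \<alpha> k (Y s))" by simp
    qed (use ab in simp, intro bm_integrable ctrl_bm, assumption, intro bm_integrable bm_mult ctrl_bm Wb, assumption+)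
    have "b - a \<le> ctrl_length n a b (ctrl e v h)"
      by (rule minimal[OF hc]) (use Y in blast)
    also have "\<dots> \<le> I (\<lambda>t. 1 + T t + E t + Ke * e\<^sup>2)"
      unfolding ctrl_length_def
    proof (rule LI_mono[OF _ _ pw])
      have sb: "bm (\<lambda>t. \<Sum>k\<in>?N. (ctrl e v h t k)\<^sup>2)" using ctrl_bm by (intro bm_sum bm_power) auto
      obtain Z where Z: "\<And>t. \<bar>\<Sum>k\<in>?N. (ctrl e v h t k)\<^sup>2\<bar> \<le> Z" using bm_bound[OF sb] by blast
      have "bm (\<lambda>t. sqrt (\<Sum>k\<in>?N. (ctrl e v h t k)\<^sup>2))"
      proof (rule bmI)
        show "(\<lambda>t. sqrt (\<Sum>k\<in>?N. (ctrl e v h t k)\<^sup>2)) \<in> borel_measurable borel"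
          by (rule measurable_compose[OF bm_measurable[OF sb] borel_measurable_sqrt])
        show "\<bar>sqrt (\<Sum>k\<in>?N. (ctrl e v h t k)\<^sup>2)\<bar> \<le> sqrt Z" for t
        proof -
          have "0 \<le> (\<Sum>k\<in>?N. (ctrl e v h t k)\<^sup>2)" by (intro sum_nonneg) simp
          then show ?thesis using Z[of t] by (simp only: abs_of_nonneg real_sqrt_ge_zero real_sqrt_le_iff)
        qed
      qed
      then show "set_integrable lborel {a..b} (\<lambda>t. sqrt (\<Sum>k\<in>?N. (ctrl e v h t k)\<^sup>2))" by (rule bm_integrable)
      show "set_integrable lborel {a..b} (\<lambda>t. 1 + T t + E t + Ke * e\<^sup>2)"
        by (intro bm_integrable bm_add bm_const T_bm E_bm)
    qed
    also have "I (\<lambda>t. 1 + T t + E t + Ke * e\<^sup>2) = I (\<lambda>t. 1) + I T + I E + I (\<lambda>t. Ke * e\<^sup>2)"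
      by (simp only: LI_add bm_add bm_const T_bm E_bm)
    also have "\<dots> = (b - a) - e * S + Ke * e\<^sup>2 * (b - a)"
      unfolding IT IE LI_const[OF less_imp_le[OF ab]] by simp
    finally have "e * S \<le> e * (Ke * (b - a) * e)" by (simp add: power2_eq_square algebra_simps)
    then show ?thesis using e(1) by simp
  qed
  have S0: "0 \<le> I (\<lambda>t. (r t k)\<^sup>2)" for k
    unfolding set_lebesgue_integral_def by (rule integral_nonneg_AE) auto
  have "S \<le> 0"
  proof (rule ccontr)
    assume "\<not> S \<le> 0"
    then have S: "0 < S" by simp
    define B where "B = \<bar>Ke * (b - a)\<bar> + 1"
    \<comment> \<open>Small enough that B e <= S / 2, so \<open>main\<close> would give S <= S /
      2.\<close>
    define e where "e = min e1 (S / (2 * B))"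
    have B: "0 < B" by (simp add: B_def)
    have e: "0 < e" "e \<le> e1" "e \<le> S / (2 * B)" using e1 S B unfolding e_def by simp_all
    have "S \<le> Ke * (b - a) * e" by (rule main[OF e(1,2)])
    also have "\<dots> \<le> B * e" using e(1) by (intro mult_right_mono) (auto simp: B_def)
    also have "\<dots> \<le> B * (S / (2 * B))" using e(3) B by (intro mult_left_mono) auto
    also have "\<dots> = S / 2" using B by simp
    finally show False using S by simp
  qed
  moreover have "I (\<lambda>t. (r t j)\<^sup>2) \<le> S"
    unfolding S_def by (rule member_le_sum[OF j S0]) simp
  ultimately have "I (\<lambda>t. (r t j)\<^sup>2) = 0" using S0[of j] by linarith
  then show ?thesis unfolding r_def .
qed

text \<open>Regularity is gained here: replacing u by p xi almost everywhere makes the integrands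
  continuous, so the integral equations can be differentiated at every time. The identity for u is
  kept for the later normalization of H.\<close>

lemma ham_on_exists: "\<exists>p. ham_on \<alpha> n a b X p \<and> (\<forall>j\<in>{1..n+1}. AE t in lborel. t \<in> {a..b} \<longrightarrow> u t j = p t j * xi \<alpha> j (X t))"
proof -
  let ?N = "{1..n+1}"
  obtain p c where pc: "\<forall>j\<in>{1..n+1}. bm (\<lambda>t. p t j) \<and>
     (\<forall>t\<in>{a..b}. p t j = c j - (LINT s:{a..t}|lborel. adj p j s)) \<and>
     I (\<lambda>t. (u t j - p t j * xi \<alpha> j (X t)) * xi \<alpha> j (X t)) = 0"
    using adjoint_exists by blast
  have p_bm: "\<And>j. j \<in> ?N \<Longrightarrow> bm (\<lambda>t. p t j)" using pc by blast
  have p_eq: "\<And>j t. j \<in> ?N \<Longrightarrow> t \<in> {a..b} \<Longrightarrow> p t j = c j - (LINT s:{a..t}|lborel. adj p j s)" using pc by blast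
  have ae: "AE t in lborel. t \<in> {a..b} \<longrightarrow> u t j - p t j * xi \<alpha> j (X t) = 0" if j: "j \<in> ?N" for j
  proof (rule LI_sq_zero)
    show "bm (\<lambda>t. u t j - p t j * xi \<alpha> j (X t))" using u_bm[OF j] p_bm[OF j] xi_X_bm[OF j] by simp
    show "I (\<lambda>t. (u t j - p t j * xi \<alpha> j (X t))\<^sup>2) = 0"
    proof (rule defect_zero[OF p_bm p_eq _ j])
      fix k assume "k \<in> ?N"
      then show "I (\<lambda>t. (u t k - p t k * xi \<alpha> k (X t)) * xi \<alpha> k (X t)) = 0" using pc by blast
    qed
  qed
  have X_cont: "continuous_on {a..b} (\<lambda>t. X t j)" if j: "j \<in> ?N" for j
  proof -
    have "continuous_on {a..b} (\<lambda>t. X a j + (LINT s:{a..t}|lborel. u s j * xi \<alpha> j (X s)))"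
      using u_bm[OF j] xi_X_bm[OF j]
      by (intro continuous_intros continuous_on_subset[OF LI_continuous]) auto
    then show ?thesis by (rule continuous_on_eq) (rule X_eq[OF j, symmetric])
  qed
  have adj_bm: "bm (adj p k)" if "k \<in> ?N" for k
    unfolding adj_def[abs_def] using that by (intro bm_sum bm_mult dxi_X_bm u_bm p_bm) auto
  have p_cont: "continuous_on {a..b} (\<lambda>t. p t j)" if j: "j \<in> ?N" for j
  proof -
    have "continuous_on {a..b} (\<lambda>t. c j - (LINT s:{a..t}|lborel. adj p j s))"
      using adj_bm[OF j] by (intro continuous_intros continuous_on_subset[OF LI_continuous]) auto
    then show ?thesis by (rule continuous_on_eq) (rule p_eq[OF j, symmetric])
  qed
  have xi_cont: "continuous_on {a..b} (\<lambda>t. xi \<alpha> k (X t))" if "k \<in> ?N" for k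
    unfolding xi_def using that by (intro continuous_intros X_cont) auto
  have dxi_cont: "continuous_on {a..b} (\<lambda>t. dxi \<alpha> j k (X t))" if "1 \<le> j" "j < k" "k \<in> ?N" for j k
    unfolding dxi_def using that by (intro continuous_intros X_cont) auto
  have LI_ae: "(LINT s:{a..t}|lborel. f s) = (LINT s:{a..t}|lborel. g s)"
    if "bm f" "bm g" "AE s in lborel. s \<in> {a..b} \<longrightarrow> f s = g s" "t \<in> {a..b}" for f g :: "real \<Rightarrow> real" and t
    unfolding set_lebesgue_integral_def
  proof (rule integral_cong_AE)
    show "(\<lambda>s. indicat_real {a..t} s *\<^sub>R f s) \<in> borel_measurable lborel"
      "(\<lambda>s. indicat_real {a..t} s *\<^sub>R g s) \<in> borel_measurable lborel"
      using bm_measurable[OF that(1)] bm_measurable[OF that(2)] by auto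
    show "AE s in lborel. indicat_real {a..t} s *\<^sub>R f s = indicat_real {a..t} s *\<^sub>R g s"
      using that(3) by eventually_elim (use that(4) in \<open>auto simp: indicator_def\<close>)
  qed
  have "((\<lambda>s. X s j) has_real_derivative (xi \<alpha> j (X t))\<^sup>2 * p t j) (at t within {a..b})"
    if j: "j \<in> ?N" and t: "t \<in> {a..b}" for j t
  proof -
    let ?f = "\<lambda>s. (xi \<alpha> j (X s))\<^sup>2 * p s j"
    have f_bm: "bm ?f" using xi_X_bm[OF j] p_bm[OF j] by simp
    have eq: "X a j + (LINT r:{a..s}|lborel. ?f r) = X s j" if s: "s \<in> {a..b}" for s
    proof -
      have "(LINT r:{a..s}|lborel. u r j * xi \<alpha> j (X r)) = (LINT r:{a..s}|lborel. ?f r)"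
      proof (rule LI_ae[OF _ f_bm _ s])
        show "bm (\<lambda>r. u r j * xi \<alpha> j (X r))" using u_bm[OF j] xi_X_bm[OF j] by simp
        show "AE r in lborel. r \<in> {a..b} \<longrightarrow> u r j * xi \<alpha> j (X r) = ?f r"
          using ae[OF j] by eventually_elim (auto simp: power2_eq_square)
      qed
      then show ?thesis using X_eq[OF j s] by simp
    qed
    have "((\<lambda>s. X a j + (LINT r:{a..s}|lborel. ?f r)) has_real_derivative ?f t) (at t within {a..b})"
    proof -
      have "continuous_on {a..b} ?f" by (intro continuous_intros xi_cont[OF j] p_cont[OF j])
      from LI_has_derivative[OF f_bm this t] show ?thesis by (auto intro!: derivative_eq_intros)
    qed
    then show ?thesis
      by (rule has_field_derivative_cong_on[OF _ t eq refl refl])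
  qed
  moreover have "((\<lambda>s. p s j) has_real_derivative - dHam_dx \<alpha> n j (X t) (p t)) (at t within {a..b})"
    if j: "j \<in> ?N" and t: "t \<in> {a..b}" for j t
  proof -
    let ?f = "\<lambda>s. \<Sum>k\<in>{Suc j..n+1}. dxi \<alpha> j k (X s) * xi \<alpha> k (X s) * (p s k)\<^sup>2"
    have f_bm: "bm ?f" using j by (intro bm_sum bm_mult bm_power dxi_X_bm xi_X_bm p_bm) auto
    have f_cont: "continuous_on {a..b} ?f" using j by (intro continuous_intros dxi_cont xi_cont p_cont) auto
    have eq: "c j - (LINT r:{a..s}|lborel. ?f r) = p s j" if s: "s \<in> {a..b}" for s
    proof -
      have "(LINT r:{a..s}|lborel. adj p j r) = (LINT r:{a..s}|lborel. ?f r)"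
      proof (rule LI_ae[OF adj_bm[OF j] f_bm _ s])
        have "AE r in lborel. \<forall>k\<in>{Suc j..n+1}. r \<in> {a..b} \<longrightarrow> u r k - p r k * xi \<alpha> k (X r) = 0"
          by (intro AE_finite_allI ae) (use j in auto)
        then show "AE r in lborel. r \<in> {a..b} \<longrightarrow> adj p j r = ?f r"
          by eventually_elim (auto simp: adj_def power2_eq_square intro!: sum.cong)
      qed
      then show ?thesis using p_eq[OF j s] by simp
    qed
    have "((\<lambda>s. c j - (LINT r:{a..s}|lborel. ?f r)) has_real_derivative - ?f t) (at t within {a..b})"
      using LI_has_derivative[OF f_bm f_cont t] by (auto intro!: derivative_eq_intros)
    then show ?thesis
      by (rule has_field_derivative_cong_on[OF _ t eq _ refl]) (use j in \<open>simp_all only: dHam_dx_sum atLeastAtMost_iff\<close>)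
  qed
  ultimately have "ham_on \<alpha> n a b X p" unfolding ham_on_def by blast
  moreover have "\<forall>j\<in>?N. AE t in lborel. t \<in> {a..b} \<longrightarrow> u t j = p t j * xi \<alpha> j (X t)"
  proof
    fix j assume "j \<in> ?N"
    from ae[OF this] show "AE t in lborel. t \<in> {a..b} \<longrightarrow> u t j = p t j * xi \<alpha> j (X t)"
      by eventually_elim auto
  qed
  ultimately show ?thesis by blast
qed

end

subsection \<open>Arc-length controls\<close>

lemma enn2real_inj: "a \<noteq> \<infinity> \<Longrightarrow> b \<noteq> \<infinity> \<Longrightarrow> enn2real a = enn2real b \<Longrightarrow> a = b"
  by (cases a; cases b) auto

text \<open>The positive and negative parts of g are densities of two finite measures that agree on
  all half-lines, hence coincide; equal densities give f = - f almost everywhere, in the truncated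
  sense that forces 0.\<close>

lemma AE_zero_if_primitive_zero:
  fixes g :: "real \<Rightarrow> real"
  assumes g: "set_integrable lborel {a..b} g" and ab: "a \<le> b"
    and zero: "\<And>t. t \<in> {a..b} \<Longrightarrow> (LINT s:{a..t}|lborel. g s) = 0"
  shows "AE s in lborel. s \<in> {a..b} \<longrightarrow> g s = 0"
proof -
  define f where "f = (\<lambda>s. indicator {a..b} s * g s)"
  have f: "integrable lborel f" using g by (simp add: f_def set_integrable_def)
  then have f_m [measurable]: "f \<in> borel_measurable borel" by auto
  have f_meas: "f \<in> borel_measurable lborel" by simp
  have tail: "integrable lborel (\<lambda>s. f s * indicator {x<..} s)" "(\<integral>s. f s * indicator {x<..} s \<partial>lborel) = 0" for x
  proof -
    show i: "integrable lborel (\<lambda>s. f s * indicator {x<..} s)"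
      by (rule integrable_real_mult_indicator) (use f in auto)
    define y where "y = max a (min b x)"
    have y: "y \<in> {a..b}" using ab by (auto simp: y_def)
    have gi: "integrable lborel (\<lambda>s. indicator {a..c} s * g s)" if "c \<in> {a..b}" for c
      using set_integrable_subset[OF g, of "{a..c}"] that by (auto simp: set_integrable_def)
    have z: "(\<integral>s. indicator {a..c} s * g s \<partial>lborel) = 0" if "c \<in> {a..b}" for c
      using zero[OF that] by (simp add: set_lebesgue_integral_def)
    have "(\<integral>s. f s * indicator {x<..} s \<partial>lborel) = (\<integral>s. indicator {a..b} s * g s - indicator {a..y} s * g s \<partial>lborel)"
    proof (rule integral_cong_AE)
      show "(\<lambda>s. f s * indicat_real {x<..} s) \<in> borel_measurable lborel" by measurable
      show "(\<lambda>s. indicat_real {a..b} s * g s - indicat_real {a..y} s * g s) \<in> borel_measurable lborel"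
        using gi[of b] gi[OF y] ab by (intro borel_measurable_diff borel_measurable_integrable) auto
      \<comment> \<open>If x < a then y = a, and {a..y} wrongly removes the single point a; it is
        discarded as a null set.\<close>
      have "AE s in lborel. s \<noteq> a" by (rule AE_lborel_singleton)
      then show "AE s in lborel. f s * indicat_real {x<..} s = indicat_real {a..b} s * g s - indicat_real {a..y} s * g s"
      proof eventually_elim
        case (elim s)
        have "s \<in> {a..y} \<longleftrightarrow> s \<in> {a..b} \<and> \<not> x < s" using elim unfolding y_def by auto
        then show ?case unfolding f_def by (auto simp: indicator_def)
      qed
    qed
    also have "\<dots> = 0" using z[of b] z[OF y] gi[of b] gi[OF y] ab by simp
    finally show "(\<integral>s. f s * indicator {x<..} s \<partial>lborel) = 0" .
  qed
  \<comment> \<open>\<open>ennreal\<close> truncates negative numbers to 0, so P and N carry the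
    positive and the negative part of f.\<close>
  define P where "P = density lborel (\<lambda>s. ennreal (f s))"
  define N where "N = density lborel (\<lambda>s. ennreal (- f s))"
  have emP: "emeasure P {x<..} = (\<integral>\<^sup>+s. ennreal (f s * indicator {x<..} s) \<partial>lborel)" for x
    unfolding P_def by (subst emeasure_density) (auto intro!: nn_integral_cong simp: indicator_def)
  have emN: "emeasure N {x<..} = (\<integral>\<^sup>+s. ennreal (- (f s * indicator {x<..} s)) \<partial>lborel)" for x
    unfolding N_def by (subst emeasure_density) (auto intro!: nn_integral_cong simp: indicator_def)
  have fin: "(\<integral>\<^sup>+s. ennreal (f s * indicator {x<..} s) \<partial>lborel) \<noteq> \<infinity>"
    "(\<integral>\<^sup>+s. ennreal (- (f s * indicator {x<..} s)) \<partial>lborel) \<noteq> \<infinity>" for x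
    using tail(1)[of x] unfolding real_integrable_def by auto
  have "P = N"
  proof (rule measure_eqI_lessThan)
    fix x
    show "emeasure P {x<..} < \<infinity>" unfolding emP using fin(1)[of x] by (simp add: less_top)
    have "enn2real (\<integral>\<^sup>+s. ennreal (f s * indicator {x<..} s) \<partial>lborel) = enn2real (\<integral>\<^sup>+s. ennreal (- (f s * indicator {x<..} s)) \<partial>lborel)"
      using real_lebesgue_integral_def[OF tail(1)[of x]] tail(2)[of x] by simp
    then show "emeasure P {x<..} = emeasure N {x<..}"
      unfolding emP emN using enn2real_inj[OF fin(1)[of x] fin(2)[of x]] by blast
  qed (simp_all add: P_def N_def)
  then have "AE s in lborel. ennreal (f s) = ennreal (- f s)"
    unfolding P_def N_def by (subst (asm) sigma_finite_measure.density_unique_iff[OF sigma_finite_lborel]) auto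
  then show ?thesis
  proof eventually_elim
    case (elim s)
    have "f s = 0"
    proof (cases "f s \<ge> 0")
      case True
      then have "ennreal (f s) = 0" using elim by (simp add: ennreal_neg)
      then show ?thesis using True by simp
    next
      case False
      then have "ennreal (- f s) = 0" using elim by (simp add: ennreal_neg)
      then show ?thesis using False by simp
    qed
    then show ?case by (auto simp: f_def)
  qed
qed

lemma set_LI_split:
  fixes f :: "real \<Rightarrow> real"
  assumes f: "set_integrable lborel {a..b} f" and "a \<le> c" "c \<le> b"
  shows "(LINT s:{a..b}|lborel. f s) = (LINT s:{a..c}|lborel. f s) + (LINT s:{c..b}|lborel. f s)"
proof -
  have "set_integrable lborel {a..c} f" "set_integrable lborel {c..b} f"
    using set_integrable_subset[OF f] assms by auto
  then show ?thesis
    using assms set_borel_integral_eq_integral[OF f]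
      set_borel_integral_eq_integral(2)[of "{a..c}" f] set_borel_integral_eq_integral(2)[of "{c..b}" f]
    by (simp add: Henstock_Kurzweil_Integration.integral_combine)
qed

lemma horiz_control_subinterval:
  assumes h: "horiz_control \<alpha> n a b \<gamma> h" and st: "a \<le> s" "s \<le> t" "t \<le> b"
  shows "horiz_control \<alpha> n s t \<gamma> h"
  unfolding horiz_control_def
proof (intro conjI ballI)
  fix j r assume j: "j \<in> {1..n+1}" and r: "r \<in> {s..t}"
  have i: "set_integrable lborel {a..b} (\<lambda>s. h s j * xi \<alpha> j (\<gamma> s))"
    and e: "\<And>t. t \<in> {a..b} \<Longrightarrow> \<gamma> t j = \<gamma> a j + (LINT s:{a..t}|lborel. h s j * xi \<alpha> j (\<gamma> s))"
    using h j unfolding horiz_control_def by blast+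
  have "set_integrable lborel {a..r} (\<lambda>s. h s j * xi \<alpha> j (\<gamma> s))"
    by (rule set_integrable_subset[OF i]) (use r st in auto)
  from set_LI_split[OF this, of s] show "\<gamma> r j = \<gamma> s j + (LINT s:{s..r}|lborel. h s j * xi \<alpha> j (\<gamma> s))"
    using e[of s] e[of r] r st by auto
next
  fix j assume j: "j \<in> {1..n+1}"
  have "set_integrable lborel {a..b} (\<lambda>s. h s j)" "set_integrable lborel {a..b} (\<lambda>s. h s j * xi \<alpha> j (\<gamma> s))"
    using h j unfolding horiz_control_def by blast+
  then show "set_integrable lborel {s..t} (\<lambda>s. h s j)" "set_integrable lborel {s..t} (\<lambda>s. h s j * xi \<alpha> j (\<gamma> s))"
    using st by (auto intro: set_integrable_subset)
qed (fact st)

lemma control_norm_integrable: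
  assumes "\<And>j. j \<in> J \<Longrightarrow> set_integrable lborel {a..b::real} (\<lambda>s. h s j)"
  shows "set_integrable lborel {a..b} (\<lambda>s. sqrt (\<Sum>j\<in>J. (h s j)\<^sup>2))"
proof (cases "finite J")
  case True
  have 1: "set_integrable lborel {a..b} (\<lambda>s. \<Sum>j\<in>J. \<bar>h s j\<bar>)"
    using True assms set_integrable_abs[OF assms] unfolding set_integrable_def scaleR_sum_right
    by (intro Bochner_Integration.integrable_sum) auto
  show ?thesis
  proof (rule set_integrable_bound[OF 1])
    have m: "(\<lambda>s. indicat_real {a..b} s * h s j) \<in> borel_measurable lborel" if "j \<in> J" for j
      using assms[OF that] unfolding set_integrable_def by (auto dest: borel_measurable_integrable)
    have "(\<lambda>s. indicat_real {a..b} s *\<^sub>R sqrt (\<Sum>j\<in>J. (h s j)\<^sup>2)) = (\<lambda>s. sqrt (\<Sum>j\<in>J. (indicat_real {a..b} s * h s j)\<^sup>2))"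
      by (auto simp: indicator_def)
    moreover have "(\<lambda>s. sqrt (\<Sum>j\<in>J. (indicat_real {a..b} s * h s j)\<^sup>2)) \<in> borel_measurable lborel"
      by (intro measurable_compose[OF _ borel_measurable_sqrt] borel_measurable_sum borel_measurable_power m)
    ultimately show "set_borel_measurable lborel {a..b} (\<lambda>s. sqrt (\<Sum>j\<in>J. (h s j)\<^sup>2))"
      unfolding set_borel_measurable_def by simp
    show "AE x in lborel. x \<in> {a..b} \<longrightarrow> norm (sqrt (\<Sum>j\<in>J. (h x j)\<^sup>2)) \<le> norm (\<Sum>j\<in>J. \<bar>h x j\<bar>)"
    proof (intro AE_I2 impI)
      fix x
      have "sqrt (\<Sum>j\<in>J. (h x j)\<^sup>2) \<le> (\<Sum>j\<in>J. \<bar>h x j\<bar>)"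
        using L2_set_le_sum_abs[of "h x" J] by (simp add: L2_set_def)
      then show "norm (sqrt (\<Sum>j\<in>J. (h x j)\<^sup>2)) \<le> norm (\<Sum>j\<in>J. \<bar>h x j\<bar>)" by (simp add: sum_nonneg)
    qed
  qed
qed (simp add: set_integrable_def)

lemma ctrl_length_nonneg: "0 \<le> ctrl_length n a b h"
  unfolding ctrl_length_def set_lebesgue_integral_def
  by (rule integral_nonneg_AE) (auto simp: sum_nonneg)

lemma curve_length_le: "horiz_control \<alpha> n a b \<gamma> h \<Longrightarrow> curve_length \<alpha> n a b \<gamma> \<le> ctrl_length n a b h"
  unfolding curve_length_def
  by (rule cInf_lower) (auto intro!: bdd_belowI[of _ 0] ctrl_length_nonneg)

lemma curve_length_nonneg: "horizontal \<alpha> n a b \<gamma> \<Longrightarrow> 0 \<le> curve_length \<alpha> n a b \<gamma>"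
  unfolding curve_length_def horizontal_def
  by (rule cInf_greatest) (auto intro: ctrl_length_nonneg)

lemma cc_dist_le:
  assumes h: "horiz_control \<alpha> n a b \<gamma> h" and "\<And>j. j \<in> {1..n+1} \<Longrightarrow> \<gamma> a j = x j \<and> \<gamma> b j = y j"
  shows "cc_dist \<alpha> n x y \<le> ctrl_length n a b h"
proof -
  have "cc_dist \<alpha> n x y \<le> curve_length \<alpha> n a b \<gamma>"
    unfolding cc_dist_def
  proof (rule cInf_lower)
    have "horizontal \<alpha> n a b \<gamma>" using h unfolding horizontal_def by blast
    then show "curve_length \<alpha> n a b \<gamma> \<in> {curve_length \<alpha> n a b \<gamma> |a b \<gamma>. horizontal \<alpha> n a b \<gamma> \<and> (\<forall>j\<in>{1..n + 1}. \<gamma> a j = x j \<and> \<gamma> b j = y j)}"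
      using assms(2) by blast
  qed (auto intro!: bdd_belowI[of _ 0] curve_length_nonneg)
  then show ?thesis using curve_length_le[OF h] by linarith
qed

text \<open>Both products have the same primitive. Nothing more can hold: where xi_j vanishes the
  controls themselves are not determined by the curve.\<close>

lemma control_unique:
  assumes "horiz_control \<alpha> n s t \<gamma> h" "horiz_control \<alpha> n s t \<gamma> w" and j: "j \<in> {1..n+1}"
  shows "AE r in lborel. r \<in> {s..t} \<longrightarrow> h r j * xi \<alpha> j (\<gamma> r) = w r j * xi \<alpha> j (\<gamma> r)"
proof -
  let ?h = "\<lambda>r. h r j * xi \<alpha> j (\<gamma> r)" and ?w = "\<lambda>r. w r j * xi \<alpha> j (\<gamma> r)"
  have i: "set_integrable lborel {s..t} ?h" "set_integrable lborel {s..t} ?w" and st: "s \<le> t"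
    and e: "\<And>r. r \<in> {s..t} \<Longrightarrow> \<gamma> r j = \<gamma> s j + (LINT r:{s..r}|lborel. ?h r)"
    "\<And>r. r \<in> {s..t} \<Longrightarrow> \<gamma> r j = \<gamma> s j + (LINT r:{s..r}|lborel. ?w r)"
    using assms unfolding horiz_control_def by blast+
  have "AE r in lborel. r \<in> {s..t} \<longrightarrow> ?h r - ?w r = 0"
  proof (rule AE_zero_if_primitive_zero[OF set_integral_diff(1)[OF i] st])
    fix r assume r: "r \<in> {s..t}"
    have "set_integrable lborel {s..r} ?h" "set_integrable lborel {s..r} ?w"
      using r set_integrable_subset[OF i(1), of "{s..r}"] set_integrable_subset[OF i(2), of "{s..r}"] by auto
    then have "(LINT q:{s..r}|lborel. ?h q - ?w q) = (LINT q:{s..r}|lborel. ?h q) - (LINT q:{s..r}|lborel. ?w q)"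
      by (rule set_integral_diff(2))
    then show "(LINT q:{s..r}|lborel. ?h q - ?w q) = 0" using e(1)[OF r] e(2)[OF r] by linarith
  qed
  then show ?thesis by eventually_elim auto
qed

lemma AE_on_Icc_ex:
  assumes "AE s in lborel. s \<in> {a..b::real} \<longrightarrow> P s" "a < b"
  shows "\<exists>s\<in>{a..b}. P s"
proof (rule ccontr)
  assume "\<not> ?thesis"
  then have "AE s in lborel. s \<notin> {a..b}" using assms(1) by (auto elim: eventually_mono)
  then have "emeasure lborel {a..b} = 0" using AE_iff_null_sets[of "{a..b}" lborel] by (simp add: null_setsD1)
  then show False using assms(2) by simp
qed

lemma continuous_bm_clamp:
  assumes "continuous_on {a..b} f" "a \<le> b"
  shows "bm (\<lambda>t. f (max a (min b t)))"
proof -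
  obtain C where C: "\<forall>y\<in>f ` {a..b}. norm y \<le> C"
    using compact_imp_bounded[OF compact_continuous_image[OF assms(1) compact_Icc]] unfolding bounded_iff by blast
  have "continuous_on UNIV (\<lambda>t. f (max a (min b t)))"
    by (rule continuous_on_compose2[OF assms(1)]) (use assms(2) in \<open>auto intro!: continuous_intros\<close>)
  moreover have "\<bar>f (max a (min b t))\<bar> \<le> C" for t using C assms(2) by force
  ultimately show ?thesis by (intro bmI[of _ C]) (auto intro: borel_measurable_continuous_onI)
qed

lemma geodesic_continuous:
  assumes "arclength_geodesic \<alpha> n T x" "j \<in> {1..n+1}"
  shows "continuous_on {0..T} (\<lambda>t. x t j)"
proof -
  obtain h where h: "horiz_control \<alpha> n 0 T x h" using assms unfolding arclength_geodesic_def horizontal_def by blast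
  let ?f = "\<lambda>s. h s j * xi \<alpha> j (x s)"
  have i: "set_integrable lborel {0..T} ?f" and e: "\<And>t. t \<in> {0..T} \<Longrightarrow> x t j = x 0 j + (LINT s:{0..t}|lborel. ?f s)"
    using h assms(2) unfolding horiz_control_def by blast+
  have "continuous_on {0..T} (\<lambda>t. x 0 j + integral {0..t} ?f)"
    using set_borel_integral_eq_integral(1)[OF i] by (intro continuous_intros indefinite_integral_continuous_1)
  moreover have "x 0 j + integral {0..t} ?f = x t j" if "t \<in> {0..T}" for t
    using e[OF that] set_borel_integral_eq_integral(2)[OF set_integrable_subset[OF i, of "{0..t}"]] that by auto
  ultimately show ?thesis by (rule continuous_on_eq)
qed

text \<open>Where \<open>\<xi>\<^sub>j = 0\<close> the \<open>j\<close>-th control is arbitrary; setting it to zero there gives the control of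
  least length, and this one has unit speed almost everywhere.\<close>

lemma arclength_control:
  assumes geo: "arclength_geodesic \<alpha> n T x"
  obtains u where "\<And>j. j \<in> {1..n+1} \<Longrightarrow> bm (\<lambda>t. u t j)" "\<And>t. (\<Sum>j\<in>{1..n+1}. (u t j)\<^sup>2) \<le> 1"
    "horiz_control \<alpha> n 0 T x u"
    "AE t in lborel. t \<in> {0..T} \<longrightarrow> (\<Sum>j\<in>{1..n+1}. (u t j)\<^sup>2) = 1"
proof -
  let ?N = "{1..n+1}"
  have T: "0 < T" and len: "\<And>s t. 0 \<le> s \<Longrightarrow> s \<le> t \<Longrightarrow> t \<le> T \<Longrightarrow> curve_length \<alpha> n s t x = t - s"
    using geo unfolding arclength_geodesic_def by blast+
  obtain h where h: "horiz_control \<alpha> n 0 T x h" using geo unfolding arclength_geodesic_def horizontal_def by blast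
  have h_i: "set_integrable lborel {0..T} (\<lambda>s. h s j)" "set_integrable lborel {0..T} (\<lambda>s. h s j * xi \<alpha> j (x s))"
    and h_e: "\<And>t. t \<in> {0..T} \<Longrightarrow> x t j = x 0 j + (LINT s:{0..t}|lborel. h s j * xi \<alpha> j (x s))" if "j \<in> ?N" for j
    using h that unfolding horiz_control_def by blast+
  define X where "X = (\<lambda>t. x (max 0 (min T t)))"
  have X_x: "X t = x t" if "t \<in> {0..T}" for t
  proof -
    have "max 0 (min T t) = t" using that by auto
    then show ?thesis by (simp add: X_def)
  qed
  have xi_bm: "bm (\<lambda>t. xi \<alpha> j (X t))" if "j \<in> ?N" for j
    unfolding xi_def X_def using that T
    by (intro bm_prod bm_power continuous_bm_clamp geodesic_continuous[OF geo]) auto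
  define u0 where "u0 = (\<lambda>t j. if xi \<alpha> j (X t) \<noteq> 0 then indicat_real {0..T} t * h t j else 0)"
  have u0_m: "(\<lambda>t. u0 t j) \<in> borel_measurable lborel" if j: "j \<in> ?N" for j
  proof -
    have [measurable]: "(\<lambda>t. xi \<alpha> j (X t)) \<in> borel_measurable borel" using bm_measurable[OF xi_bm[OF j]] .
    have [measurable]: "(\<lambda>t. indicat_real {0..T} t * h t j) \<in> borel_measurable borel"
      using h_i(1)[OF j] unfolding set_integrable_def by (auto dest: borel_measurable_integrable)
    show ?thesis unfolding u0_def by measurable
  qed
  have u0_i: "set_integrable lborel {0..T} (\<lambda>t. u0 t j)" if j: "j \<in> ?N" for j
  proof (rule set_integrable_bound[OF h_i(1)[OF j]])
    show "set_borel_measurable lborel {0..T} (\<lambda>t. u0 t j)"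
      using u0_m[OF j] unfolding set_borel_measurable_def by (intro borel_measurable_scaleR) auto
  qed (auto simp: u0_def indicator_def)
  have u0_xi: "u0 t j * xi \<alpha> j (x t) = h t j * xi \<alpha> j (x t)" if "t \<in> {0..T}" for t j
    using that by (simp add: u0_def X_x)
  have u0_ctrl: "horiz_control \<alpha> n 0 T x u0"
    unfolding horiz_control_def
  proof (intro conjI ballI)
    fix j assume j: "j \<in> ?N"
    show "set_integrable lborel {0..T} (\<lambda>s. u0 s j)" by (rule u0_i[OF j])
    show "set_integrable lborel {0..T} (\<lambda>s. u0 s j * xi \<alpha> j (x s))"
      using h_i(2)[OF j] u0_xi by (subst set_integrable_cong[OF refl refl u0_xi]) auto
    fix t assume t: "t \<in> {0..T}"
    have "(LINT s:{0..t}|lborel. u0 s j * xi \<alpha> j (x s)) = (LINT s:{0..t}|lborel. h s j * xi \<alpha> j (x s))"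
      by (rule LI_cong, rule u0_xi) (use t in auto)
    then show "x t j = x 0 j + (LINT s:{0..t}|lborel. u0 s j * xi \<alpha> j (x s))" using h_e[OF j t] by simp
  qed (use T in simp)
  \<comment> \<open>Any control of the curve agrees with u0 almost everywhere where xi_j is nonzero,
    and u0 is zero elsewhere; so u0 attains the infimum on every subinterval.\<close>
  have u0_min: "ctrl_length n s t u0 = t - s" if st: "0 \<le> s" "s \<le> t" "t \<le> T" for s t
  proof (rule antisym)
    have c: "horiz_control \<alpha> n s t x u0" by (rule horiz_control_subinterval[OF u0_ctrl st])
    show "t - s \<le> ctrl_length n s t u0" using curve_length_le[OF c] len[OF st] by simp
    have "ctrl_length n s t u0 \<le> curve_length \<alpha> n s t x"
      unfolding curve_length_def
    proof (rule cInf_greatest)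
      show "{ctrl_length n s t h |h. horiz_control \<alpha> n s t x h} \<noteq> {}" using c by blast
      fix l assume "l \<in> {ctrl_length n s t h |h. horiz_control \<alpha> n s t x h}"
      then obtain w where w: "horiz_control \<alpha> n s t x w" and l: "l = ctrl_length n s t w" by blast
      have "AE r in lborel. \<forall>j\<in>?N. r \<in> {s..t} \<longrightarrow> u0 r j * xi \<alpha> j (x r) = w r j * xi \<alpha> j (x r)"
        by (intro AE_finite_allI control_unique[OF c w]) auto
      then have ae: "AE r in lborel. r \<in> {s..t} \<longrightarrow> sqrt (\<Sum>j\<in>?N. (u0 r j)\<^sup>2) \<le> sqrt (\<Sum>j\<in>?N. (w r j)\<^sup>2)"
      proof eventually_elim
        case (elim r)
        show ?case
        proof
          assume r: "r \<in> {s..t}"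
          then have rT: "r \<in> {0..T}" using st by auto
          show "sqrt (\<Sum>j\<in>?N. (u0 r j)\<^sup>2) \<le> sqrt (\<Sum>j\<in>?N. (w r j)\<^sup>2)"
          proof (intro real_sqrt_le_mono sum_mono)
            fix j assume "j \<in> ?N"
            then have "u0 r j * xi \<alpha> j (x r) = w r j * xi \<alpha> j (x r)" using elim r by blast
            then show "(u0 r j)\<^sup>2 \<le> (w r j)\<^sup>2"
              by (cases "xi \<alpha> j (x r) = 0") (auto simp: u0_def X_x[OF rT])
          qed
        qed
      qed
      show "ctrl_length n s t u0 \<le> l"
        unfolding l ctrl_length_def
      proof (rule set_integral_mono_AE[OF _ _ ae])
        show "set_integrable lborel {s..t} (\<lambda>r. sqrt (\<Sum>j\<in>?N. (u0 r j)\<^sup>2))"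
          "set_integrable lborel {s..t} (\<lambda>r. sqrt (\<Sum>j\<in>?N. (w r j)\<^sup>2))"
          using c w unfolding horiz_control_def by (intro control_norm_integrable; blast)+
      qed
    qed
    then show "ctrl_length n s t u0 \<le> t - s" using len[OF st] by simp
  qed
  let ?L = "\<lambda>s. sqrt (\<Sum>j\<in>?N. (u0 s j)\<^sup>2)"
  have L_i: "set_integrable lborel {0..T} ?L" by (intro control_norm_integrable u0_i)
  \<comment> \<open>The length of u0 over [0,t] is t for every t, so its speed minus 1 has zero
    primitive.\<close>
  have "AE s in lborel. s \<in> {0..T} \<longrightarrow> ?L s - 1 = 0"
  proof (rule AE_zero_if_primitive_zero)
    show "set_integrable lborel {0..T} (\<lambda>s. ?L s - 1)" by (intro set_integral_diff(1) L_i bm_integrable bm_const)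
    fix t assume t: "t \<in> {0..T}"
    have "(LINT s:{0..t}|lborel. ?L s - 1) = (LINT s:{0..t}|lborel. ?L s) - (LINT s:{0..t}|lborel. 1)"
      by (intro set_integral_diff(2) set_integrable_subset[OF L_i] bm_integrable bm_const) (use t in auto)
    then show "(LINT s:{0..t}|lborel. ?L s - 1) = 0"
      using u0_min[of 0 t] LI_const[of 0 t 1] t by (simp add: ctrl_length_def)
  qed (use T in simp)
  then have L1: "AE s in lborel. s \<in> {0..T} \<longrightarrow> (\<Sum>j\<in>?N. (u0 s j)\<^sup>2) = 1"
    by eventually_elim (simp add: real_sqrt_eq_1_iff)
  \<comment> \<open>A change on a null set only, after which the bound 1 on the speed, and with it
    membership in \<open>bm\<close>, holds at every time.\<close>
  define u where "u = (\<lambda>t j. if (\<Sum>j\<in>?N. (u0 t j)\<^sup>2) \<le> 1 then u0 t j else 0)"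
  have u_unit: "(\<Sum>j\<in>?N. (u t j)\<^sup>2) \<le> 1" for t unfolding u_def by (cases "(\<Sum>j\<in>?N. (u0 t j)\<^sup>2) \<le> 1") auto
  have u_bd: "\<bar>u t j\<bar> \<le> 1" if "j \<in> ?N" for t j
  proof -
    have "(u t j)\<^sup>2 \<le> (\<Sum>j\<in>?N. (u t j)\<^sup>2)" using that by (intro member_le_sum) auto
    then have "(u t j)\<^sup>2 \<le> 1" using u_unit[of t] by linarith
    then show ?thesis by (simp add: abs_square_le_1)
  qed
  have u_bm: "bm (\<lambda>t. u t j)" if j: "j \<in> ?N" for j
  proof (rule bmI[OF _ u_bd[OF j]])
    have [measurable]: "(\<lambda>t. u0 t j) \<in> borel_measurable borel" using u0_m[OF j] by simp
    have [measurable]: "(\<lambda>t. \<Sum>j\<in>?N. (u0 t j)\<^sup>2) \<in> borel_measurable borel"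
      using u0_m by (intro borel_measurable_sum borel_measurable_power) simp
    show "(\<lambda>t. u t j) \<in> borel_measurable borel" unfolding u_def by measurable
  qed
  have u_eq: "AE t in lborel. t \<in> {0..T} \<longrightarrow> u t = u0 t" using L1 by eventually_elim (auto simp: u_def)
  have u_ctrl: "horiz_control \<alpha> n 0 T x u"
    unfolding horiz_control_def
  proof (intro conjI ballI)
    fix j assume j: "j \<in> ?N"
    show "set_integrable lborel {0..T} (\<lambda>s. u s j)" by (intro bm_integrable u_bm[OF j])
    have b: "bm (\<lambda>s. u s j * xi \<alpha> j (X s))" by (intro bm_mult u_bm xi_bm j)
    show "set_integrable lborel {0..T} (\<lambda>s. u s j * xi \<alpha> j (x s))"
      using bm_integrable[OF b, of 0 T] by (subst set_integrable_cong[OF refl refl, of _ _ "\<lambda>s. u s j * xi \<alpha> j (X s)"]) (auto simp: X_x)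
    fix t assume t: "t \<in> {0..T}"
    have "(LINT s:{0..t}|lborel. u s j * xi \<alpha> j (X s)) = (LINT s:{0..t}|lborel. u0 s j * xi \<alpha> j (X s))"
      unfolding set_lebesgue_integral_def
    proof (rule integral_cong_AE)
      show "(\<lambda>s. indicat_real {0..t} s *\<^sub>R (u s j * xi \<alpha> j (X s))) \<in> borel_measurable lborel"
        "(\<lambda>s. indicat_real {0..t} s *\<^sub>R (u0 s j * xi \<alpha> j (X s))) \<in> borel_measurable lborel"
        using bm_measurable[OF u_bm[OF j]] u0_m[OF j] bm_measurable[OF xi_bm[OF j]]
        by (intro borel_measurable_scaleR borel_measurable_times; simp)+
      show "AE s in lborel. indicat_real {0..t} s *\<^sub>R (u s j * xi \<alpha> j (X s)) = indicat_real {0..t} s *\<^sub>R (u0 s j * xi \<alpha> j (X s))"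
        using u_eq by eventually_elim (use t in \<open>auto simp: indicator_def\<close>)
    qed
    moreover have "(LINT s:{0..t}|lborel. u s j * xi \<alpha> j (X s)) = (LINT s:{0..t}|lborel. u s j * xi \<alpha> j (x s))"
      "(LINT s:{0..t}|lborel. u0 s j * xi \<alpha> j (X s)) = (LINT s:{0..t}|lborel. u0 s j * xi \<alpha> j (x s))"
      by (rule LI_cong; use t in \<open>simp add: X_x\<close>)+
    moreover have "x t j = x 0 j + (LINT s:{0..t}|lborel. u0 s j * xi \<alpha> j (x s))"
      using u0_ctrl j t unfolding horiz_control_def by blast
    ultimately show "x t j = x 0 j + (LINT s:{0..t}|lborel. u s j * xi \<alpha> j (x s))" by simp
  qed (use T in simp)
  have "AE t in lborel. t \<in> {0..T} \<longrightarrow> (\<Sum>j\<in>?N. (u t j)\<^sup>2) = 1"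
    using L1 u_eq by eventually_elim auto
  then show ?thesis using that[OF u_bm u_unit u_ctrl] by blast
qed

subsection \<open>Local Hamiltonian lifts\<close>

text \<open>Used to pass between a curve and its clamped version. The sum form of the force shows
  that only coordinates up to n + 1 enter, which the \<open>deriv\<close> in its definition
  hides.\<close>

lemma ham_on_cong:
  assumes h: "ham_on \<alpha> n a b x p"
    and "\<And>t j. t \<in> {a..b} \<Longrightarrow> j \<in> {1..n+1} \<Longrightarrow> x t j = x' t j \<and> p t j = p' t j"
  shows "ham_on \<alpha> n a b x' p'"
  unfolding ham_on_def
proof (intro ballI conjI)
  fix t j assume t: "t \<in> {a..b}" and j: "j \<in> {1..n+1}"
  have e: "x t i = x' t i" "p t i = p' t i" if "i \<in> {1..n+1}" for i using assms(2)[OF t that] by auto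
  have xi: "xi \<alpha> k (x t) = xi \<alpha> k (x' t)" if "k \<le> n + 1" for k
    by (rule xi_cong, rule e(1)) (use that in auto)
  have dxi: "dxi \<alpha> j k (x t) = dxi \<alpha> j k (x' t)" if "k \<le> n + 1" for k
  proof -
    have "(\<Prod>i\<in>{1..<k} - {j}. x t i ^ \<alpha> i) = (\<Prod>i\<in>{1..<k} - {j}. x' t i ^ \<alpha> i)"
    proof (rule prod.cong[OF refl])
      fix i assume "i \<in> {1..<k} - {j}"
      then have "i \<in> {1..n+1}" using that by auto
      from e(1)[OF this] show "x t i ^ \<alpha> i = x' t i ^ \<alpha> i" by (rule arg_cong)
    qed
    then show ?thesis unfolding dxi_def e(1)[OF j] by (rule arg_cong)
  qed
  have jn: "1 \<le> j" "j \<le> n + 1" using j by auto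
  have dH: "dHam_dx \<alpha> n j (x t) (p t) = dHam_dx \<alpha> n j (x' t) (p' t)"
    unfolding dHam_dx_sum[OF jn]
  proof (rule sum.cong[OF refl])
    fix k assume "k \<in> {Suc j..n+1}"
    then have k: "k \<in> {1..n+1}" "k \<le> n + 1" by auto
    show "dxi \<alpha> j k (x t) * xi \<alpha> k (x t) * (p t k)\<^sup>2 = dxi \<alpha> j k (x' t) * xi \<alpha> k (x' t) * (p' t k)\<^sup>2"
      unfolding xi[OF k(2)] dxi[OF k(2)] e(2)[OF k(1)] ..
  qed
  have d: "((\<lambda>s. x s j) has_real_derivative (xi \<alpha> j (x t))\<^sup>2 * p t j) (at t within {a..b})"
    "((\<lambda>s. p s j) has_real_derivative - dHam_dx \<alpha> n j (x t) (p t)) (at t within {a..b})"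
    using h t j unfolding ham_on_def by blast+
  show "((\<lambda>s. x' s j) has_real_derivative (xi \<alpha> j (x' t))\<^sup>2 * p' t j) (at t within {a..b})"
    using d(1) unfolding xi[OF jn(2)] e(2)[OF j]
    by (rule has_field_derivative_cong_on[OF _ t _ refl refl]) (rule assms(2)[OF _ j, THEN conjunct1])
  show "((\<lambda>s. p' s j) has_real_derivative - dHam_dx \<alpha> n j (x' t) (p' t)) (at t within {a..b})"
    using d(2) unfolding dH
    by (rule has_field_derivative_cong_on[OF _ t _ refl refl]) (rule assms(2)[OF _ j, THEN conjunct2])
qed

lemma ham_on_xi_continuous:
  assumes "ham_on \<alpha> n a b x p" "k \<le> n + 2"
  shows "continuous_on {a..b} (\<lambda>t. xi \<alpha> k (x t))"
  unfolding xi_def using assms by (intro continuous_intros ham_on_continuous(1)[OF assms(1)]) auto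

text \<open>The distance hypothesis makes b - a a lower bound for the length of every competitor,
  and continuity turns one time with xi_j nonzero into a nonzero integral of its square.\<close>

lemma local_lift:
  assumes ctrl: "horiz_control \<alpha> n 0 T x u" and u_bm: "\<And>j. j \<in> {1..n+1} \<Longrightarrow> bm (\<lambda>t. u t j)"
    and u_unit: "\<And>t. (\<Sum>j\<in>{1..n+1}. (u t j)\<^sup>2) \<le> 1"
    and cont: "\<And>j. j \<in> {1..n+1} \<Longrightarrow> continuous_on {0..T} (\<lambda>t. x t j)"
    and ab: "0 \<le> a" "a < b" "b \<le> T" and dist: "cc_dist \<alpha> n (x a) (x b) = b - a"
    and nz: "\<And>j. j \<in> {1..n+1} \<Longrightarrow> \<exists>t\<in>{a..b}. xi \<alpha> j (x t) \<noteq> 0"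
  shows "\<exists>p. ham_on \<alpha> n a b x p \<and> (\<forall>j\<in>{1..n+1}. AE t in lborel. t \<in> {a..b} \<longrightarrow> u t j = p t j * xi \<alpha> j (x t))"
proof -
  let ?N = "{1..n+1}"
  define X where "X = (\<lambda>t. x (max a (min b t)))"
  have X_x: "X t = x t" if "t \<in> {a..b}" for t
  proof -
    have "max a (min b t) = t" using that by auto
    then show ?thesis by (simp add: X_def)
  qed
  have cont_ab: "continuous_on {a..b} (\<lambda>t. x t j)" if "j \<in> ?N" for j
    by (rule continuous_on_subset[OF cont[OF that]]) (use ab in auto)
  interpret length_minimizer \<alpha> n a b X u
  proof
    show "a < b" by fact
    show "bm (\<lambda>t. X t j)" if "j \<in> ?N" for j
      unfolding X_def using continuous_bm_clamp[OF cont_ab[OF that]] ab by simp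
    show "bm (\<lambda>t. u t j)" if "j \<in> ?N" for j by (rule u_bm[OF that])
    show "(\<Sum>j\<in>?N. (u t j)\<^sup>2) \<le> 1" for t by (rule u_unit)
    show "X t j = X a j + (LINT s:{a..t}|lborel. u s j * xi \<alpha> j (X s))" if j: "j \<in> ?N" and t: "t \<in> {a..b}" for j t
    proof -
      have "horiz_control \<alpha> n a b x u" using horiz_control_subinterval[OF ctrl] ab by auto
      then have "x t j = x a j + (LINT s:{a..t}|lborel. u s j * xi \<alpha> j (x s))"
        using j t unfolding horiz_control_def by blast
      moreover have "(LINT s:{a..t}|lborel. u s j * xi \<alpha> j (X s)) = (LINT s:{a..t}|lborel. u s j * xi \<alpha> j (x s))"
        by (rule LI_cong) (use t in \<open>simp add: X_x\<close>)
      ultimately show ?thesis using t ab by (simp add: X_x)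
    qed
    show "b - a \<le> ctrl_length n a b w" if w: "horiz_control \<alpha> n a b Y w"
      and e: "\<And>j. j \<in> ?N \<Longrightarrow> Y a j = X a j \<and> Y b j = X b j" for Y w
    proof -
      have "cc_dist \<alpha> n (x a) (x b) \<le> ctrl_length n a b w"
        by (rule cc_dist_le[OF w]) (use e ab X_x[of a] X_x[of b] in auto)
      then show ?thesis using dist by simp
    qed
    show "(LINT s:{a..b}|lborel. (xi \<alpha> j (X s))\<^sup>2) \<noteq> 0" if j: "j \<in> ?N" for j
    proof
      assume z: "(LINT s:{a..b}|lborel. (xi \<alpha> j (X s))\<^sup>2) = 0"
      have c: "continuous_on {a..b} (\<lambda>s. (xi \<alpha> j (x s))\<^sup>2)"
        unfolding xi_def using j by (intro continuous_intros cont_ab) auto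
      have "(LINT s:{a..b}|lborel. (xi \<alpha> j (X s))\<^sup>2) = (LINT s:{a..b}|lborel. (xi \<alpha> j (x s))\<^sup>2)"
        by (rule LI_cong) (simp add: X_x)
      also have "\<dots> = integral {a..b} (\<lambda>s. (xi \<alpha> j (x s))\<^sup>2)"
        by (intro set_borel_integral_eq_integral(2) borel_integrable_atLeastAtMost' c)
      finally have "integral {a..b} (\<lambda>s. (xi \<alpha> j (x s))\<^sup>2) = 0" using z by simp
      then have "\<forall>t\<in>{a..b}. (xi \<alpha> j (x t))\<^sup>2 = 0" using integral_eq_0_iff[OF c ab(2)] by simp
      then show False using nz[OF j] by simp
    qed
  qed
  obtain p where p: "ham_on \<alpha> n a b X p" "\<forall>j\<in>?N. AE t in lborel. t \<in> {a..b} \<longrightarrow> u t j = p t j * xi \<alpha> j (X t)"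
    using ham_on_exists by blast
  have "ham_on \<alpha> n a b x p" by (rule ham_on_cong[OF p(1)]) (simp add: X_x)
  moreover have "\<forall>j\<in>?N. AE t in lborel. t \<in> {a..b} \<longrightarrow> u t j = p t j * xi \<alpha> j (x t)"
  proof
    fix j assume "j \<in> ?N"
    with p(2) have "AE t in lborel. t \<in> {a..b} \<longrightarrow> u t j = p t j * xi \<alpha> j (X t)" by blast
    then show "AE t in lborel. t \<in> {a..b} \<longrightarrow> u t j = p t j * xi \<alpha> j (x t)"
      by eventually_elim (simp add: X_x)
  qed
  ultimately show ?thesis by blast
qed

subsection \<open>Singular times are nowhere dense\<close>

lemma continuous_nonzero_interval:
  fixes f :: "real \<Rightarrow> real"
  assumes c: "continuous_on {a..b} f" and t: "t \<in> {a..b}" and "a < b" "f t \<noteq> 0"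
  obtains c' d' where "a \<le> c'" "c' < d'" "d' \<le> b" "\<And>s. s \<in> {c'..d'} \<Longrightarrow> f s \<noteq> 0"
proof -
  obtain d where d: "0 < d" "\<And>s. s \<in> {a..b} \<Longrightarrow> dist s t < d \<Longrightarrow> dist (f s) (f t) < \<bar>f t\<bar>"
    using c t assms(4) unfolding continuous_on_iff by (metis zero_less_abs_iff)
  \<comment> \<open>t may be an end point, so a one-sided interval of length r is taken; since r is
    at most half of b - a, it fits on the right or on the left of t.\<close>
  define r where "r = min (d / 2) ((b - a) / 2)"
  have r: "0 < r" "r < d" "r \<le> (b - a) / 2" using d(1) assms(3) by (auto simp: r_def min_def)
  have nz: "f s \<noteq> 0" if "s \<in> {a..b}" "\<bar>s - t\<bar> \<le> r" for s
    using d(2)[OF that(1)] that(2) r by (auto simp: dist_real_def)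
  show ?thesis
  proof (cases "t + r \<le> b")
    case True
    show ?thesis by (rule that[of t "t + r"]) (use True r t nz in auto)
  next
    case False
    have "b < t + r" using False by simp
    then have "a \<le> t - r" using r(3) t by (auto simp: field_simps)
    then show ?thesis by (intro that[of "t - r" t]) (use r t nz in auto)
  qed
qed

text \<open>If \<open>x\<^sub>j\<close> vanished on an interval on which \<open>\<xi>\<^sub>j \<noteq> 0\<close>, then \<open>p\<^sub>j\<close> would vanish there, so the
  conserved quantity \<open>R\<^sub>j\<close> would be zero and \<open>x\<^sub>j\<close> constant, equal to its nonzero initial value.\<close>

lemma xi_nonzero_dense:
  assumes h: "ham_on \<alpha> n 0 \<tau> x p" and riem: "riemannian_point \<alpha> n (x 0)"
    and j: "1 \<le> j" "j \<le> n + 1" and cd: "0 \<le> c" "c < d" "d \<le> \<tau>"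
  shows "\<exists>t\<in>{c..d}. xi \<alpha> j (x t) \<noteq> 0"
  using j cd
proof (induction j arbitrary: c d rule: dec_induct)
  case base
  then show ?case by (auto simp: xi_1 intro!: bexI[of _ c])
next
  case (step j)
  have jn: "1 \<le> j" "j \<le> n" "j \<le> n + 1" "j \<le> n + 2" using step by auto
  obtain t where t: "t \<in> {c..d}" "xi \<alpha> j (x t) \<noteq> 0" using step.IH[of c d] step.prems jn by auto
  have "continuous_on {c..d} (\<lambda>t. xi \<alpha> j (x t))"
    using continuous_on_subset[OF ham_on_xi_continuous[OF h jn(4)]] step.prems by auto
  from continuous_nonzero_interval[OF this t(1) \<open>c < d\<close> t(2)]
  obtain c' d' where cd': "c \<le> c'" "c' < d'" "d' \<le> d" "\<And>s. s \<in> {c'..d'} \<Longrightarrow> xi \<alpha> j (x s) \<noteq> 0" by blast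
  show ?case
  proof (rule ccontr)
    assume "\<not> ?case"
    then have z: "xi \<alpha> (Suc j) (x s) = 0" if "s \<in> {c..d}" for s using that by blast
    have xz: "x s j ^ \<alpha> j = 0" if "s \<in> {c'..d'}" for s
      using z[of s] cd'(4)[OF that] that cd' jn(1) by (auto simp: xi_Suc)
    have a: "\<alpha> j \<noteq> 0" using xz[of c'] cd'(2) by (auto intro: ccontr)
    have x0: "x s j = 0" if "s \<in> {c'..d'}" for s using xz[OF that] by simp
    \<comment> \<open>An interior time, where x_j, being locally zero, has an ordinary derivative to
      compare with xi_j^2 p_j.\<close>
    define m where "m = (c' + d') / 2"
    have m: "c' < m" "m < d'" using cd' by (auto simp: m_def)
    have mI: "m \<in> {0..\<tau>}" "0 < m" "m < \<tau>" using m cd' step.prems by auto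
    have "((\<lambda>s. x s j) has_real_derivative (xi \<alpha> j (x m))\<^sup>2 * p m j) (at m)"
      using ham_onD(1)[OF h mI(1) jn(1,3)] mI by (simp add: at_within_Icc_at)
    moreover have "((\<lambda>s. x s j) has_real_derivative 0) (at m)"
    proof (rule has_field_derivative_transform_within_open[of "\<lambda>s. 0" 0 m "{c'<..<d'}"])
      show "0 = x s j" if "s \<in> {c'<..<d'}" for s using x0[of s] that by auto
    qed (use m in auto)
    ultimately have "(xi \<alpha> j (x m))\<^sup>2 * p m j = 0" by (rule DERIV_unique)
    then have "p m j = 0" using cd'(4)[of m] m by simp
    then have "R_sq \<alpha> n (x m) (p m) j = 0" using x0[of m] m a jn by (simp add: R_sq_step)
    then have R0: "R_sq \<alpha> n (x 0) (p 0) j = 0" using R_sq_const[OF h mI(1) jn(1,4)] by simp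
    have "0 \<le> x 0 j ^ (2 * \<alpha> j)" by simp
    then have "0 \<le> R_sq \<alpha> n (x 0) (p 0) (Suc j) * x 0 j ^ (2 * \<alpha> j)" using R_sq_nonneg by (rule mult_nonneg_nonneg[rotated])
    then have "R_sq \<alpha> n (x 0) (p 0) (Suc j) * x 0 j ^ (2 * \<alpha> j) = 0"
      using R0 R_sq_step[OF jn(3), of \<alpha> "x 0" "p 0"] by (smt (verit) zero_le_power2)
    \<comment> \<open>R_j^2 dominates p_j^2 at every time, so its vanishing spreads from one time to
      all.\<close>
    have pz: "p s j = 0" if "s \<in> {0..\<tau>}" for s
    proof -
      have "R_sq \<alpha> n (x s) (p s) j = 0" using R_sq_const[OF h that jn(1,4)] R0 by simp
      moreover have "0 \<le> R_sq \<alpha> n (x s) (p s) (Suc j) * x s j ^ (2 * \<alpha> j)"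
        by (intro mult_nonneg_nonneg R_sq_nonneg) simp
      ultimately have "(p s j)\<^sup>2 \<le> 0" using R_sq_step[OF jn(3), of \<alpha> "x s" "p s"] by linarith
      then show ?thesis by simp
    qed
    have "((\<lambda>s. x s j) has_real_derivative 0) (at s within {0..\<tau>})" if "s \<in> {0..\<tau>}" for s
      using ham_onD(1)[OF h that jn(1,3)] pz[OF that] by simp
    then have "\<exists>k. \<forall>s\<in>{0..\<tau>}. x s j = k" by (intro has_field_derivative_zero_constant) auto
    then obtain k where k: "\<forall>s\<in>{0..\<tau>}. x s j = k" by blast
    have "x 0 j = 0" using k mI x0[of m] m by auto
    then show False using riem jn a unfolding riemannian_point_def by auto
  qed
qed

section \<open>Uniqueness of the covector and gluing\<close>

text \<open>The equation for x_j' determines p_j wherever xi_j is nonzero. Such times are dense, and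
  p_j is continuous.\<close>

lemma covector_unique:
  assumes hp: "ham_on \<alpha> n a b x p" and hq: "ham_on \<alpha> n a b x q" and ab: "a < b"
    and dense: "\<And>c d j. a \<le> c \<Longrightarrow> c < d \<Longrightarrow> d \<le> b \<Longrightarrow> j \<in> {1..n+1} \<Longrightarrow> \<exists>t\<in>{c..d}. xi \<alpha> j (x t) \<noteq> 0"
    and t: "t \<in> {a..b}" and j: "j \<in> {1..n+1}"
  shows "p t j = q t j"
proof (rule ccontr)
  assume ne: "p t j \<noteq> q t j"
  have j': "1 \<le> j" "j \<le> n + 1" using j by auto
  have cont: "continuous_on {a..b} (\<lambda>s. p s j - q s j)"
    by (intro continuous_intros ham_on_continuous(2)[OF hp j'] ham_on_continuous(2)[OF hq j'])
  have "p t j - q t j \<noteq> 0" using ne by simp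
  from continuous_nonzero_interval[OF cont t ab this]
  obtain c d where cd: "a \<le> c" "c < d" "d \<le> b" "\<And>s. s \<in> {c..d} \<Longrightarrow> p s j - q s j \<noteq> 0" by blast
  obtain s where s: "s \<in> {c..d}" "xi \<alpha> j (x s) \<noteq> 0" using dense[OF cd(1-3) j] by blast
  then have sI: "s \<in> {a..b}" using cd by auto
  \<comment> \<open>Makes the derivative within the interval unique also when s is an end
    point.\<close>
  have "at s within {a..b} \<noteq> bot" using sI ab by (simp add: trivial_limit_within islimpt_Icc)
  then have "(xi \<alpha> j (x s))\<^sup>2 * p s j = (xi \<alpha> j (x s))\<^sup>2 * q s j"
    by (rule has_field_derivative_unique[OF ham_onD(1)[OF hp sI j'] ham_onD(1)[OF hq sI j']])
  then show False using s(2) cd(4)[OF s(1)] by simp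
qed

lemma ham_on_glue:
  assumes hp: "ham_on \<alpha> n a c x p" and hq: "ham_on \<alpha> n b d x q" and o: "a \<le> b" "b < c" "c \<le> d"
    and eq: "\<And>t j. t \<in> {b..c} \<Longrightarrow> j \<in> {1..n+1} \<Longrightarrow> p t j = q t j"
  shows "\<exists>r. ham_on \<alpha> n a d x r \<and> (\<forall>t\<in>{a..c}. r t = p t)"
proof -
  define r where "r = (\<lambda>t. if t \<le> c then p t else q t)"
  have h1: "ham_on \<alpha> n a c x r" by (rule ham_on_cong[OF hp]) (simp add: r_def)
  have h2: "ham_on \<alpha> n c d x r"
    by (rule ham_on_cong[OF ham_on_subset[OF hq]]) (use o eq in \<open>auto simp: r_def\<close>)
  have "ham_on \<alpha> n a d x r"
    unfolding ham_on_def
  proof (intro ballI conjI)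
    fix t j assume t: "t \<in> {a..d}" and j: "j \<in> {1..n+1}"
    show "((\<lambda>s. x s j) has_real_derivative (xi \<alpha> j (x t))\<^sup>2 * r t j) (at t within {a..d})"
      by (rule has_field_derivative_Icc_join[where b = c]) (use h1 h2 j o in \<open>auto simp: ham_on_def\<close>)
    show "((\<lambda>s. r s j) has_real_derivative - dHam_dx \<alpha> n j (x t) (r t)) (at t within {a..d})"
      by (rule has_field_derivative_Icc_join[where b = c and d = "\<lambda>t. - dHam_dx \<alpha> n j (x t) (r t)"])
         (use h1 h2 j o in \<open>auto simp: ham_on_def\<close>)
  qed
  then show ?thesis by (intro exI[of _ r]) (simp add: r_def)
qed

subsection \<open>The global lift\<close>

text \<open>The radius of local minimality depends on the time; a Lebesgue number of the cover by
  these balls gives one length that serves everywhere, so finitely many steps exhaust [0,T].\<close>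

lemma uniform_minimality:
  assumes "arclength_geodesic \<alpha> n T x"
  obtains \<delta> where "0 < \<delta>" "\<And>s1 s2. s1 \<in> {0..T} \<Longrightarrow> s2 \<in> {0..T} \<Longrightarrow> \<bar>s1 - s2\<bar> < \<delta> \<Longrightarrow> cc_dist \<alpha> n (x s1) (x s2) = \<bar>s2 - s1\<bar>"
proof -
  have "\<forall>t\<in>{0..T}. \<exists>\<epsilon>>0. \<forall>s1\<in>{0..T}. \<forall>s2\<in>{0..T}. \<bar>s1 - t\<bar> < \<epsilon> \<longrightarrow> \<bar>s2 - t\<bar> < \<epsilon> \<longrightarrow>
        cc_dist \<alpha> n (x s1) (x s2) = \<bar>s2 - s1\<bar>"
    using assms unfolding arclength_geodesic_def by blast
  then obtain \<epsilon> where \<epsilon>: "\<forall>t\<in>{0..T}. 0 < \<epsilon> t \<and> (\<forall>s1\<in>{0..T}. \<forall>s2\<in>{0..T}. \<bar>s1 - t\<bar> < \<epsilon> t \<longrightarrow> \<bar>s2 - t\<bar> < \<epsilon> t \<longrightarrow>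
        cc_dist \<alpha> n (x s1) (x s2) = \<bar>s2 - s1\<bar>)"
    using bchoice[of "{0..T}" "\<lambda>t e. 0 < e \<and> (\<forall>s1\<in>{0..T}. \<forall>s2\<in>{0..T}. \<bar>s1 - t\<bar> < e \<longrightarrow> \<bar>s2 - t\<bar> < e \<longrightarrow>
        cc_dist \<alpha> n (x s1) (x s2) = \<bar>s2 - s1\<bar>)"] by blast
  have T: "0 < T" using assms unfolding arclength_geodesic_def by blast
  let ?C = "(\<lambda>t. ball t (\<epsilon> t)) ` {0..T}"
  obtain \<delta> where \<delta>: "0 < \<delta>" "\<And>S. S \<subseteq> {0..T} \<Longrightarrow> diameter S < \<delta> \<Longrightarrow> \<exists>B\<in>?C. S \<subseteq> B"
  proof (rule Lebesgue_number_lemma[of "{0..T}" ?C])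
    show "{0..T} \<subseteq> \<Union> ?C" using \<epsilon> by force
  qed (use T in auto)
  show ?thesis
  proof (rule that[OF \<delta>(1)])
    fix s1 s2 assume s: "s1 \<in> {0..T}" "s2 \<in> {0..T}" "\<bar>s1 - s2\<bar> < \<delta>"
    have "diameter {s1, s2} \<le> \<bar>s1 - s2\<bar>"
      by (rule diameter_le) (auto simp: abs_minus_commute)
    then have "\<exists>B\<in>?C. {s1, s2} \<subseteq> B" using s by (intro \<delta>(2)) auto
    then obtain t where t: "t \<in> {0..T}" "s1 \<in> ball t (\<epsilon> t)" "s2 \<in> ball t (\<epsilon> t)" by auto
    then show "cc_dist \<alpha> n (x s1) (x s2) = \<bar>s2 - s1\<bar>"
      using \<epsilon> s by (auto simp: dist_real_def abs_minus_commute)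
  qed
qed

lemma riemannian_xi_nonzero:
  assumes "riemannian_point \<alpha> n x0" "j \<le> n + 1"
  shows "xi \<alpha> j x0 \<noteq> 0"
  using assms by (auto simp: xi_def riemannian_point_def)

text \<open>Forward continuation from time 0, where all weights are nonzero because the point is
  Riemannian. Later intervals find their nonsingular times inside the part already lifted.\<close>

lemma lift_exists:
  assumes geo: "arclength_geodesic \<alpha> n T x" and riem: "riemannian_point \<alpha> n (x 0)"
  shows "\<exists>p. ham_lift \<alpha> n T x p"
proof -
  let ?N = "{1..n+1}"
  have T: "0 < T" using geo unfolding arclength_geodesic_def by blast
  obtain u where u: "\<And>j. j \<in> ?N \<Longrightarrow> bm (\<lambda>t. u t j)" "\<And>t. (\<Sum>j\<in>?N. (u t j)\<^sup>2) \<le> 1"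
    "horiz_control \<alpha> n 0 T x u" "AE t in lborel. t \<in> {0..T} \<longrightarrow> (\<Sum>j\<in>?N. (u t j)\<^sup>2) = 1"
    using arclength_control[OF geo] by blast
  obtain \<delta> where \<delta>: "0 < \<delta>" "\<And>s1 s2. s1 \<in> {0..T} \<Longrightarrow> s2 \<in> {0..T} \<Longrightarrow> \<bar>s1 - s2\<bar> < \<delta> \<Longrightarrow> cc_dist \<alpha> n (x s1) (x s2) = \<bar>s2 - s1\<bar>"
    using uniform_minimality[OF geo] by blast
  have loc: "\<exists>p. ham_on \<alpha> n a b x p \<and> (\<forall>j\<in>?N. AE t in lborel. t \<in> {a..b} \<longrightarrow> u t j = p t j * xi \<alpha> j (x t))"
    if "0 \<le> a" "a < b" "b \<le> T" "b - a < \<delta>" "\<And>j. j \<in> ?N \<Longrightarrow> \<exists>t\<in>{a..b}. xi \<alpha> j (x t) \<noteq> 0" for a b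
  proof (rule local_lift[OF u(3) u(1) u(2) geodesic_continuous[OF geo] that(1-3) _ that(5)])
    show "cc_dist \<alpha> n (x a) (x b) = b - a" using \<delta>(2)[of a b] that by auto
  qed
  \<comment> \<open>A new interval reaches back by at most s and forward by at most s, so its length
    2 s stays below the length of uniform minimality.\<close>
  define s where "s = \<delta> / 3"
  have s: "0 < s" "2 * s < \<delta>" using \<delta>(1) by (auto simp: s_def)
  define e where "e = min T s"
  have e: "0 < e" "e \<le> T" "e \<le> s" using T s by (auto simp: e_def)
  have "\<exists>t\<in>{0..e}. xi \<alpha> j (x t) \<noteq> 0" if "j \<in> ?N" for j
    using riemannian_xi_nonzero[OF riem, of j] that e by (intro bexI[of _ 0]) auto
  then obtain p1 where p1: "ham_on \<alpha> n 0 e x p1" "\<forall>j\<in>?N. AE t in lborel. t \<in> {0..e} \<longrightarrow> u t j = p1 t j * xi \<alpha> j (x t)"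
    using loc[of 0 e] e s by auto
  \<comment> \<open>Agreement with the first local lift is carried along because the relation u = p
    xi is retained on [0,e] only, where it will fix the energy.\<close>
  have lifts: "\<exists>p. ham_on \<alpha> n 0 (min T (e + real k * s)) x p \<and> (\<forall>t\<in>{0..e}. p t = p1 t)" for k
  proof (induction k)
    case 0
    have "min T (e + real 0 * s) = e" using e by simp
    then show ?case using p1(1) by auto
  next
    case (Suc k)
    define c where "c = min T (e + real k * s)"
    define d where "d = min T (e + real (Suc k) * s)"
    obtain p where p: "ham_on \<alpha> n 0 c x p" "\<forall>t\<in>{0..e}. p t = p1 t" using Suc unfolding c_def by blast
    have ks: "0 \<le> real k * s" using s by simp
    have cd: "e \<le> c" "c \<le> d" "d \<le> c + s" "c \<le> T" "d \<le> T"
      using e ks s by (auto simp: c_def d_def min_def algebra_simps)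
    define b where "b = max 0 (c - s)"
    have b: "0 \<le> b" "b < c" "d - b < \<delta>" using cd s e by (auto simp: b_def)
    have dense: "\<exists>t\<in>{c1..d1}. xi \<alpha> j (x t) \<noteq> 0" if "j \<in> ?N" "0 \<le> c1" "c1 < d1" "d1 \<le> c" for c1 d1 j
      by (rule xi_nonzero_dense[OF p(1) riem]) (use that in auto)
    have "\<exists>t\<in>{b..d}. xi \<alpha> j (x t) \<noteq> 0" if jN: "j \<in> ?N" for j
    proof -
      obtain t where "t \<in> {b..c}" "xi \<alpha> j (x t) \<noteq> 0" using dense[OF jN b(1,2) order_refl] by blast
      then show ?thesis using cd by (intro bexI[of _ t]) auto
    qed
    then obtain q where q: "ham_on \<alpha> n b d x q" using loc[of b d] b cd by auto
    have "p t j = q t j" if t: "t \<in> {b..c}" and j: "j \<in> ?N" for t j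
    proof (rule covector_unique[OF _ _ b(2) _ t j])
      show "ham_on \<alpha> n b c x p" by (rule ham_on_subset[OF p(1)]) (use b in auto)
      show "ham_on \<alpha> n b c x q" by (rule ham_on_subset[OF q]) (use cd in auto)
      show "\<exists>t\<in>{c1..d1}. xi \<alpha> j (x t) \<noteq> 0" if "b \<le> c1" "c1 < d1" "d1 \<le> c" "j \<in> ?N" for c1 d1 j
        by (rule dense) (use that b in auto)
    qed
    then obtain r where "ham_on \<alpha> n 0 d x r" "\<forall>t\<in>{0..c}. r t = p t"
      using ham_on_glue[OF p(1) q b(1,2) cd(2)] by blast
    moreover from this p(2) cd(1) have "\<forall>t\<in>{0..e}. r t = p1 t" by auto
    ultimately show ?case unfolding d_def by blast
  qed
  obtain k :: nat where "T \<le> real k * s"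
    using real_arch_simple[of "T / s"] s by (auto simp: field_simps)
  then have "min T (e + real k * s) = T" using e by simp
  with lifts[of k] obtain p where p: "ham_on \<alpha> n 0 T x p" "\<forall>t\<in>{0..e}. p t = p1 t" by auto
  have "AE t in lborel. \<forall>j\<in>?N. t \<in> {0..e} \<longrightarrow> u t j = p1 t j * xi \<alpha> j (x t)"
    using p1(2) by (intro AE_finite_allI) auto
  with u(4) have "AE t in lborel. t \<in> {0..e} \<longrightarrow> (\<Sum>j\<in>?N. (xi \<alpha> j (x t))\<^sup>2 * (p t j)\<^sup>2) = 1"
  proof eventually_elim
    case (elim t)
    show ?case
    proof
      assume t: "t \<in> {0..e}"
      have "(\<Sum>j\<in>?N. (xi \<alpha> j (x t))\<^sup>2 * (p t j)\<^sup>2) = (\<Sum>j\<in>?N. (u t j)\<^sup>2)"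
        using elim(2) t p(2) by (intro sum.cong refl) (auto simp: power_mult_distrib)
      then show "(\<Sum>j\<in>?N. (xi \<alpha> j (x t))\<^sup>2 * (p t j)\<^sup>2) = 1" using elim(1) t e by auto
    qed
  qed
  \<comment> \<open>One time of unit speed suffices, since H is half of the conserved
    \<open>R_sq\<close> at 1.\<close>
  from AE_on_Icc_ex[OF this e(1)] obtain t where t: "t \<in> {0..e}" "(\<Sum>j\<in>?N. (xi \<alpha> j (x t))\<^sup>2 * (p t j)\<^sup>2) = 1" by blast
  have "Ham \<alpha> n (x t) (p t) = 1 / 2" unfolding Ham_def t(2) by simp
  moreover have "R_sq \<alpha> n (x t) (p t) (Suc 0) = R_sq \<alpha> n (x 0) (p 0) (Suc 0)"
    by (rule R_sq_const[OF p(1)]) (use t e in auto)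
  ultimately have "Ham \<alpha> n (x 0) (p 0) = 1 / 2" by (simp add: Ham_eq_R_sq)
  then show ?thesis using p(1) by (auto simp: ham_lift_iff)
qed

subsection \<open>Explicit solution\<close>

lemma gronwall_zero:
  fixes E E' :: "real \<Rightarrow> real"
  assumes d: "\<And>t. t \<in> {0..T} \<Longrightarrow> (E has_real_derivative E' t) (at t within {0..T})"
    and le: "\<And>t. t \<in> {0..T} \<Longrightarrow> E' t \<le> C * E t" and nonneg: "\<And>t. t \<in> {0..T} \<Longrightarrow> 0 \<le> E t"
    and zero: "E 0 = 0" and t: "t \<in> {0..T}"
  shows "E t = 0"
proof -
  let ?G = "\<lambda>t. E t * exp (- C * t)"
  have "?G t \<le> ?G 0"
  proof (rule DERIV_nonpos_imp_decreasing_open[of 0 t ?G])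
    fix s assume s: "0 < s" "s < t"
    then have sI: "s \<in> {0..T}" using t by auto
    then have "(E has_real_derivative E' s) (at s)" using d[OF sI] s t by (simp add: at_within_Icc_at)
    then have "(?G has_real_derivative (E' s - C * E s) * exp (- C * s)) (at s)"
      by (auto intro!: derivative_eq_intros simp: algebra_simps)
    moreover have "(E' s - C * E s) * exp (- C * s) \<le> 0"
      using le[OF sI] by (intro mult_nonpos_nonneg) auto
    ultimately show "\<exists>y. (?G has_real_derivative y) (at s) \<and> y \<le> 0" by blast
  next
    have "continuous_on {0..T} E" by (rule DERIV_continuous_on[OF d])
    then have "continuous_on {0..t} E" by (rule continuous_on_subset) (use t in auto)
    then show "continuous_on {0..t} ?G" by (intro continuous_intros)
  qed (use t in auto)
  then have "E t * exp (- C * t) \<le> 0" using zero by simp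
  then have "E t \<le> 0" by (simp add: mult_le_0_iff not_le[symmetric])
  then show ?thesis using nonneg[OF t] by linarith
qed

text \<open>Uniqueness is shown in the original time, because the change of time \<open>\<integral> \<xi>\<^sub>j\<^sup>2\<close>
  degenerates where \<open>\<xi>\<^sub>j = 0\<close>.\<close>

lemma oscillator_unique:
  fixes x p y q k :: "real \<Rightarrow> real"
  assumes x: "\<And>t. t \<in> {0..T} \<Longrightarrow> (x has_real_derivative k t * p t) (at t within {0..T})"
    and p: "\<And>t. t \<in> {0..T} \<Longrightarrow> (p has_real_derivative - (k t * (c * x t ^ N))) (at t within {0..T})"
    and y: "\<And>t. t \<in> {0..T} \<Longrightarrow> (y has_real_derivative k t * q t) (at t within {0..T})"
    and q: "\<And>t. t \<in> {0..T} \<Longrightarrow> (q has_real_derivative - (k t * (c * y t ^ N))) (at t within {0..T})"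
    and k: "continuous_on {0..T} k" and init: "x 0 = y 0" "p 0 = q 0" and t: "t \<in> {0..T}"
  shows "x t = y t \<and> p t = q t"
proof -
  \<comment> \<open>Divided difference of the N-th power: it makes the difference of the two forces
    linear in x - y with a continuous coefficient.\<close>
  define S where "S = (\<lambda>t. \<Sum>i<N. y t ^ (N - Suc i) * x t ^ i)"
  have S: "x t ^ N - y t ^ N = (x t - y t) * S t" for t
    unfolding S_def by (rule power_diff_sumr2)
  have cont: "continuous_on {0..T} x" "continuous_on {0..T} y"
    by (rule DERIV_continuous_on[OF x], assumption) (rule DERIV_continuous_on[OF y])
  \<comment> \<open>The derivative of the squared distance of the two solutions is 2 (x - y) (p - q)
    B; B is bounded on [0,T], so Gronwall applies.\<close>
  define B where "B = (\<lambda>t. k t * (1 - c * S t))"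
  have "continuous_on {0..T} B" unfolding B_def S_def by (intro continuous_intros cont k)
  then have "bounded (B ` {0..T})" by (intro compact_imp_bounded compact_continuous_image compact_Icc)
  then obtain C where "\<forall>t\<in>{0..T}. \<bar>B t\<bar> \<le> C" unfolding bounded_iff by auto
  then have C: "\<And>t. t \<in> {0..T} \<Longrightarrow> \<bar>B t\<bar> \<le> C" by blast
  define E where "E = (\<lambda>t. (x t - y t)\<^sup>2 + (p t - q t)\<^sup>2)"
  have "E t = 0"
  proof (rule gronwall_zero[OF _ _ _ _ t])
    fix s assume s: "s \<in> {0..T}"
    have eq: "2 * (x s - y s) * (p s - q s) * B s = 2 * (x s - y s) * (k s * p s - k s * q s) + 2 * (p s - q s) * (- (k s * (c * x s ^ N)) - - (k s * (c * y s ^ N)))"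
    proof -
      have e: "x s ^ N = y s ^ N + (x s - y s) * S s" using S[of s] by simp
      show ?thesis unfolding B_def e by (simp add: algebra_simps)
    qed
    show "(E has_real_derivative 2 * (x s - y s) * (p s - q s) * B s) (at s within {0..T})"
      unfolding E_def eq
      by (auto intro!: derivative_eq_intros x[OF s] y[OF s] p[OF s] q[OF s] simp: algebra_simps)
    have "2 * (x s - y s) * (p s - q s) * B s \<le> \<bar>2 * (x s - y s) * (p s - q s)\<bar> * \<bar>B s\<bar>"
      by (metis abs_ge_self abs_mult)
    also have "\<dots> \<le> E s * C"
    proof (rule mult_mono)
      have "0 \<le> (x s - y s + (p s - q s))\<^sup>2" "0 \<le> (x s - y s - (p s - q s))\<^sup>2" by simp_all
      then show "\<bar>2 * (x s - y s) * (p s - q s)\<bar> \<le> E s"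
        unfolding E_def power2_sum power2_diff by linarith
    qed (use C[OF s] in \<open>auto simp: E_def\<close>)
    finally show "2 * (x s - y s) * (p s - q s) * B s \<le> C * E s" by (simp add: mult.commute)
    show "0 \<le> E s" by (simp add: E_def)
  qed (simp add: E_def init)
  then show ?thesis by (simp add: E_def sum_power2_eq_zero_iff)
qed

lemma lift_time_deriv:
  assumes "ham_on \<alpha> n 0 T x p" "1 \<le> j" "j \<le> n + 1" "t \<in> {0..T}"
  shows "((\<lambda>t. LINT r:{0..t}|lborel. (xi \<alpha> j (x r))\<^sup>2) has_real_derivative (xi \<alpha> j (x t))\<^sup>2) (at t within {0..T})"
proof -
  have c: "continuous_on {0..T} (\<lambda>r. (xi \<alpha> j (x r))\<^sup>2)"
    by (intro continuous_intros ham_on_xi_continuous[OF assms(1)]) (use assms in auto)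
  have "integral {0..t} (\<lambda>r. (xi \<alpha> j (x r))\<^sup>2) = (LINT r:{0..t}|lborel. (xi \<alpha> j (x r))\<^sup>2)" if "t \<in> {0..T}" for t
    by (intro set_borel_integral_eq_integral(2)[symmetric] borel_integrable_atLeastAtMost' continuous_on_subset[OF c]) (use that in auto)
  then show ?thesis
    by (rule has_field_derivative_cong_on[OF integral_has_real_derivative[OF c assms(4)] assms(4) _ refl refl])
qed

text \<open>In either case the coupling \<alpha>_j R_(j+1)^2 vanishes, and by conservation it does
  so at all times; hence p_j is constant.\<close>

lemma free_solution:
  assumes h: "ham_on \<alpha> n 0 T x p" and j: "1 \<le> j" "j \<le> n + 1" and t: "t \<in> {0..T}"
    and free: "R_const \<alpha> n (x 0) (p 0) (Suc j) = 0 \<or> \<alpha> j = 0"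
  shows "x t j = x 0 j + p 0 j * (LINT r:{0..t}|lborel. (xi \<alpha> j (x r))\<^sup>2) \<and> p t j = p 0 j"
proof -
  have T: "0 \<in> {0..T}" using t by auto
  have "((\<lambda>s. p s j) has_real_derivative 0) (at s within {0..T})" if s: "s \<in> {0..T}" for s
  proof -
    have "real (\<alpha> j) * R_sq \<alpha> n (x s) (p s) (Suc j) = 0"
      using free R_sq_const[OF h s, of "Suc j"] j by (auto simp: R_sq_zero)
    then show ?thesis using ham_onD(2)[OF h s j] by (auto simp: mult.assoc)
  qed
  then have "\<exists>k. \<forall>s\<in>{0..T}. p s j = k" by (intro has_field_derivative_zero_constant) auto
  then have pc: "p s j = p 0 j" if "s \<in> {0..T}" for s using that T by metis
  let ?S = "\<lambda>t. LINT r:{0..t}|lborel. (xi \<alpha> j (x r))\<^sup>2"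
  have "((\<lambda>s. x s j - p 0 j * ?S s) has_real_derivative 0) (at s within {0..T})" if s: "s \<in> {0..T}" for s
    using ham_onD(1)[OF h s j] lift_time_deriv[OF h j s]
    by (auto intro!: derivative_eq_intros simp: pc[OF s])
  then have "\<exists>k. \<forall>s\<in>{0..T}. x s j - p 0 j * ?S s = k" by (intro has_field_derivative_zero_constant) auto
  then have "x t j - p 0 j * ?S t = x 0 j - p 0 j * ?S 0" using t T by metis
  moreover have "?S 0 = 0" using LI_point[of 0 "\<lambda>r. (xi \<alpha> j (x r))\<^sup>2"] by simp
  ultimately show ?thesis using pc[OF t] by simp
qed

text \<open>A nonzero R_(j+1) forces D_j and the sine of \<open>\<phi> j\<close> to be nonzero, so
  A_j and \<omega>_j are meaningful. They satisfy A \<omega> = D_j, which matches p_j at time 0, and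
  the energy relation R_(j+1)^2 A^(2 \<alpha>_j) = D_j^2.\<close>

lemma oscillating_solution:
  assumes h: "ham_on \<alpha> n 0 T x p" and j: "1 \<le> j" "j \<le> n" and t: "t \<in> {0..T}"
    and riem: "riemannian_point \<alpha> n (x 0)" and sph: "spherical_coords \<alpha> n (x 0) (p 0) \<phi>"
    and R: "R_const \<alpha> n (x 0) (p 0) (Suc j) \<noteq> 0" and a: "\<alpha> j \<noteq> 0"
  defines "s \<equiv> (LINT r:{0..t}|lborel. (xi \<alpha> j (x r))\<^sup>2)"
  shows "x t j = A_coef \<alpha> (x 0) \<phi> j * sin_a (\<alpha> j) (omega \<alpha> (x 0) \<phi> j * s + \<phi> j) \<and>
    p t j = A_coef \<alpha> (x 0) \<phi> j * omega \<alpha> (x 0) \<phi> j * cos_a (\<alpha> j) (omega \<alpha> (x 0) \<phi> j * s + \<phi> j)"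
proof -
  have a1: "1 \<le> \<alpha> j" using a by simp
  have j': "j \<le> n + 1" using j by simp
  have at: "alpha_t \<alpha> j = \<alpha> j" "x_t \<alpha> (x 0) j = x 0 j" using a by (auto simp: alpha_t_def x_t_def)
  have x0: "x 0 j \<noteq> 0" using riem j a unfolding riemannian_point_def by auto
  let ?\<sigma> = "sin_a (\<alpha> j) (\<phi> j)"
  define D where "D = D_prod \<alpha> (x 0) \<phi> j"
  have Rsq: "R_sq \<alpha> n (x 0) (p 0) (Suc j) = (D * sdelta \<alpha> (x 0) \<phi> j)\<^sup>2"
    using R_sq_spherical[OF riem sph, of "Suc j"] j by (simp add: D_prod_Suc D_def)
  then have nz: "D \<noteq> 0" "sdelta \<alpha> (x 0) \<phi> j \<noteq> 0" using R by (auto simp: R_sq_zero[symmetric])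
  have sg: "?\<sigma> \<noteq> 0" using nz(2) by (auto simp: sdelta_def at rho_def)
  define A where "A = A_coef \<alpha> (x 0) \<phi> j"
  define w where "w = omega \<alpha> (x 0) \<phi> j"
  have A: "A = x 0 j / ?\<sigma>" by (simp add: A_def A_coef_def)
  have A0: "A \<noteq> 0" using x0 sg by (simp add: A)
  have w: "w = D / A" by (simp add: w_def omega_def A D_def D_prod_def)
  have Aw: "A * w = D" using A0 by (simp add: w)
  have Rval: "R_sq \<alpha> n (x 0) (p 0) (Suc j) * A ^ (2 * \<alpha> j) = D\<^sup>2"
  proof -
    have "(sdelta \<alpha> (x 0) \<phi> j)\<^sup>2 = (?\<sigma> / x 0 j) ^ (2 * \<alpha> j)"
      using a1 by (simp add: sdelta_def at rho_squared)
    also have "?\<sigma> / x 0 j = inverse A" by (simp add: A)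
    finally have "(sdelta \<alpha> (x 0) \<phi> j)\<^sup>2 * A ^ (2 * \<alpha> j) = 1"
      using A0 by (simp add: power_inverse)
    then show ?thesis unfolding Rsq power_mult_distrib by (simp add: mult.assoc)
  qed
  define c where "c = real (\<alpha> j) * R_sq \<alpha> n (x 0) (p 0) (Suc j)"
  let ?k = "\<lambda>t. (xi \<alpha> j (x t))\<^sup>2"
  define S where "S = (\<lambda>t. LINT r:{0..t}|lborel. (xi \<alpha> j (x r))\<^sup>2)"
  define y where "y = (\<lambda>t. A * sin_a (\<alpha> j) (w * S t + \<phi> j))"
  define q where "q = (\<lambda>t. A * w * cos_a (\<alpha> j) (w * S t + \<phi> j))"
  have "x t j = y t \<and> p t j = q t"
  proof (rule oscillator_unique[where k = ?k and c = c and N = "2 * \<alpha> j - 1", OF _ _ _ _ _ _ _ t])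
    fix r assume r: "r \<in> {0..T}"
    show "((\<lambda>s. x s j) has_real_derivative ?k r * p r j) (at r within {0..T})"
      by (rule ham_onD(1)[OF h r j(1) j'])
    have "R_sq \<alpha> n (x r) (p r) (Suc j) = R_sq \<alpha> n (x 0) (p 0) (Suc j)"
      by (rule R_sq_const[OF h r]) (use j in auto)
    then show "((\<lambda>s. p s j) has_real_derivative - (?k r * (c * x r j ^ (2 * \<alpha> j - 1)))) (at r within {0..T})"
      using ham_onD(2)[OF h r j(1) j'] by (simp add: c_def ac_simps)
    have dS: "(S has_real_derivative ?k r) (at r within {0..T})"
      unfolding S_def by (rule lift_time_deriv[OF h j(1) j' r])
    have inner: "((\<lambda>t. w * S t + \<phi> j) has_real_derivative w * ?k r) (at r within {0..T})"
      by (auto intro!: derivative_eq_intros dS)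
    have "((\<lambda>t. sin_a (\<alpha> j) (w * S t + \<phi> j)) has_real_derivative cos_a (\<alpha> j) (w * S r + \<phi> j) * (w * ?k r)) (at r within {0..T})"
      by (rule DERIV_chain2[OF sin_a_has_derivative[OF a1] inner])
    from DERIV_cmult[OF this, of A]
    show "(y has_real_derivative ?k r * q r) (at r within {0..T})"
      unfolding y_def q_def by (simp add: ac_simps)
    have dc: "((\<lambda>t. cos_a (\<alpha> j) (w * S t + \<phi> j)) has_real_derivative
      - (real (\<alpha> j) * sin_a (\<alpha> j) (w * S r + \<phi> j) ^ (2 * \<alpha> j - 1)) * (w * ?k r)) (at r within {0..T})"
      by (rule DERIV_chain2[OF cos_a_has_derivative[OF a1] inner])
    \<comment> \<open>The frequency condition for A sin_a(\<omega> s + \<phi>) to solve the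
      oscillator equation; it is the energy relation with D = A \<omega> and one factor A
      cancelled.\<close>
    have "R_sq \<alpha> n (x 0) (p 0) (Suc j) * A ^ (2 * \<alpha> j - 1) = A * w * w"
    proof -
      have e: "A * A ^ (2 * \<alpha> j - 1) = A ^ (2 * \<alpha> j)" using a1 by (simp add: power_minus_mult mult.commute flip: power_Suc)
      have "A * (R_sq \<alpha> n (x 0) (p 0) (Suc j) * A ^ (2 * \<alpha> j - 1)) = R_sq \<alpha> n (x 0) (p 0) (Suc j) * (A * A ^ (2 * \<alpha> j - 1))"
        by (rule mult.left_commute)
      also have "\<dots> = D\<^sup>2" unfolding e by (rule Rval)
      also have "\<dots> = A * (A * w * w)" unfolding Aw[symmetric] by (simp add: power2_eq_square)
      finally show ?thesis using A0 by (simp only: mult_cancel_left) simp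
    qed
    then have e: "c * y r ^ (2 * \<alpha> j - 1) = A * w * w * (real (\<alpha> j) * sin_a (\<alpha> j) (w * S r + \<phi> j) ^ (2 * \<alpha> j - 1))"
      unfolding c_def y_def power_mult_distrib by (simp add: ac_simps)
    show "(q has_real_derivative - (?k r * (c * y r ^ (2 * \<alpha> j - 1)))) (at r within {0..T})"
      unfolding e using DERIV_cmult[OF dc, of "A * w"] unfolding q_def by (simp add: ac_simps)
  next
    show "continuous_on {0..T} ?k"
      by (intro continuous_intros ham_on_xi_continuous[OF h]) (use j in auto)
    have S0: "S 0 = 0" using LI_point[of 0 "\<lambda>r. (xi \<alpha> j (x r))\<^sup>2"] by (simp add: S_def)
    show "x 0 j = y 0" using sg by (simp add: y_def S0 A)
    have "p 0 j = cos_a (alpha_t \<alpha> j) (\<phi> j) * D"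
      using sph j unfolding spherical_coords_def D_def D_prod_def by auto
    then show "p 0 j = q 0" by (simp add: q_def S0 Aw at)
  qed
  then show ?thesis by (simp add: y_def q_def S_def s_def A_def w_def)
qed

theorem mainTheorem8:
  fixes \<alpha> :: "nat \<Rightarrow> nat" and n :: nat and T :: real and x :: "real \<Rightarrow> nat \<Rightarrow> real"
  assumes "1 \<le> n"
    and "riemannian_point \<alpha> n (x 0)"
    and "arclength_geodesic \<alpha> n T x"
  shows "\<exists>p. ham_lift \<alpha> n T x p \<and>
           (\<forall>q. ham_lift \<alpha> n T x q \<longrightarrow> (\<forall>t\<in>{0..T}. \<forall>j\<in>{1..n+1}. q t j = p t j)) \<and>
           (\<exists>\<phi>. spherical_coords \<alpha> n (x 0) (p 0) \<phi>) \<and>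
           (\<forall>\<phi>. spherical_coords \<alpha> n (x 0) (p 0) \<phi> \<longrightarrow>
              (\<forall>j\<in>{1..n+1}. \<forall>t\<in>{0..T}.
                 let s = (LINT u:{0..t}|lborel. (xi \<alpha> j (x u))^2) in
                 (if R_const \<alpha> n (x 0) (p 0) (j+1) = 0 \<or> \<alpha> j = 0
                  then x t j = x 0 j + p 0 j * s \<and> p t j = p 0 j
                  else x t j = A_coef \<alpha> (x 0) \<phi> j * sin_a (\<alpha> j) (omega \<alpha> (x 0) \<phi> j * s + \<phi> j) \<and>
                       p t j = A_coef \<alpha> (x 0) \<phi> j * omega \<alpha> (x 0) \<phi> j *
                               cos_a (\<alpha> j) (omega \<alpha> (x 0) \<phi> j * s + \<phi> j))))"
proof -
  note n = assms(1) and riem = assms(2) and geo = assms(3)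
  have T: "0 < T" using geo unfolding arclength_geodesic_def by blast
  obtain p where p: "ham_lift \<alpha> n T x p" using lift_exists[OF geo riem] by blast
  then have h: "ham_on \<alpha> n 0 T x p" and H: "Ham \<alpha> n (x 0) (p 0) = 1/2" by (auto simp: ham_lift_iff)
  have "q t j = p t j" if q: "ham_lift \<alpha> n T x q" and t: "t \<in> {0..T}" and j: "j \<in> {1..n+1}" for q t j
  proof (rule covector_unique[OF _ h T _ t j])
    show "ham_on \<alpha> n 0 T x q" using q by (simp add: ham_lift_iff)
    show "\<exists>t\<in>{c..d}. xi \<alpha> j (x t) \<noteq> 0" if "0 \<le> c" "c < d" "d \<le> T" "j \<in> {1..n+1}" for c d j
      by (rule xi_nonzero_dense[OF h riem]) (use that in auto)
  qed
  moreover have "\<exists>\<phi>. spherical_coords \<alpha> n (x 0) (p 0) \<phi>" by (rule spherical_coords_exist[OF riem n H])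
  moreover have "let s = (LINT u:{0..t}|lborel. (xi \<alpha> j (x u))^2) in
                 (if R_const \<alpha> n (x 0) (p 0) (j+1) = 0 \<or> \<alpha> j = 0
                  then x t j = x 0 j + p 0 j * s \<and> p t j = p 0 j
                  else x t j = A_coef \<alpha> (x 0) \<phi> j * sin_a (\<alpha> j) (omega \<alpha> (x 0) \<phi> j * s + \<phi> j) \<and>
                       p t j = A_coef \<alpha> (x 0) \<phi> j * omega \<alpha> (x 0) \<phi> j *
                               cos_a (\<alpha> j) (omega \<alpha> (x 0) \<phi> j * s + \<phi> j))"
    if \<phi>: "spherical_coords \<alpha> n (x 0) (p 0) \<phi>" and j: "j \<in> {1..n+1}" and t: "t \<in> {0..T}" for \<phi> j t
  proof (cases "R_const \<alpha> n (x 0) (p 0) (Suc j) = 0 \<or> \<alpha> j = 0")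
    case True
    have "x t j = x 0 j + p 0 j * (LINT r:{0..t}|lborel. (xi \<alpha> j (x r))\<^sup>2) \<and> p t j = p 0 j"
      by (rule free_solution[OF h _ _ t True]) (use j in auto)
    then show ?thesis using True unfolding Let_def Suc_eq_plus1 by (simp only: if_True)
  next
    case False
    \<comment> \<open>The top coordinate is always in the free case because R_(n+2) = 0, whatever
      the value of \<alpha> at n + 1.\<close>
    have "j \<noteq> n + 1"
    proof
      assume "j = n + 1"
      then have "R_const \<alpha> n (x 0) (p 0) (Suc j) = 0" by (simp add: R_const_def)
      then show False using False by blast
    qed
    then have jn: "1 \<le> j" "j \<le> n" using j by auto
    show ?thesis
      using oscillating_solution[OF h jn t riem \<phi>] False unfolding Let_def Suc_eq_plus1 by (simp only: if_False de_Morgan_disj) simp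
  qed
  ultimately show ?thesis using p by blast
qed

end
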